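(* Let $q$ be a prime power, $n$ a positive integer, $\mathcal{E}=\mathbb{F}_q^n$, and let $\mathcal{M}=(\mathcal{E},\rho)$ be a $q$-matroid of rank $k=\rho(\mathcal{E})$. Let $N=Cl(\mathcal{M})^*$ be the dual of the classical matroid associated to $\mathcal{M}$. Then for every $s$ with $0\le s\le n$, the $s$-th generalized weight polynomial of $\mathcal{M}$ is $$P_{\mathcal{M},s}(X)=\sum_{l=0}^{k}\sum_{i=0}^{k}(-1)^i\left(\beta^{(l)}_{i,[s]}(N)-\beta^{(l-1)}_{i,[s]}(N)\right)X^l .$$ Consequently, if $\mathcal{M}=\mathcal{M}_{\mathcal{C}}$ is the $q$-matroid of a Gabidulin rank-metric code $\mathcal{C}\subseteq\mathbb{F}_{q^m}^n$ of dimension $k$, then for every $r\ge 1$ and $\tilde{Q}=q^{mr}$, the number of codewords of rank weight $s$ in $\tilde{\mathcal{C}}$ equals $$A_{\mathcal{C},s}(\tilde{Q})=\sum_{l=0}^{k}\sum_{i=0}^{k}(-1)^i\left(\beta^{(l)}_{i,[s]}(N)-\beta^{(l-1)}_{i,[s]}(N)\right)\tilde{Q}^l .$$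
   Context: $q$-matroids: $\Sigma(\mathcal{E})$ is the set of $\mathbb{F}_q$-subspaces of $\mathcal{E}=\mathbb{F}_q^n$. A $q$-matroid is a pair $(\mathcal{E},\rho)$ with $\rho:\Sigma(\mathcal{E})\to\mathbb{N}_0$ such that $0\le\rho(X)\le\dim X$, $\rho(X)\le\rho(Y)$ whenever $X\subseteq Y$, and $\rho(X+Y)+\rho(X\cap Y)\le\rho(X)+\rho(Y)$. For $X\in\Sigma(\mathcal{E})$, $X^\perp$ is its orthogonal complement for the standard dot product. The dual $q$-matroid is $\mathcal{M}^*=(\mathcal{E},\rho^* )$ with $\rho^*(X)=\dim X+\rho(X^\perp)-\rho(\mathcal{E})$; its nullity is $\eta^*(X)=\dim X-\rho^*(X)$. Classical matroid: $P(\mathcal{E})$ denotes the set of $1$-dimensional subspaces of $\mathcal{E}$ (so $|P(\mathcal{E})|=\frac{q^n-1}{q-1}$), and for a subspace $U$, $P(U)$ is the set of $1$-dimensional subspaces of $U$. $Cl(\mathcal{M})$ is the matroid on $P(\mathcal{E})$ with rank function $\mathbf{r}_\rho(S)=\rho(\langle S\rangle)$, $\langle S\rangle$ the span. For a matroid $(E,\mathbf{r})$, its dual has rank $\mathbf{r}^*(Y)=|Y|+\mathbf{r}(E\setminus Y)-\mathbf{r}(E)$ and its nullity function is $\mathbf{n}(Y)=|Y|-\mathbf{r}(Y)$. The $l$-th elongation of a matroid $M=(E,\mathbf{r})$ is $M^{(l)}=(E,\mathbf{r}^{(l)})$, $\mathbf{r}^{(l)}(Y)=\min\{|Y|,\mathbf{r}(Y)+l\}$,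 $0\le l\le |E|-\mathbf{r}(E)$. Betti numbers: for a matroid $M$ on $E$, let $S=\mathbb{K}[x_e:e\in E]$ ($\mathbb{K}$ a field), $I_M$ the ideal generated by the monomials $\prod_{e\in\sigma}x_e$ with $\sigma$ dependent in $M$; $\beta_{i,\sigma}(M)$ ($\sigma\subseteq E$) are the $\mathbb{N}^{E}$-graded Betti numbers of a minimal free resolution of $S/I_M$ over $S$ and $\beta_{i,j}(M)=\sum_{|\sigma|=j}\beta_{i,\sigma}(M)$ (independent of $\mathbb{K}$). $\beta^{(l)}_{i,j}(M)$ denotes $\beta_{i,j}(M^{(l)})$, with the convention $\beta^{(-1)}_{i,j}=0$. Notation: $[j]=q^{n-1}+q^{n-2}+\cdots+q^{n-j}$ for $1\le j\le n$, and $[0]=0$. Generalized weight polynomial: for a subspace $U\subseteq\mathcal{E}$ of dimension $s$, fix a basis of $U$ identifying $U$ with $\mathbb{F}_q^s$ and its standard dot product, and let $\mathcal{M}_U=(U,\rho_U)$ be the $q$-matroid on $U$ whose dual (with respect to this dot product) has nullity $\eta_U^*(V)=\eta^*(V)$ for all subspaces $V\subseteq U$ (i.e. $\mathcal{M}_U^*$ is the restriction of $\mathcal{M}^*$ to $U$). Let $\mathbf{n}^*_{Cl(\mathcal{M}_U)}$ be the nullity function of $Cl(\mathcal{M}_U)^*$ (a matroid on $P(U)$). Then $P_{\mathcal{M},s}(X)=(-1)^{\frac{q^s-1}{q-1}}\sum_{U\subseteq\mathcal{E},\ \dim U=s}\ \sum_{\gamma\subseteq P(U)}(-1)^{|\gamma|}X^{\mathbf{n}^*_{Cl(\mathcal{M}_U)}(\gamma)}\in\mathbb{Z}[X]$.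 Gabidulin codes: a Gabidulin rank-metric code is an $\mathbb{F}_{q^m}$-linear subspace $\mathcal{C}\subseteq\mathbb{F}_{q^m}^n$ of dimension $k$. Fixing an $\mathbb{F}_q$-basis of $\mathbb{F}_{q^m}$, a vector $c=(c_1,\dots,c_n)$ is represented by the $m\times n$ matrix over $\mathbb{F}_q$ whose $j$-th column is the coordinate vector of $c_j$; its rank support $Rsupp(c)\subseteq\mathbb{F}_q^n$ is the row space of this matrix and its rank weight is $\dim Rsupp(c)$. For $X\in\Sigma(\mathcal{E})$, $\mathcal{C}(X)=\{c\in\mathcal{C}:Rsupp(c)\subseteq X\}$. The $q$-matroid of $\mathcal{C}$ is $\mathcal{M}_\mathcal{C}=(\mathcal{E},\rho_\mathcal{C})$ with $\rho_\mathcal{C}(X)=k-\dim_{\mathbb{F}_{q^m}}\mathcal{C}(X^\perp)$. For $r\ge1$, $\tilde{\mathcal{C}}=\mathcal{C}\otimes_{\mathbb{F}_{q^m}}\mathbb{F}_{q^{mr}}$ is the $\mathbb{F}_{q^{mr}}$-span of $\mathcal{C}$ in $\mathbb{F}_{q^{mr}}^n$, with rank support and rank weight defined in the same way using an $\mathbb{F}_q$-basis of $\mathbb{F}_{q^{mr}}$. *)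

theory Defs
  imports
    "HOL-Analysis.Cartesian_Space"
    "HOL-Analysis.Finite_Cartesian_Product"
    "HOL-Library.Poly_Mapping"
    "HOL-Computational_Algebra.Polynomial"
begin

section \<open>q-matroids\<close>

text \<open>
  The field with \<open>q\<close> elements is a type \<open>'a :: {field, finite}\<close>, so \<open>q = CARD('a)\<close>, and the
  ambient space is \<open>'a ^ 'n\<close>. Rank functions are only meaningful on subspaces of the
  ground space \<open>U\<close>; their values elsewhere are irrelevant.
\<close>

definition q_matroid :: "('a::field ^ 'n) set \<Rightarrow> (('a ^ 'n) set \<Rightarrow> nat) \<Rightarrow> bool" where
  "q_matroid U \<rho> \<longleftrightarrow>
     vec.subspace U \<and>
     (\<forall>X. vec.subspace X \<and> X \<subseteq> U \<longrightarrow> \<rho> X \<le> vec.dim X) \<and>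
     (\<forall>X Y. vec.subspace X \<and> vec.subspace Y \<and> X \<subseteq> Y \<and> Y \<subseteq> U \<longrightarrow> \<rho> X \<le> \<rho> Y) \<and>
     (\<forall>X Y. vec.subspace X \<and> X \<subseteq> U \<and> vec.subspace Y \<and> Y \<subseteq> U \<longrightarrow>
        \<rho> {x + y | x y. x \<in> X \<and> y \<in> Y} + \<rho> (X \<inter> Y) \<le> \<rho> X + \<rho> Y)"

definition std_dot :: "'a::field ^ 'n \<Rightarrow> 'a ^ 'n \<Rightarrow> 'a" where
  "std_dot x y = (\<Sum>i\<in>UNIV. x $ i * y $ i)"

text \<open>
  The standard dot product transported to the span of \<open>b\<close> along the coordinates with
  respect to the basis \<open>b\<close>. It does not depend on an ordering of the basis.
\<close>

definition basis_dot :: "('a::field ^ 'n) set \<Rightarrow> 'a ^ 'n \<Rightarrow> 'a ^ 'n \<Rightarrow> 'a" where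
  "basis_dot b x y = (\<Sum>v\<in>b. vec.representation b x v * vec.representation b y v)"

definition perp ::
    "('a::field ^ 'n \<Rightarrow> 'a ^ 'n \<Rightarrow> 'a) \<Rightarrow> ('a ^ 'n) set \<Rightarrow> ('a ^ 'n) set \<Rightarrow> ('a ^ 'n) set" where
  "perp f U X = {y \<in> U. \<forall>x\<in>X. f x y = 0}"

text \<open>
  For q-matroids the truncated subtractions in \<open>q_dual\<close>, \<open>q_nullity\<close> (and below in \<open>mdual\<close>,
  \<open>nullity\<close> for matroids) are genuine subtractions.
\<close>

definition q_dual ::
    "('a::field ^ 'n \<Rightarrow> 'a ^ 'n \<Rightarrow> 'a) \<Rightarrow> ('a ^ 'n) set \<Rightarrow> (('a ^ 'n) set \<Rightarrow> nat) \<Rightarrow> ('a ^ 'n) set \<Rightarrow> nat"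
  where "q_dual f U \<rho> X = vec.dim X + \<rho> (perp f U X) - \<rho> U"

definition q_nullity :: "(('a::field ^ 'n) set \<Rightarrow> nat) \<Rightarrow> ('a ^ 'n) set \<Rightarrow> nat" where
  "q_nullity \<rho> X = vec.dim X - \<rho> X"

text \<open>
  The rank function of the q-matroid on \<open>U\<close>, with dot product given by the basis \<open>b\<close> of \<open>U\<close>,
  whose dual has the nullity function of the dual of \<open>(UNIV, \<rho>)\<close>. Its values on subspaces of \<open>U\<close>
  are uniquely determined; the choice only concerns the irrelevant other arguments.
\<close>

definition q_local ::
    "('a::field ^ 'n) set \<Rightarrow> (('a ^ 'n) set \<Rightarrow> nat) \<Rightarrow> ('a ^ 'n) set \<Rightarrow> ('a ^ 'n) set \<Rightarrow> nat" where
  "q_local b \<rho> U = (SOME \<rho>\<^sub>U. q_matroid U \<rho>\<^sub>U \<and>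
     (\<forall>V. vec.subspace V \<and> V \<subseteq> U \<longrightarrow>
        q_nullity (q_dual (basis_dot b) U \<rho>\<^sub>U) V = q_nullity (q_dual std_dot UNIV \<rho>) V))"


section \<open>Matroids given by rank functions\<close>

record 'e matroid =
  ground :: "'e set"
  rnk :: "'e set \<Rightarrow> nat"

definition mdual :: "'e matroid \<Rightarrow> 'e matroid" where
  "mdual M = \<lparr>ground = ground M,
              rnk = (\<lambda>Y. card Y + rnk M (ground M - Y) - rnk M (ground M))\<rparr>"

definition nullity :: "'e matroid \<Rightarrow> 'e set \<Rightarrow> nat" where
  "nullity M Y = card Y - rnk M Y"

definition elongation :: "nat \<Rightarrow> 'e matroid \<Rightarrow> 'e matroid" where
  "elongation l M = \<lparr>ground = ground M, rnk = (\<lambda>Y. min (card Y) (rnk M Y + l))\<rparr>"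

definition dependent_sets :: "'e matroid \<Rightarrow> 'e set set" where
  "dependent_sets M = {\<sigma>. \<sigma> \<subseteq> ground M \<and> rnk M \<sigma> < card \<sigma>}"

definition points :: "('a::field ^ 'n) set \<Rightarrow> ('a ^ 'n) set set" where
  "points U = {L. vec.subspace L \<and> vec.dim L = 1 \<and> L \<subseteq> U}"

definition Cl :: "('a::field ^ 'n) set \<Rightarrow> (('a ^ 'n) set \<Rightarrow> nat) \<Rightarrow> ('a ^ 'n) set matroid" where
  "Cl U \<rho> = \<lparr>ground = points U, rnk = (\<lambda>S. \<rho> (vec.span (\<Union>S)))\<rparr>"


section \<open>Multigraded Betti numbers\<close>

text \<open>
  Exponent vectors are finitely supported functions \<open>'e \<Rightarrow>\<^sub>0 nat\<close>, and multivariate polynomials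
  finitely supported functions from these to the coefficient field, with convolution product.
\<close>

type_synonym ('e, 'k) mvpoly = "('e \<Rightarrow>\<^sub>0 nat) \<Rightarrow>\<^sub>0 'k"

definition poly_ring :: "'e set \<Rightarrow> ('e, 'k::field) mvpoly set" where
  "poly_ring E = {p. \<forall>m\<in>Poly_Mapping.keys p. Poly_Mapping.keys m \<subseteq> E}"

definition set_exponent :: "'e set \<Rightarrow> 'e \<Rightarrow>\<^sub>0 nat" where
  "set_exponent \<sigma> = (\<Sum>e\<in>\<sigma>. Poly_Mapping.single e 1)"

definition set_monomial :: "'e set \<Rightarrow> ('e, 'k::field) mvpoly" where
  "set_monomial \<sigma> = Poly_Mapping.single (set_exponent \<sigma>) 1"

definition matroid_ideal :: "'e matroid \<Rightarrow> ('e, 'k::field) mvpoly set" where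
  "matroid_ideal M = {(\<Sum>\<sigma>\<in>dependent_sets M. f \<sigma> * set_monomial \<sigma>) | f.
     \<forall>\<sigma>\<in>dependent_sets M. f \<sigma> \<in> poly_ring (ground M)}"

text \<open>
  Data of a multigraded complex \<open>\<dots> \<rightarrow> F\<^sub>2 \<rightarrow> F\<^sub>1 \<rightarrow> F\<^sub>0 \<rightarrow> S/I\<close> of finitely generated free modules:
  \<open>F\<^sub>i\<close> has basis elements indexed by \<open>j < fr_rank i\<close>, in multidegrees \<open>fr_deg i j\<close>; the matrix
  \<open>fr_diff i\<close> (row, column) describes \<open>F\<^bsub>i+1\<^esub> \<rightarrow> F\<^sub>i\<close>; and the \<open>j\<close>-th basis element of \<open>F\<^sub>0\<close> is sent
  to the class of \<open>fr_aug j\<close>.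
\<close>

record (overloaded) ('e, 'k) free_complex =
  fr_rank :: "nat \<Rightarrow> nat"
  fr_deg :: "nat \<Rightarrow> nat \<Rightarrow> 'e \<Rightarrow>\<^sub>0 nat"
  fr_diff :: "nat \<Rightarrow> nat \<Rightarrow> nat \<Rightarrow> ('e \<Rightarrow>\<^sub>0 nat) \<Rightarrow>\<^sub>0 'k"
  fr_aug :: "nat \<Rightarrow> ('e \<Rightarrow>\<^sub>0 nat) \<Rightarrow>\<^sub>0 'k"

definition free_module :: "'e set \<Rightarrow> nat \<Rightarrow> (nat \<Rightarrow> ('e, 'k::field) mvpoly) set" where
  "free_module E b = {v. (\<forall>j<b. v j \<in> poly_ring E) \<and> (\<forall>j\<ge>b. v j = 0)}"

definition apply_diff ::
    "('e, 'k::field) free_complex \<Rightarrow> nat \<Rightarrow> (nat \<Rightarrow> ('e, 'k) mvpoly) \<Rightarrow> nat \<Rightarrow> ('e, 'k) mvpoly" where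
  "apply_diff F i v = (\<lambda>r. if r < fr_rank F i
     then \<Sum>c<fr_rank F (Suc i). fr_diff F i r c * v c else 0)"

definition apply_aug ::
    "('e, 'k::field) free_complex \<Rightarrow> (nat \<Rightarrow> ('e, 'k) mvpoly) \<Rightarrow> ('e, 'k) mvpoly" where
  "apply_aug F v = (\<Sum>j<fr_rank F 0. v j * fr_aug F j)"

text \<open>All maps are homogeneous of degree \<open>0\<close>.\<close>

definition multigraded_complex :: "'e set \<Rightarrow> ('e, 'k::field) free_complex \<Rightarrow> bool" where
  "multigraded_complex E F \<longleftrightarrow>
     (\<forall>i. \<forall>j<fr_rank F i. Poly_Mapping.keys (fr_deg F i j) \<subseteq> E) \<and>
     (\<forall>j<fr_rank F 0. fr_aug F j \<in> poly_ring E \<and>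
        (\<forall>m\<in>Poly_Mapping.keys (fr_aug F j). m = fr_deg F 0 j)) \<and>
     (\<forall>i. \<forall>r<fr_rank F i. \<forall>c<fr_rank F (Suc i). fr_diff F i r c \<in> poly_ring E \<and>
        (\<forall>m\<in>Poly_Mapping.keys (fr_diff F i r c). m + fr_deg F i r = fr_deg F (Suc i) c))"

definition resolves_quotient ::
    "'e set \<Rightarrow> ('e, 'k::field) mvpoly set \<Rightarrow> ('e, 'k) free_complex \<Rightarrow> bool" where
  "resolves_quotient E I F \<longleftrightarrow>
     (\<forall>p\<in>poly_ring E. \<exists>v\<in>free_module E (fr_rank F 0). p - apply_aug F v \<in> I) \<and>
     (\<forall>v\<in>free_module E (fr_rank F 0).
        apply_aug F v \<in> I \<longleftrightarrow> (\<exists>w\<in>free_module E (fr_rank F 1). v = apply_diff F 0 w)) \<and>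
     (\<forall>i. \<forall>v\<in>free_module E (fr_rank F (Suc i)).
        apply_diff F i v = (\<lambda>_. 0) \<longleftrightarrow>
        (\<exists>w\<in>free_module E (fr_rank F (Suc (Suc i))). v = apply_diff F (Suc i) w))"

text \<open>
  Minimality: the image of each differential lies in \<open>\<mm> F\<^sub>i\<close> for the irrelevant ideal \<open>\<mm>\<close>, that is,
  no matrix entry has a constant term.
\<close>

definition minimal_free_resolution ::
    "'e set \<Rightarrow> ('e, 'k::field) mvpoly set \<Rightarrow> ('e, 'k) free_complex \<Rightarrow> bool" where
  "minimal_free_resolution E I F \<longleftrightarrow>
     multigraded_complex E F \<and> resolves_quotient E I F \<and>
     (\<forall>i. \<forall>r<fr_rank F i. \<forall>c<fr_rank F (Suc i). Poly_Mapping.lookup (fr_diff F i r c) 0 = 0)"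

text \<open>The type argument is the coefficient field.\<close>

definition multigraded_betti :: "'k::field itself \<Rightarrow> 'e matroid \<Rightarrow> nat \<Rightarrow> 'e set \<Rightarrow> nat" where
  "multigraded_betti _ M i \<sigma> =
     (let F = (SOME F :: ('e, 'k) free_complex.
                 minimal_free_resolution (ground M) (matroid_ideal M) F)
      in card {j. j < fr_rank F i \<and> fr_deg F i j = set_exponent \<sigma>})"

definition betti :: "'k::field itself \<Rightarrow> 'e matroid \<Rightarrow> nat \<Rightarrow> nat \<Rightarrow> nat" where
  "betti K M i j = (\<Sum>\<sigma> | \<sigma> \<subseteq> ground M \<and> card \<sigma> = j. multigraded_betti K M i \<sigma>)"

definition elongation_betti :: "'k::field itself \<Rightarrow> int \<Rightarrow> 'e matroid \<Rightarrow> nat \<Rightarrow> nat \<Rightarrow> int" where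
  "elongation_betti K l M i j = (if l < 0 then 0 else int (betti K (elongation (nat l) M) i j))"


section \<open>Generalized weight polynomials\<close>

definition q_bracket :: "nat \<Rightarrow> nat \<Rightarrow> nat \<Rightarrow> nat" where
  "q_bracket q n j = (\<Sum>i=1..j. q ^ (n - i))"

text \<open>\<open>B U\<close> is the basis fixed for the subspace \<open>U\<close>.\<close>

definition basis_family :: "(('a::field ^ 'n) set \<Rightarrow> ('a ^ 'n) set) \<Rightarrow> bool" where
  "basis_family B \<longleftrightarrow>
     (\<forall>U. vec.subspace U \<longrightarrow> vec.independent (B U) \<and> vec.span (B U) = U)"

definition gen_weight_poly ::
    "(('a::{field,finite} ^ 'n) set \<Rightarrow> ('a ^ 'n) set) \<Rightarrow> (('a ^ 'n) set \<Rightarrow> nat) \<Rightarrow> nat \<Rightarrow> int poly"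
  where
  "gen_weight_poly B \<rho> s =
     (-1) ^ ((CARD('a) ^ s - 1) div (CARD('a) - 1)) *
     (\<Sum>U | vec.subspace U \<and> vec.dim U = s.
        \<Sum>\<gamma>\<in>Pow (points U).
          (-1) ^ card \<gamma> * monom 1 (nullity (mdual (Cl U (q_local (B U) \<rho> U))) \<gamma>))"


section \<open>Gabidulin codes\<close>

definition field_embedding :: "('a::field \<Rightarrow> 'b::field) \<Rightarrow> bool" where
  "field_embedding \<iota> \<longleftrightarrow> \<iota> 1 = 1 \<and>
     (\<forall>x y. \<iota> (x + y) = \<iota> x + \<iota> y) \<and> (\<forall>x y. \<iota> (x * y) = \<iota> x * \<iota> y)"

text \<open>An embedding \<open>\<iota>\<close> of \<open>'a\<close> into \<open>'b\<close> makes \<open>'b\<close> a vector space over \<open>'a\<close>.\<close>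

definition ext_scale :: "('a::field \<Rightarrow> 'b::field) \<Rightarrow> 'a \<Rightarrow> 'b \<Rightarrow> 'b" where
  "ext_scale \<iota> a x = \<iota> a * x"

definition ext_basis :: "('a::field \<Rightarrow> 'b::field) \<Rightarrow> 'b set \<Rightarrow> bool" where
  "ext_basis \<iota> \<B> \<longleftrightarrow>
     \<not> module.dependent (ext_scale \<iota>) \<B> \<and> module.span (ext_scale \<iota>) \<B> = UNIV"

text \<open>
  The rows of the matrix of \<open>c\<close> are indexed by the elements \<open>b\<close> of the basis; the row space does not
  depend on their order.
\<close>

definition Rsupp :: "('a::field \<Rightarrow> 'b::field) \<Rightarrow> 'b set \<Rightarrow> 'b ^ 'n \<Rightarrow> ('a ^ 'n) set" where
  "Rsupp \<iota> \<B> c =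
     vec.span ((\<lambda>b. \<chi> j. module.representation (ext_scale \<iota>) \<B> (c $ j) b) ` \<B>)"

definition code_rank ::
    "('a::field \<Rightarrow> 'b::field) \<Rightarrow> 'b set \<Rightarrow> ('b ^ 'n) set \<Rightarrow> ('a ^ 'n) set \<Rightarrow> nat" where
  "code_rank \<iota> \<B> C X =
     vec.dim C - vec.dim {c \<in> C. Rsupp \<iota> \<B> c \<subseteq> perp std_dot UNIV X}"

definition extend_code :: "('b::field \<Rightarrow> 'c::field) \<Rightarrow> ('b ^ 'n) set \<Rightarrow> ('c ^ 'n) set" where
  "extend_code \<kappa> C = vec.span ((\<lambda>c. \<chi> j. \<kappa> (c $ j)) ` C)"

definition rank_weight_count ::
    "('a::field \<Rightarrow> 'c::field) \<Rightarrow> 'c set \<Rightarrow> ('c ^ 'n) set \<Rightarrow> nat \<Rightarrow> nat" where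
  "rank_weight_count \<iota> \<B> C s = card {c \<in> C. vec.dim (Rsupp \<iota> \<B> c) = s}"

end

theory Submission
  imports Defs "HOL-Library.Function_Algebras"
begin

text \<open>
  In squarefree degrees, a multigraded free resolution of the Stanley-Reisner ring of a matroid
  amounts to scalar matrices that are exact on the coordinate subspaces belonging to each subset
  of the ground set (its strands). Dimension shifting against the Koszul complex, which for a matroid
  is exact below the top degree by deletion and contraction, bounds the homological degree of a
  basis element by the nullity of its multidegree. Hence the Euler characteristics of the strands
  are finite sums, and Moebius inversion gives
  \<open>\<Sum>\<^sub>i (-1)^i \<beta>\<^bsub>i,\<sigma>\<^esub> = \<Sum>\<^bsub>\<gamma>\<subseteq>\<sigma>\<^esub> (-1)^\<bar>\<sigma>-\<gamma>\<bar> [\<gamma> independent]\<close>.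

  The independent sets of the \<open>l\<close>-th elongation are the sets of nullity at most \<open>l\<close>, so the differences
  of consecutive elongations sum up to \<open>\<Sum>\<^bsub>\<gamma>\<subseteq>\<sigma>\<^esub> (-1)^\<bar>\<sigma>-\<gamma>\<bar> X^(nullity of \<gamma>)\<close>. In the dual of \<open>Cl M\<close> the
  nullity of \<open>\<gamma>\<close> depends only on the span of the complement of \<open>\<gamma>\<close>, so toggling a point in that span
  shows that only complements of the point sets of subspaces contribute. These contributions, the
  local terms of the weight polynomial and the numbers of codewords of given rank support are all
  the Moebius inverse of \<open>V \<mapsto> X^(dual nullity of V)\<close> on the lattice of subspaces.
\<close>

section \<open>Koszul cohomology of matroid complexes\<close>

text \<open>\<open>multigraded_betti\<close> reads its numbers off a resolution picked by
  \<open>SOME\<close>, and nothing in the definition makes a resolution stop. So a minimal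
  resolution has to be shown to exist, and its squarefree part to have finite length, before an
  Euler characteristic makes sense. The alternating formula is derived for every minimal resolution,
  hence for the picked one. Since only squarefree degrees are counted, and only they occur in the
  strands over subsets of the ground set, the homological part becomes finite-dimensional linear
  algebra over the coefficient field.

  The sums stop at \<open>k\<close> because in the dual of \<open>Cl UNIV \<rho>\<close> no set has
  nullity above \<open>k\<close>, and elongation only lowers nullities.

  The number \<open>[s]\<close> counts the points outside a subspace of dimension
  \<open>n - s\<close>. A set of \<open>[s]\<close> points whose complement is the point set of a
  subspace thus stands for a subspace of that dimension, and dually for an
  \<open>s\<close>-dimensional \<open>U\<close> in the weight polynomial.\<close>

definition ksign :: "('e \<Rightarrow> nat) \<Rightarrow> 'e \<Rightarrow> 'e set \<Rightarrow> 'k::comm_ring_1" where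
  "ksign ord b B = (-1) ^ card {c \<in> B. ord c < ord b}"

text \<open>The simplicial coboundary. Cochains are functions on all sets: the degree enters only
  through \<open>card B\<close>, and the complex only through the sets \<open>B\<close> at which an
  equation is demanded. \<open>ord\<close> numbers the vertices, whose type need not carry an
  order.\<close>

definition kcob :: "('e \<Rightarrow> nat) \<Rightarrow> ('e set \<Rightarrow> 'k::comm_ring_1) \<Rightarrow> 'e set \<Rightarrow> 'k" where
  "kcob ord f B = (\<Sum>b\<in>B. ksign ord b B * f (B - {b}))"

lemma ksign_square: "ksign ord b B * ksign ord b B = (1 :: 'k::comm_ring_1)"
  by (simp add: ksign_def flip: power_add mult_2)

text \<open>Removing the earlier \<open>b\<close> lowers the position of \<open>c\<close> by one,
  while removing the later \<open>c\<close> leaves that of \<open>b\<close> unchanged; hence the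
  single minus sign.\<close>

lemma ksign_swap_aux:
  assumes "finite B" "b \<in> B" "c \<in> B" "ord b < ord c"
  shows "ksign ord b B * ksign ord c (B - {b}) = - (ksign ord c B * ksign ord b (B - {c}) :: 'k::comm_ring_1)"
proof -
  let ?L = "{x \<in> B. ord x < ord c}"
  have "{x \<in> B - {b}. ord x < ord c} = ?L - {b}" by auto
  moreover have "b \<in> ?L" "finite ?L" using assms by auto
  ultimately have "card ?L = Suc (card {x \<in> B - {b}. ord x < ord c})"
    by (metis card_Suc_Diff1)
  moreover have "{x \<in> B - {c}. ord x < ord b} = {x \<in> B. ord x < ord b}" using assms by auto
  ultimately show ?thesis by (simp add: ksign_def)
qed

lemma ksign_swap:
  assumes "finite B" "inj_on ord B" "b \<in> B" "c \<in> B" "b \<noteq> c"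
  shows "ksign ord b B * ksign ord c (B - {b}) = - (ksign ord c B * ksign ord b (B - {c}) :: 'k::comm_ring_1)"
proof -
  have "ord b \<noteq> ord c" using assms by (auto dest: inj_onD)
  then consider "ord b < ord c" | "ord c < ord b" by linarith
  then show ?thesis
    by cases (use ksign_swap_aux[of B b c ord, where ?'k='k] ksign_swap_aux[of B c b ord, where ?'k='k] assms
      in \<open>auto simp: minus_equation_iff\<close>)
qed

text \<open>Deleting two elements in either order leaves the same set but opposite signs, so the
  terms over \<open>?L\<close> and \<open>?G\<close> cancel.\<close>

lemma kcob_kcob:
  fixes f :: "'e set \<Rightarrow> 'k::comm_ring_1"
  assumes "finite B" "inj_on ord B"
  shows "kcob ord (kcob ord f) B = 0"
proof -
  let ?g = "\<lambda>b c. ksign ord b B * ksign ord c (B - {b}) * f (B - {b} - {c})"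
  let ?L = "{(b, c). b \<in> B \<and> c \<in> B \<and> ord b < ord c}"
  let ?G = "{(b, c). b \<in> B \<and> c \<in> B \<and> ord c < ord b}"
  have finL: "finite ?L" "finite ?G"
    by (rule finite_subset[of _ "B \<times> B"]; use assms in auto)+
  have "kcob ord (kcob ord f) B = (\<Sum>b\<in>B. \<Sum>c\<in>B - {b}. ?g b c)"
    by (simp add: kcob_def sum_distrib_left mult.assoc)
  also have "\<dots> = (\<Sum>(b, c)\<in>Sigma B (\<lambda>b. B - {b}). ?g b c)"
    using assms by (simp add: sum.Sigma)
  also have "Sigma B (\<lambda>b. B - {b}) = ?L \<union> ?G"
    using assms(2) by (auto dest: inj_onD) (metis inj_onD linorder_neq_iff)
  also have "(\<Sum>(b, c)\<in>?L \<union> ?G. ?g b c) = (\<Sum>(b, c)\<in>?L. ?g b c) + (\<Sum>(b, c)\<in>?G. ?g b c)"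
    by (rule sum.union_disjoint) (use finL in auto)
  also have "(\<Sum>(b, c)\<in>?G. ?g b c) = (\<Sum>(b, c)\<in>?L. ?g c b)"
    by (rule sum.reindex_bij_witness[of _ prod.swap prod.swap]) auto
  also have "(\<Sum>(b, c)\<in>?L. ?g c b) = - (\<Sum>(b, c)\<in>?L. ?g b c)"
    unfolding sum_negf[symmetric]
  proof (rule sum.cong[OF refl], clarify)
    fix b c assume bc: "b \<in> B" "c \<in> B" "ord b < ord c"
    have "B - {c} - {b} = B - {b} - {c}" by auto
    then show "?g c b = - ?g b c"
      using ksign_swap_aux[of B b c ord, where ?'k='k] bc assms by simp
  qed
  finally show ?thesis by simp
qed

lemma kcob_diff: "kcob ord (\<lambda>A. f A - g A) B = kcob ord f B - kcob ord g B"
  by (simp add: kcob_def algebra_simps sum_subtractf)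

lemma kcob_add: "kcob ord (\<lambda>A. f A + g A) B = kcob ord f B + kcob ord g B"
  by (simp add: kcob_def algebra_simps sum.distrib)

lemma kcob_sum_scale:
  "kcob ord (\<lambda>A. \<Sum>c\<in>J. a c * f c A) B = (\<Sum>c\<in>J. a c * kcob ord (f c) B)"
proof -
  have "kcob ord (\<lambda>A. \<Sum>c\<in>J. a c * f c A) B
      = (\<Sum>b\<in>B. \<Sum>c\<in>J. a c * (ksign ord b B * f c (B - {b})))"
    by (simp add: kcob_def sum_distrib_left ac_simps)
  also have "\<dots> = (\<Sum>c\<in>J. \<Sum>b\<in>B. a c * (ksign ord b B * f c (B - {b})))"
    by (rule sum.swap)
  finally show ?thesis by (simp add: kcob_def sum_distrib_left)
qed

lemma kcob_cong: "(\<And>b. b \<in> B \<Longrightarrow> f (B - {b}) = g (B - {b})) \<Longrightarrow> kcob ord f B = kcob ord g B"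
  unfolding kcob_def by (intro sum.cong) auto

text \<open>The contracting homotopy of a cone with apex \<open>a\<close>: it moves values from sets
  through the apex to the opposite faces.\<close>

definition kcone :: "('e \<Rightarrow> nat) \<Rightarrow> 'e \<Rightarrow> ('e set \<Rightarrow> 'k::comm_ring_1) \<Rightarrow> 'e set \<Rightarrow> 'k" where
  "kcone ord a f A = (if a \<in> A then 0 else ksign ord a (insert a A) * f (insert a A))"

lemma kcob_kcone_in:
  assumes "finite B" "a \<in> B"
  shows "kcob ord (kcone ord a f) B = f B"
proof -
  have "kcob ord (kcone ord a f) B = ksign ord a B * (ksign ord a B * f B)"
    unfolding kcob_def kcone_def using assms
    by (subst sum.remove[of _ a]) (auto simp: insert_absorb intro!: sum.neutral split: if_splits)
  also have "\<dots> = f B"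
    by (metis ksign_square mult.assoc mult_1)
  finally show ?thesis .
qed

text \<open>The cocycle equation at \<open>insert a B\<close> contains \<open>f B\<close> and values
  on sets through the apex; solved for \<open>f B\<close> it is the coboundary of the cone, the
  signs matching by \<open>ksign_swap\<close>.\<close>

lemma kcob_kcone_notin:
  fixes f :: "'e set \<Rightarrow> 'k::comm_ring_1"
  assumes "finite B" "inj_on ord (insert a B)" "a \<notin> B" "kcob ord f (insert a B) = 0"
  shows "kcob ord (kcone ord a f) B = f B"
proof -
  let ?C = "insert a B"
  have "ksign ord a ?C * f B + (\<Sum>b\<in>B. ksign ord b ?C * f (?C - {b})) = 0"
    using assms by (simp add: kcob_def)
  then have "ksign ord a ?C * (ksign ord a ?C * f B + (\<Sum>b\<in>B. ksign ord b ?C * f (?C - {b}))) = 0"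
    by simp
  then have "f B + (\<Sum>b\<in>B. ksign ord a ?C * (ksign ord b ?C * f (?C - {b}))) = 0"
    by (simp add: distrib_left ksign_square sum_distrib_left flip: mult.assoc)
  then have "f B = (\<Sum>b\<in>B. - (ksign ord a ?C * (ksign ord b ?C * f (?C - {b}))))"
    by (simp add: sum_negf eq_neg_iff_add_eq_0)
  also have "\<dots> = kcob ord (kcone ord a f) B"
    unfolding kcob_def
  proof (rule sum.cong[OF refl])
    fix b assume b: "b \<in> B"
    then have ne: "a \<noteq> b" using assms by auto
    have "ksign ord b ?C * ksign ord a (?C - {b}) = - (ksign ord a ?C * ksign ord b (?C - {a}) :: 'k)"
      by (rule ksign_swap) (use assms b ne in auto)
    then have "(ksign ord a ?C * ksign ord b ?C) * ksign ord a (?C - {b}) * ksign ord a (?C - {b})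
      = - (ksign ord a ?C * ksign ord a ?C * ksign ord b (?C - {a}) * ksign ord a (?C - {b}) :: 'k)"
      by (metis (no_types, lifting) mult.assoc mult_minus_left mult_minus_right)
    then have s: "ksign ord a ?C * ksign ord b ?C = - (ksign ord b B * ksign ord a (?C - {b}) :: 'k)"
      using assms(3) by (simp add: mult.assoc ksign_square)
    have eq: "insert a (B - {b}) = ?C - {b}" using ne by auto
    show "- (ksign ord a ?C * (ksign ord b ?C * f (?C - {b})))
        = ksign ord b B * kcone ord a f (B - {b})"
      using assms(3) s by (simp add: kcone_def eq flip: mult.assoc)
  qed
  finally show ?thesis by simp
qed

lemma kcone_nonzero: "kcone ord a f A \<noteq> 0 \<Longrightarrow> a \<notin> D \<Longrightarrow> (\<And>A. f A \<noteq> 0 \<Longrightarrow> D \<subseteq> A) \<Longrightarrow> D \<subseteq> A"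
  unfolding kcone_def by (metis mult_zero_right subset_insert)

text \<open>Nullity functions by local axioms: unit increase, and an element outside
  \<open>B\<close> that raises the nullity at \<open>A\<close> still raises it at the larger
  \<open>B\<close>, which is supermodularity. This form survives the truncated shift by
  \<open>l\<close> that elongation performs. Independent sets are the zeros of
  \<open>\<nu>\<close>.\<close>

definition matroid_nullity :: "'e set \<Rightarrow> ('e set \<Rightarrow> nat) \<Rightarrow> bool" where
  "matroid_nullity E \<nu> \<longleftrightarrow> \<nu> {} = 0 \<and>
     (\<forall>A\<subseteq>E. \<forall>a\<in>E. \<nu> A \<le> \<nu> (insert a A) \<and> \<nu> (insert a A) \<le> \<nu> A + 1) \<and>
     (\<forall>B\<subseteq>E. \<forall>A\<subseteq>B. \<forall>a\<in>E - B. \<nu> A < \<nu> (insert a A) \<longrightarrow> \<nu> B < \<nu> (insert a B))"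

lemma matroid_nullity_mono:
  assumes "matroid_nullity E \<nu>" "A \<subseteq> B" "B \<subseteq> E" "finite E"
  shows "\<nu> A \<le> \<nu> B"
proof -
  have "\<nu> A \<le> \<nu> (A \<union> S)" if "finite S" "S \<subseteq> E" for S
    using that
  proof (induction S)
    case (insert x S)
    have "\<nu> (A \<union> S) \<le> \<nu> (insert x (A \<union> S))"
      using assms insert.prems unfolding matroid_nullity_def by simp
    then show ?case using insert by auto
  qed simp
  from this[of B] show ?thesis using assms finite_subset by (metis Un_absorb1)
qed

text \<open>Koszul cohomology of the Stanley-Reisner ring of a matroid (with the elements of \<open>D\<close>
  contracted) vanishes below the top degree. Induction on \<open>S\<close> by deletion and contraction of a
  non-coloop; a coloop makes the complex a cone.\<close>

lemma matroid_cochain_exact: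
  fixes f :: "'e set \<Rightarrow> 'k::field"
  assumes "matroid_nullity E \<nu>" "finite E" "inj_on ord E"
    and "finite S" "S \<subseteq> E" "D \<subseteq> E" "D \<inter> S = {}" "\<nu> D = 0"
    and "p + \<nu> (D \<union> S) < card (D \<union> S)"
    and "\<And>B. \<nu> B = 0 \<Longrightarrow> B \<subseteq> D \<union> S \<Longrightarrow> card B = Suc p \<Longrightarrow> kcob ord f B = 0"
    and "\<And>A. f A \<noteq> 0 \<Longrightarrow> D \<subseteq> A"
  shows "\<exists>g. (\<forall>A. g A \<noteq> 0 \<longrightarrow> D \<subseteq> A) \<and>
    (\<forall>B. \<nu> B = 0 \<longrightarrow> B \<subseteq> D \<union> S \<longrightarrow> card B = p \<longrightarrow> kcob ord g B = f B)"
  using assms(4-)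
proof (induction S arbitrary: D f rule: finite_induct)
  case empty
  \<comment> \<open>A value can only sit on \<open>D\<close> itself, and
    \<open>p + \<nu> D < card D\<close> puts \<open>D\<close> in a degree above
    \<open>p\<close>.\<close>
  have "f B = 0" if "B \<subseteq> D" "card B = p" for B
  proof (rule ccontr)
    assume "f B \<noteq> 0"
    then have "B = D" using empty(7)[of B] that by auto
    then show False using empty(5) that by simp
  qed
  then show ?case
    by (intro exI[of _ "\<lambda>_. 0"]) (auto simp: kcob_def)
next
  case (insert a S)
  note nul = assms(1)[unfolded matroid_nullity_def]
  have a: "a \<in> E" "a \<notin> D" "a \<notin> D \<union> S" "S \<subseteq> E" "D \<inter> S = {}" using insert by auto
  have DSE: "D \<union> S \<subseteq> E" using insert by auto
  have finDS: "finite (D \<union> S)" using DSE assms(2) finite_subset by blast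
  have cardDS: "card (D \<union> insert a S) = Suc (card (D \<union> S))" using finDS a by simp
  have fin: "finite B" if "B \<subseteq> D \<union> insert a S" for B
    using that finDS finite_subset[of B "insert a (D \<union> S)"] by auto
  have inj: "inj_on ord B" if "B \<subseteq> D \<union> insert a S" for B
    by (rule inj_on_subset[OF assms(3)]) (use that DSE a(1) in auto)
  have sub0: "\<nu> A = 0" if "\<nu> B = 0" "A \<subseteq> B" "B \<subseteq> E" for A B
    using matroid_nullity_mono[OF assms(1) that(2,3) assms(2)] that by simp
  show ?case
  \<comment> \<open>The bound for the deletion of \<open>a\<close> holds unless \<open>a\<close> is
    a coloop. Contraction moves \<open>a\<close> from \<open>S\<close> to \<open>D\<close> and
    leaves the union unchanged, so its bound is the given one.\<close>
  proof (cases "p + \<nu> (D \<union> S) < card (D \<union> S)")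
    case del: True
    obtain g where g: "\<And>A. g A \<noteq> 0 \<Longrightarrow> D \<subseteq> A"
      "\<And>B. \<nu> B = 0 \<Longrightarrow> B \<subseteq> D \<union> S \<Longrightarrow> card B = p \<Longrightarrow> kcob ord g B = f B"
      proof -
      have "\<exists>g. (\<forall>A. g A \<noteq> 0 \<longrightarrow> D \<subseteq> A) \<and>
        (\<forall>B. \<nu> B = 0 \<longrightarrow> B \<subseteq> D \<union> S \<longrightarrow> card B = p \<longrightarrow> kcob ord g B = f B)"
        by (rule insert.IH[OF a(4) insert.prems(2) a(5) insert.prems(4) del])
          (use insert.prems(6,7) in \<open>simp_all add: subset_insertI2\<close>)
      then show ?thesis using that by meson
    qed
    \<comment> \<open>Discarding the sets through \<open>a\<close> leaves the coboundary unchanged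
      on the deletion and frees those sets for the correction \<open>h\<close>.\<close>
    define g1 where "g1 A = (if a \<in> A then 0 else g A)" for A
    have g1: "kcob ord g1 B = f B" if "\<nu> B = 0" "B \<subseteq> D \<union> S" "card B = p" for B
    proof -
      have "kcob ord g1 B = kcob ord g B"
        by (rule kcob_cong) (use that a(3) in \<open>auto simp: g1_def\<close>)
      then show ?thesis using g(2)[OF that] by simp
    qed
    \<comment> \<open>The remaining error lives on sets through \<open>a\<close>, so it is a cocycle
      of the contraction.\<close>
    define f1 where "f1 A = (if a \<in> A \<and> A \<subseteq> D \<union> insert a S then f A - kcob ord g1 A else 0)" for A
    have f1_closed: "kcob ord f1 B = 0" if "\<nu> B = 0" "B \<subseteq> D \<union> insert a S" "card B = Suc p" for B
    proof (cases "a \<in> B")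
      case True
      have "kcob ord f1 B = kcob ord (\<lambda>A. f A - kcob ord g1 A) B"
      proof (rule kcob_cong)
        fix b assume b: "b \<in> B"
        show "f1 (B - {b}) = f (B - {b}) - kcob ord g1 (B - {b})"
        proof (cases "b = a")
          case True
          have "kcob ord g1 (B - {a}) = f (B - {a})"
          proof (rule g1)
            show "\<nu> (B - {a}) = 0" using sub0[OF that(1)] that(2) DSE a by auto
            show "card (B - {a}) = p" using that b True fin[of B] by auto
          qed (use that in auto)
          then show ?thesis using True by (simp add: f1_def)
        qed (use that True in \<open>auto simp: f1_def\<close>)
      qed
      also have "\<dots> = 0"
        using insert.prems(6)[OF that] kcob_kcob[of B ord g1] fin inj that by (simp add: kcob_diff)
      finally show ?thesis .
    next
      case False then show ?thesis by (simp add: kcob_def f1_def)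
    qed
    have f1_supp: "insert a D \<subseteq> A" if "f1 A \<noteq> 0" for A
    proof -
      have A: "a \<in> A" "f A \<noteq> 0 \<or> kcob ord g1 A \<noteq> 0" using that by (auto simp: f1_def split: if_splits)
      have "D \<subseteq> A" if k: "kcob ord g1 A \<noteq> 0"
      proof -
        obtain b where "b \<in> A" "g1 (A - {b}) \<noteq> 0"
          using k unfolding kcob_def by (metis (no_types, lifting) mult_zero_right sum.neutral)
        then have "g (A - {b}) \<noteq> 0" by (auto simp: g1_def split: if_splits)
        then show ?thesis using g(1) by blast
      qed
      then show ?thesis using A insert.prems(7)[of A] by auto
    qed
    have "\<exists>h. (\<forall>A. h A \<noteq> 0 \<longrightarrow> insert a D \<subseteq> A) \<and>
      (\<forall>B. \<nu> B = 0 \<longrightarrow> B \<subseteq> insert a D \<union> S \<longrightarrow> card B = p \<longrightarrow> kcob ord h B = f1 B)"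
    proof (cases "\<nu> (insert a D) = 0")
      case True
      show ?thesis
        proof (rule insert.IH)
        show "S \<subseteq> E" "insert a D \<subseteq> E" "insert a D \<inter> S = {}" "\<nu> (insert a D) = 0"
          using True a insert.prems(2) by auto
        show "p + \<nu> (insert a D \<union> S) < card (insert a D \<union> S)" using insert.prems(5) by simp
      qed (use f1_closed f1_supp in auto)
    next
      \<comment> \<open>Here \<open>insert a D\<close> is dependent: the contraction has no faces,
        and the error vanishes on every independent set.\<close>
      case False
      have "f1 B = 0" if "\<nu> B = 0" "B \<subseteq> insert a D \<union> S" for B
        proof (rule ccontr)
        assume "f1 B \<noteq> 0"
        then have "insert a D \<subseteq> B" by (rule f1_supp)
        moreover have "B \<subseteq> E" using that(2) DSE a(1) by auto
        ultimately show False using sub0[OF that(1), of "insert a D"] False by simp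
      qed
      then show ?thesis by (intro exI[of _ "\<lambda>_. 0"]) (auto simp: kcob_def)
    qed
    then obtain h where h: "\<And>A. h A \<noteq> 0 \<Longrightarrow> insert a D \<subseteq> A"
      "\<And>B. \<nu> B = 0 \<Longrightarrow> B \<subseteq> insert a D \<union> S \<Longrightarrow> card B = p \<Longrightarrow> kcob ord h B = f1 B" by blast
    show ?thesis
    proof (intro exI[of _ "\<lambda>A. g1 A + h A"] conjI allI impI)
      fix A assume "g1 A + h A \<noteq> 0"
      then have "g1 A \<noteq> 0 \<or> h A \<noteq> 0" by auto
      then show "D \<subseteq> A" using g(1)[of A] h(1)[of A] by (cases "a \<in> A") (auto simp: g1_def)
    next
      fix B assume B: "\<nu> B = 0" "B \<subseteq> D \<union> insert a S" "card B = p"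
      show "kcob ord (\<lambda>A. g1 A + h A) B = f B"
      proof (cases "a \<in> B")
        case True
        then show ?thesis using h(2)[of B] B by (auto simp: kcob_add f1_def)
      next
        case False
        then have "kcob ord h B = 0" "kcob ord g1 B = f B"
          using h(2)[of B] g1[of B] B by (auto simp: f1_def)
        then show ?thesis by (simp add: kcob_add)
      qed
    qed
  next
    case False
    \<comment> \<open>Adding \<open>a\<close> raises the cardinality by one; as the bound holds with
      \<open>a\<close> and fails without it, the nullity cannot have grown, so \<open>a\<close> is a
      coloop.\<close>
    then have "\<nu> (insert a (D \<union> S)) \<le> \<nu> (D \<union> S)"
      using insert.prems(5) cardDS by simp
    then have coloop: "\<nu> (insert a B) = 0" if "\<nu> B = 0" "B \<subseteq> D \<union> S" for B
    proof -
      have "\<not> \<nu> B < \<nu> (insert a B)"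
        using nul DSE a(1,3) that(2) \<open>\<nu> (insert a (D \<union> S)) \<le> \<nu> (D \<union> S)\<close> by (meson DiffI not_le)
      then show ?thesis using that(1) by simp
    qed
    show ?thesis
    proof (intro exI[of _ "kcone ord a f"] conjI allI impI)
      fix A assume "kcone ord a f A \<noteq> 0"
      then show "D \<subseteq> A" by (rule kcone_nonzero[OF _ a(2) insert.prems(7)])
    next
      fix B assume B: "\<nu> B = 0" "B \<subseteq> D \<union> insert a S" "card B = p"
      show "kcob ord (kcone ord a f) B = f B"
      proof (cases "a \<in> B")
        case True then show ?thesis by (rule kcob_kcone_in[OF fin[OF B(2)]])
      next
        case F: False
        have "kcob ord f (insert a B) = 0"
        proof (rule insert.prems(6))
          show "\<nu> (insert a B) = 0" by (rule coloop) (use B F in auto)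
          show "card (insert a B) = Suc p" using B F fin[OF B(2)] by simp
        qed (use B in auto)
        then show ?thesis using kcob_kcone_notin[of B ord a f] F fin[of B] inj[of "insert a B"] B by auto
      qed
    qed
  qed
qed

text \<open>The sets between \<open>D\<close> and \<open>\<sigma>\<close> form a cone with apex any
  element of \<open>\<sigma> - D\<close>. Only \<open>D = \<sigma>\<close> leaves no apex, a complex
  with a single term in top degree, and \<open>top\<close> excludes values there.\<close>

lemma boolean_cochain_exact:
  fixes f :: "'e set \<Rightarrow> 'k::field"
  assumes "finite \<sigma>" "inj_on ord \<sigma>" "D \<subseteq> \<sigma>" "p \<le> card \<sigma>"
    and closed: "\<And>B. B \<subseteq> \<sigma> \<Longrightarrow> card B = Suc p \<Longrightarrow> kcob ord f B = 0"
    and supp: "\<And>A. f A \<noteq> 0 \<Longrightarrow> D \<subseteq> A"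
    and top: "p = card \<sigma> \<Longrightarrow> f \<sigma> \<noteq> 0 \<Longrightarrow> D \<noteq> \<sigma>"
  shows "\<exists>g. (\<forall>A. g A \<noteq> 0 \<longrightarrow> D \<subseteq> A) \<and> (\<forall>B\<subseteq>\<sigma>. card B = p \<longrightarrow> kcob ord g B = f B)"
proof (cases "D = \<sigma>")
  case True
  have "f B = 0" if "B \<subseteq> \<sigma>" "card B = p" for B
  proof (rule ccontr)
    assume "f B \<noteq> 0"
    then have "\<sigma> \<subseteq> B" using supp[of B] True by simp
    then have "B = \<sigma>" using that(1) by simp
    then show False using top that True \<open>f B \<noteq> 0\<close> by simp
  qed
  then show ?thesis by (intro exI[of _ "\<lambda>_. 0"]) (auto simp: kcob_def)
next
  case False
  then obtain a where a: "a \<in> \<sigma>" "a \<notin> D" using assms by blast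
  show ?thesis
  proof (intro exI[of _ "kcone ord a f"] conjI allI impI)
    fix A assume "kcone ord a f A \<noteq> 0"
    then show "D \<subseteq> A" by (rule kcone_nonzero[OF _ a(2) supp])
  next
    fix B assume B: "B \<subseteq> \<sigma>" "card B = p"
    have finB: "finite B" by (rule finite_subset[OF B(1) assms(1)])
    show "kcob ord (kcone ord a f) B = f B"
    proof (cases "a \<in> B")
      case True then show ?thesis by (rule kcob_kcone_in[OF finB])
    next
      case F: False
      have "kcob ord f (insert a B) = 0"
        by (rule closed) (use B F finB a in auto)
      moreover have "inj_on ord (insert a B)"
        by (rule inj_on_subset[OF assms(2)]) (use B a in auto)
      ultimately show ?thesis using kcob_kcone_notin[of B ord a f] F finB by blast
    qed
  qed
qed

section \<open>Strands of squarefree resolutions\<close>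

lemma (in vector_space) independent_span_Diff_eq_0:
  assumes "independent C" "B \<subseteq> C" "x \<in> span B" "x \<in> span (C - B)"
  shows "x = 0"
proof -
  have xC: "x \<in> span C" using assms(2,3) span_mono by blast
  have "representation C x = representation B x"
    by (rule representation_extend[OF assms(1,3,2)])
  moreover have "representation C x = representation (C - B) x"
    by (rule representation_extend[OF assms(1,4)]) auto
  ultimately have "representation C x b = 0" for b
    using representation_ne_zero by (metis DiffD2)
  then show ?thesis
    using sum_nonzero_representation_eq[OF assms(1) xC] by simp
qed

text \<open>The domain may be infinite-dimensional, as \<open>nat \<Rightarrow> 'k\<close> is, so
  finiteness comes from the spanning set \<open>W\<close>. A basis of the kernel is extended to
  \<open>V\<close>, and \<open>f\<close> is injective on the span of the new vectors.\<close>

lemma (in vector_space_pair) rank_nullity: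
  assumes f: "Vector_Spaces.linear s1 s2 f" and V: "vs1.subspace V" "V \<subseteq> vs1.span W" "finite W"
  shows "vs1.dim V = vs2.dim (f ` V) + vs1.dim {v \<in> V. f v = 0}"
proof -
  interpret f: Vector_Spaces.linear s1 s2 f by fact
  let ?N = "{v \<in> V. f v = 0}"
  obtain B where B: "B \<subseteq> ?N" "vs1.independent B" "?N \<subseteq> vs1.span B" "card B = vs1.dim ?N"
    by (rule vs1.basis_exists[of ?N])
  obtain C where C: "B \<subseteq> C" "C \<subseteq> V" "vs1.independent C" "V \<subseteq> vs1.span C"
    by (rule vs1.maximal_independent_subset_extend[of B V]) (use B in auto)
  have finC: "finite C"
    by (rule conjunct1[OF vs1.independent_span_bound[OF V(3) C(3)]]) (use C(2) V(2) in blast)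
  have span_CB: "vs1.span (C - B) \<subseteq> V"
    using C(2) V(1) by (intro vs1.span_minimal) auto
  have indep_CB: "vs1.independent (C - B)"
    using C(3) by (rule vs1.independent_mono) auto
  have ker0: "x = 0" if "x \<in> vs1.span (C - B)" "f x = 0" for x
  proof -
    have "x \<in> vs1.span B" using that span_CB B(3) by auto
    then show ?thesis using vs1.independent_span_Diff_eq_0[OF C(3,1)] that(1) by simp
  qed
  have inj: "inj_on f (vs1.span (C - B))"
    using ker0 f.diff vs1.span_diff by (intro inj_onI) (metis eq_iff_diff_eq_0)
  have indep: "vs2.independent (f ` (C - B))"
    by (rule f.independent_injective_image[OF indep_CB inj])
  have "f ` V \<subseteq> vs2.span (f ` C)"
    using C(4) f.span_image by blast
  also have "f ` C \<subseteq> insert 0 (f ` (C - B))" using B(1) by auto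
  then have "vs2.span (f ` C) \<subseteq> vs2.span (f ` (C - B))"
    using vs2.span_mono vs2.span_insert_0 by metis
  finally have "card (f ` (C - B)) = vs2.dim (f ` V)"
    using C(2) indep by (intro vs2.basis_card_eq_dim) auto
  moreover have "card (f ` (C - B)) = card (C - B)"
    using inj vs1.span_superset by (meson card_image inj_on_subset)
  moreover have "card C = vs1.dim V"
    using C by (intro vs1.basis_card_eq_dim) auto
  moreover have "card C = card (C - B) + card B"
    using finC C(1) by (metis card_Diff_subset card_mono finite_subset le_add_diff_inverse2)
  ultimately show ?thesis using B(4) by simp
qed

text \<open>The part of a free module in the squarefree degree \<open>\<sigma>\<close>: each basis
  element whose degree divides it contributes exactly one monomial multiple, so a vector of scalars
  describes an element.\<close>

definition strand :: "nat set \<Rightarrow> (nat \<Rightarrow> 'e set) \<Rightarrow> 'e set \<Rightarrow> (nat \<Rightarrow> 'k::zero) set" where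
  "strand J D \<sigma> = {v. \<forall>c. v c \<noteq> 0 \<longrightarrow> c \<in> J \<and> D c \<subseteq> \<sigma>}"

definition mat_apply :: "(nat \<Rightarrow> nat \<Rightarrow> 'k::comm_semiring_0) \<Rightarrow> nat set \<Rightarrow> (nat \<Rightarrow> 'k) \<Rightarrow> nat \<Rightarrow> 'k" where
  "mat_apply A J v r = (\<Sum>c\<in>J. A r c * v c)"

definition fscale :: "'k::times \<Rightarrow> (nat \<Rightarrow> 'k) \<Rightarrow> nat \<Rightarrow> 'k" where
  "fscale s v = (\<lambda>c. s * v c)"

interpretation fvec: vector_space "fscale :: 'k::field \<Rightarrow> _"
  by unfold_locales (auto simp: fscale_def fun_eq_iff algebra_simps)

interpretation fvec_pair: vector_space_pair "fscale :: 'k::field \<Rightarrow> _" "fscale :: 'k::field \<Rightarrow> _"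
  by unfold_locales

lemma linear_mat_apply: "Vector_Spaces.linear fscale fscale (mat_apply (A :: nat \<Rightarrow> nat \<Rightarrow> 'k::field) J)"
  by unfold_locales
    (auto simp: mat_apply_def fscale_def fun_eq_iff algebra_simps sum.distrib sum_distrib_left)

lemma subspace_strand: "fvec.subspace (strand J D \<sigma> :: (nat \<Rightarrow> 'k::field) set)"
  unfolding fvec.subspace_def
proof (intro conjI ballI allI)
  fix u v :: "nat \<Rightarrow> 'k" assume "u \<in> strand J D \<sigma>" "v \<in> strand J D \<sigma>"
  moreover have "u c \<noteq> 0 \<or> v c \<noteq> 0" if "(u + v) c \<noteq> 0" for c using that by auto
  ultimately show "u + v \<in> strand J D \<sigma>" unfolding strand_def by blast
qed (auto simp: strand_def fscale_def)

definition unit_vec :: "nat \<Rightarrow> nat \<Rightarrow> 'k::zero_neq_one" where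
  "unit_vec c = (\<lambda>j. if j = c then 1 else 0)"

lemma unit_vec_inj: "inj (unit_vec :: nat \<Rightarrow> nat \<Rightarrow> 'k::zero_neq_one)"
  by (rule injI) (metis unit_vec_def zero_neq_one)

lemma sum_unit_vec:
  "finite T \<Longrightarrow> (\<Sum>c\<in>T. fscale (v c) (unit_vec c)) = (\<lambda>c. if c \<in> T then v c else (0 :: 'k::field))"
  by (induction T rule: finite_induct) (auto simp: fscale_def unit_vec_def fun_eq_iff)

lemma strand_eq_span:
  assumes "finite J"
  shows "strand J D \<sigma> = fvec.span (unit_vec ` {c \<in> J. D c \<subseteq> \<sigma>} :: (nat \<Rightarrow> 'k::field) set)"
proof
  let ?T = "{c \<in> J. D c \<subseteq> \<sigma>}"
  have fin: "finite ?T" using assms by simp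
  show "strand J D \<sigma> \<subseteq> (fvec.span (unit_vec ` ?T) :: (nat \<Rightarrow> 'k) set)"
  proof
    fix v :: "nat \<Rightarrow> 'k" assume v: "v \<in> strand J D \<sigma>"
    then have "v = (\<lambda>c. if c \<in> ?T then v c else 0)" by (auto simp: strand_def fun_eq_iff)
    then have eq: "v = (\<Sum>c\<in>?T. fscale (v c) (unit_vec c))" by (simp only: sum_unit_vec[OF fin])
    show "v \<in> fvec.span (unit_vec ` ?T)"
      by (subst eq) (intro fvec.span_sum fvec.span_scale fvec.span_base, auto)
  qed
  show "fvec.span (unit_vec ` ?T) \<subseteq> (strand J D \<sigma> :: (nat \<Rightarrow> 'k) set)"
    by (rule fvec.span_minimal[OF _ subspace_strand]) (auto simp: strand_def unit_vec_def split: if_splits)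
qed

lemma independent_unit_vec:
  "finite T \<Longrightarrow> fvec.independent (unit_vec ` T :: (nat \<Rightarrow> 'k::field) set)"
proof (induction T rule: finite_induct)
  case (insert c T)
  have "fvec.span (unit_vec ` T) \<subseteq> {v :: nat \<Rightarrow> 'k. v c = 0}"
  proof (rule fvec.span_minimal)
    show "unit_vec ` T \<subseteq> {v :: nat \<Rightarrow> 'k. v c = 0}"
      using insert(2) by (auto simp: unit_vec_def)
    show "fvec.subspace {v :: nat \<Rightarrow> 'k. v c = 0}"
      by (simp add: fvec.subspace_def fscale_def)
  qed
  then have "(unit_vec c :: nat \<Rightarrow> 'k) \<notin> fvec.span (unit_vec ` T)"
    by (auto simp: unit_vec_def)
  then show ?case using insert.IH by (simp add: fvec.independent_insertI)
qed (simp add: fvec.independent_empty)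

lemma dim_strand:
  assumes "finite J"
  shows "fvec.dim (strand J D \<sigma> :: (nat \<Rightarrow> 'k::field) set) = card {c \<in> J. D c \<subseteq> \<sigma>}"
proof -
  have "fvec.independent (unit_vec ` {c \<in> J. D c \<subseteq> \<sigma>} :: (nat \<Rightarrow> 'k) set)"
    using assms by (intro independent_unit_vec) simp
  then have "fvec.dim (strand J D \<sigma> :: (nat \<Rightarrow> 'k) set) = card (unit_vec ` {c \<in> J. D c \<subseteq> \<sigma>} :: (nat \<Rightarrow> 'k) set)"
    unfolding strand_eq_span[OF assms] by (rule fvec.dim_span_eq_card_independent)
  also have "\<dots> = card {c \<in> J. D c \<subseteq> \<sigma>}"
    by (intro card_image inj_on_subset[OF unit_vec_inj subset_UNIV])
  finally show ?thesis .
qed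

lemma sum_subset_moebius:
  fixes F G :: "'e set \<Rightarrow> int"
  assumes "finite \<sigma>" "\<And>\<tau>. \<tau> \<subseteq> \<sigma> \<Longrightarrow> G \<tau> = (\<Sum>\<gamma>\<in>Pow \<tau>. F \<gamma>)"
  shows "F \<sigma> = (\<Sum>\<gamma>\<in>Pow \<sigma>. (-1) ^ (card \<sigma> + card \<gamma>) * G \<gamma>)"
proof -
  have "(-1) ^ card \<sigma> * F \<sigma> = (\<Sum>T\<in>Pow \<sigma>. (-1) ^ card T * (\<Sum>\<gamma>\<in>Pow T. F \<gamma>))"
    by (rule inclusion_exclusion_symmetric[where f = "\<lambda>S. (-1) ^ card S * F S"])
      (use assms in \<open>auto simp flip: mult.assoc power_add mult_2\<close>)
  also have "\<dots> = (\<Sum>T\<in>Pow \<sigma>. (-1) ^ card T * G T)"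
    by (rule sum.cong) (use assms in auto)
  finally have "(-1) ^ card \<sigma> * ((-1) ^ card \<sigma> * F \<sigma>) = (-1) ^ card \<sigma> * (\<Sum>T\<in>Pow \<sigma>. (-1) ^ card T * G T)"
    by simp
  then show ?thesis
    by (simp add: sum_distrib_left power_add flip: mult.assoc)
qed

text \<open>A minimal resolution seen only through its strands. \<open>A_support\<close> combines
  homogeneity with minimality: the inclusion of degrees is proper because an entry between equal
  degrees would be a nonzero constant. The augmentation has target \<open>'k\<close> at faces and
  zero elsewhere, which is why \<open>exact_0\<close> is conditional on
  \<open>\<sigma> \<in> \<Delta>\<close>. Nothing here bounds the length.\<close>

locale squarefree_resolution =
  fixes E :: "'e set" and \<Delta> :: "'e set set"
    and J :: "nat \<Rightarrow> nat set" and D :: "nat \<Rightarrow> nat \<Rightarrow> 'e set"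
    and A :: "nat \<Rightarrow> nat \<Rightarrow> nat \<Rightarrow> 'k::field" and a :: "nat \<Rightarrow> 'k"
  assumes finite_E: "finite E" and finite_J: "finite (J i)"
    and D_E: "c \<in> J i \<Longrightarrow> D i c \<subseteq> E"
    and A_support: "c \<in> J (Suc i) \<Longrightarrow> A i r c \<noteq> 0 \<Longrightarrow> r \<in> J i \<and> D i r \<subset> D (Suc i) c"
    and aug_surj: "\<sigma> \<in> \<Delta> \<Longrightarrow> \<sigma> \<subseteq> E \<Longrightarrow> \<exists>v\<in>strand (J 0) (D 0) \<sigma>. (\<Sum>c\<in>J 0. a c * v c) = 1"
    and exact_0: "\<sigma> \<subseteq> E \<Longrightarrow> v \<in> strand (J 0) (D 0) \<sigma> \<Longrightarrow>
      (\<sigma> \<in> \<Delta> \<longrightarrow> (\<Sum>c\<in>J 0. a c * v c) = 0) \<longleftrightarrow>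
      (\<exists>w\<in>strand (J 1) (D 1) \<sigma>. v = mat_apply (A 0) (J 1) w)"
    and exact_Suc: "\<sigma> \<subseteq> E \<Longrightarrow> v \<in> strand (J (Suc i)) (D (Suc i)) \<sigma> \<Longrightarrow>
      mat_apply (A i) (J (Suc i)) v = 0 \<longleftrightarrow>
      (\<exists>w\<in>strand (J (Suc (Suc i))) (D (Suc (Suc i))) \<sigma>. v = mat_apply (A (Suc i)) (J (Suc (Suc i))) w)"
begin

definition V :: "nat \<Rightarrow> 'e set \<Rightarrow> (nat \<Rightarrow> 'k) set" where
  "V i \<sigma> = strand (J i) (D i) \<sigma>"

definition d :: "nat \<Rightarrow> (nat \<Rightarrow> 'k) \<Rightarrow> nat \<Rightarrow> 'k" where
  "d i = mat_apply (A i) (J (Suc i))"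

definition aug :: "(nat \<Rightarrow> 'k) \<Rightarrow> 'k" where
  "aug v = (\<Sum>c\<in>J 0. a c * v c)"

definition Z :: "nat \<Rightarrow> 'e set \<Rightarrow> (nat \<Rightarrow> 'k) set" where
  "Z i \<sigma> = d i ` V (Suc i) \<sigma>"

lemma linear_d: "Vector_Spaces.linear fscale fscale (d i)"
  unfolding d_def by (rule linear_mat_apply)

text \<open>The proper inclusion is minimality at work: boundaries never involve a basis element of
  degree \<open>\<sigma>\<close> itself.\<close>

lemma Z_support: "v \<in> Z i \<sigma> \<Longrightarrow> v c \<noteq> 0 \<Longrightarrow> c \<in> J i \<and> D i c \<subset> \<sigma>"
proof -
  assume v: "v \<in> Z i \<sigma>" "v c \<noteq> 0"
  then obtain w where w: "w \<in> V (Suc i) \<sigma>" "v = d i w" by (auto simp: Z_def)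
  then obtain c' where c': "c' \<in> J (Suc i)" "A i c c' * w c' \<noteq> 0"
    using v(2) unfolding d_def mat_apply_def by (metis (no_types, lifting) sum.neutral)
  then have "D (Suc i) c' \<subseteq> \<sigma>" using w(1) by (auto simp: V_def strand_def)
  then show ?thesis using A_support[OF c'(1), of c] c'(2) by auto
qed

lemma Z_subset_V: "Z i \<sigma> \<subseteq> V i \<sigma>"
  using Z_support unfolding V_def strand_def by blast

lemma Z_0: "\<sigma> \<subseteq> E \<Longrightarrow> Z 0 \<sigma> = {v \<in> V 0 \<sigma>. \<sigma> \<in> \<Delta> \<longrightarrow> aug v = 0}"
proof (intro set_eqI iffI)
  fix v assume s: "\<sigma> \<subseteq> E"
  { assume "v \<in> Z 0 \<sigma>"
    then show "v \<in> {v \<in> V 0 \<sigma>. \<sigma> \<in> \<Delta> \<longrightarrow> aug v = 0}"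
      using exact_0[OF s, of v] Z_subset_V[of 0 \<sigma>] by (auto simp: V_def aug_def Z_def d_def) }
  { assume "v \<in> {v \<in> V 0 \<sigma>. \<sigma> \<in> \<Delta> \<longrightarrow> aug v = 0}"
    then show "v \<in> Z 0 \<sigma>"
      using exact_0[OF s, of v] by (auto simp: V_def aug_def Z_def d_def) }
qed

lemma Z_Suc: "\<sigma> \<subseteq> E \<Longrightarrow> Z (Suc i) \<sigma> = {v \<in> V (Suc i) \<sigma>. d i v = 0}"
proof (intro set_eqI iffI)
  fix v assume s: "\<sigma> \<subseteq> E"
  { assume "v \<in> Z (Suc i) \<sigma>"
    then show "v \<in> {v \<in> V (Suc i) \<sigma>. d i v = 0}"
      using exact_Suc[OF s, of v i] Z_subset_V[of "Suc i" \<sigma>] by (auto simp: V_def Z_def d_def) }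
  { assume "v \<in> {v \<in> V (Suc i) \<sigma>. d i v = 0}"
    then show "v \<in> Z (Suc i) \<sigma>"
      using exact_Suc[OF s, of v i] by (auto simp: V_def Z_def d_def) }
qed

lemma dim_V: "fvec.dim (V i \<sigma>) = card {c \<in> J i. D i c \<subseteq> \<sigma>}"
  unfolding V_def by (rule dim_strand[OF finite_J])

lemma dim_V_Suc:
  assumes "\<sigma> \<subseteq> E"
  shows "fvec.dim (V (Suc i) \<sigma>) = fvec.dim (Z i \<sigma>) + fvec.dim (Z (Suc i) \<sigma>)"
proof -
  have "fvec.dim (V (Suc i) \<sigma>) = fvec.dim (d i ` V (Suc i) \<sigma>) + fvec.dim {v \<in> V (Suc i) \<sigma>. d i v = 0}"
  proof (rule fvec_pair.rank_nullity[OF linear_d])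
  show "fvec.subspace (V (Suc i) \<sigma>)" unfolding V_def by (rule subspace_strand)
  show "V (Suc i) \<sigma> \<subseteq> fvec.span (unit_vec ` {c \<in> J (Suc i). D (Suc i) c \<subseteq> \<sigma>})"
    unfolding V_def strand_eq_span[OF finite_J] ..
  qed (simp add: finite_J)
  then show ?thesis unfolding Z_Suc[OF assms] by (simp only: Z_def)
qed

lemma dim_V_0:
  assumes "\<sigma> \<subseteq> E"
  shows "fvec.dim (V 0 \<sigma>) = (if \<sigma> \<in> \<Delta> then 1 else 0) + fvec.dim (Z 0 \<sigma>)"
proof (cases "\<sigma> \<in> \<Delta>")
  case False
  then show ?thesis by (simp add: Z_0[OF assms])
next
  case True
  interpret vector_space_pair fscale "(*) :: 'k \<Rightarrow> 'k \<Rightarrow> 'k"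
    by unfold_locales (auto simp: algebra_simps)
  have "fvec.dim (V 0 \<sigma>) = vector_space_over_itself.dim (aug ` V 0 \<sigma>) + fvec.dim {v \<in> V 0 \<sigma>. aug v = 0}"
  proof (rule rank_nullity)
    show "Vector_Spaces.linear fscale (*) aug"
      by unfold_locales (auto simp: aug_def fscale_def algebra_simps sum.distrib sum_distrib_left)
    show "fvec.subspace (V 0 \<sigma>)" unfolding V_def by (rule subspace_strand)
    show "V 0 \<sigma> \<subseteq> fvec.span (unit_vec ` {c \<in> J 0. D 0 c \<subseteq> \<sigma>})"
      unfolding V_def strand_eq_span[OF finite_J] ..
  qed (simp add: finite_J)
  moreover have "vector_space_over_itself.dim (aug ` V 0 \<sigma>) = 1"
  proof (rule vector_space_over_itself.dim_unique)
    show "{1} \<subseteq> aug ` V 0 \<sigma>" using aug_surj[OF True assms] by (force simp: V_def aug_def)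
    show "aug ` V 0 \<sigma> \<subseteq> vector_space_over_itself.span {1}" by (auto simp: vector_space_over_itself.span_singleton)
    show "vector_space_over_itself.independent {1}" by simp
  qed simp
  ultimately show ?thesis using True by (simp add: Z_0[OF assms])
qed

text \<open>Dimensions of strands count basis elements of degree below \<open>\<tau>\<close>, and
  their alternating sum telescopes along the resolution; Moebius inversion over subsets isolates
  degree exactly \<open>\<sigma>\<close>.\<close>

lemma euler:
  assumes \<sigma>: "\<sigma> \<subseteq> E" and vanish: "\<And>i c. k < i \<Longrightarrow> c \<in> J i \<Longrightarrow> False"
  shows "(\<Sum>i\<le>k. (-1) ^ i * int (card {c \<in> J i. D i c = \<sigma>})) =
    (\<Sum>\<gamma>\<in>Pow \<sigma>. (-1) ^ (card \<sigma> + card \<gamma>) * (if \<gamma> \<in> \<Delta> then 1 else 0))"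
proof (rule sum_subset_moebius)
  show "finite \<sigma>" using \<sigma> finite_E finite_subset by blast
next
  fix \<tau> assume "\<tau> \<subseteq> \<sigma>"
  then have \<tau>: "\<tau> \<subseteq> E" "finite \<tau>" using \<sigma> finite_E finite_subset by (blast, metis)
  let ?z = "\<lambda>i. int (fvec.dim (Z i \<tau>))"
  \<comment> \<open>The truncated sum leaves only the last syzygies \<open>Z j\<close> as a
    remainder; for \<open>j = k\<close> these vanish because \<open>V (Suc k)\<close> does.\<close>
  have part: "(\<Sum>i\<le>j. (-1) ^ i * int (fvec.dim (V i \<tau>))) = (if \<tau> \<in> \<Delta> then 1 else 0) + (-1) ^ j * ?z j" for j
    by (induction j) (auto simp: dim_V_0[OF \<tau>(1)] dim_V_Suc[OF \<tau>(1)] algebra_simps)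
  have "V (Suc k) \<tau> \<subseteq> {0}"
    using vanish[of "Suc k"] by (fastforce simp: V_def strand_def fun_eq_iff)
  then have "Z k \<tau> \<subseteq> {0}"
    by (auto simp: Z_def d_def mat_apply_def fun_eq_iff)
  then have "?z k = 0" by (metis fvec.dim_le_card card.empty finite.emptyI fvec.span_empty le_zero_eq of_nat_0)
  then have "(if \<tau> \<in> \<Delta> then 1 else 0) = (\<Sum>i\<le>k. (-1) ^ i * int (fvec.dim (V i \<tau>)))"
    using part[of k] by simp
  also have "\<dots> = (\<Sum>i\<le>k. \<Sum>\<gamma>\<in>Pow \<tau>. (-1) ^ i * int (card {c \<in> J i. D i c = \<gamma>}))"
  proof (rule sum.cong[OF refl])
    fix i
    have "{c \<in> J i. D i c \<subseteq> \<tau>} = (\<Union>\<gamma>\<in>Pow \<tau>. {c \<in> J i. D i c = \<gamma>})" by auto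
    also have "card \<dots> = (\<Sum>\<gamma>\<in>Pow \<tau>. card {c \<in> J i. D i c = \<gamma>})"
      by (rule card_UN_disjoint) (use \<tau>(2) finite_J in auto)
    finally show "(-1) ^ i * int (fvec.dim (V i \<tau>))
      = (\<Sum>\<gamma>\<in>Pow \<tau>. (-1) ^ i * int (card {c \<in> J i. D i c = \<gamma>}))"
      by (simp add: dim_V sum_distrib_left)
  qed
  also have "\<dots> = (\<Sum>\<gamma>\<in>Pow \<tau>. \<Sum>i\<le>k. (-1) ^ i * int (card {c \<in> J i. D i c = \<gamma>}))"
    by (rule sum.swap)
  finally show "(if \<tau> \<in> \<Delta> then 1 else 0) =
    (\<Sum>\<gamma>\<in>Pow \<tau>. \<Sum>i\<le>k. (-1) ^ i * int (card {c \<in> J i. D i c = \<gamma>}))" .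
qed

end

section \<open>Dimension shifting along the Koszul complex\<close>

text \<open>Exactness in cochain degree \<open>p\<close> of the degree-\<open>\<sigma>\<close> part
  of the Koszul complex with coefficients in the module whose squarefree strands are
  \<open>M\<close>, read coordinatewise. Writing \<open>Suc (card \<gamma>) = p\<close> avoids a
  truncated \<open>p - 1\<close>; in degree \<open>0\<close> the condition is that
  \<open>z {}\<close> vanishes.\<close>

definition kexact :: "('e \<Rightarrow> nat) \<Rightarrow> 'e set \<Rightarrow> ('e set \<Rightarrow> (nat \<Rightarrow> 'k::comm_ring_1) set) \<Rightarrow> nat \<Rightarrow> bool" where
  "kexact ord \<sigma> M p \<longleftrightarrow> (\<forall>z.
     (\<forall>\<gamma>\<subseteq>\<sigma>. card \<gamma> = p \<longrightarrow> z \<gamma> \<in> M \<gamma>) \<and>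
     (\<forall>B\<subseteq>\<sigma>. card B = Suc p \<longrightarrow> (\<forall>c. kcob ord (\<lambda>\<gamma>. z \<gamma> c) B = 0)) \<longrightarrow>
     (\<exists>y. (\<forall>\<gamma>\<subseteq>\<sigma>. Suc (card \<gamma>) = p \<longrightarrow> y \<gamma> \<in> M \<gamma>) \<and>
        (\<forall>B\<subseteq>\<sigma>. card B = p \<longrightarrow> (\<forall>c. z B c = kcob ord (\<lambda>\<gamma>. y \<gamma> c) B))))"

text \<open>A free module splits into one Boolean complex for each basis element \<open>c\<close>,
  over the sets containing \<open>D c\<close>. The only cohomology comes from elements of degree
  \<open>\<sigma>\<close> in top degree, and \<open>top\<close> excludes it.\<close>

lemma strand_cochain_exact:
  fixes z :: "'e set \<Rightarrow> nat \<Rightarrow> 'k::field"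
  assumes \<sigma>: "finite \<sigma>" "inj_on ord \<sigma>" and p: "p \<le> card \<sigma>"
    and z: "\<And>\<gamma>. \<gamma> \<subseteq> \<sigma> \<Longrightarrow> card \<gamma> = p \<Longrightarrow> z \<gamma> \<in> strand J D \<gamma>"
    and closed: "\<And>B c. B \<subseteq> \<sigma> \<Longrightarrow> card B = Suc p \<Longrightarrow> kcob ord (\<lambda>\<gamma>. z \<gamma> c) B = 0"
    and top: "\<And>c. p = card \<sigma> \<Longrightarrow> z \<sigma> c \<noteq> 0 \<Longrightarrow> D c \<noteq> \<sigma>"
  obtains y where "\<And>\<gamma>. y \<gamma> \<in> strand J D \<gamma>"
    and "\<And>B c. B \<subseteq> \<sigma> \<Longrightarrow> card B = p \<Longrightarrow> z B c = kcob ord (\<lambda>\<gamma>. y \<gamma> c) B"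
proof -
  have "\<exists>g. (\<forall>A. g A \<noteq> 0 \<longrightarrow> c \<in> J \<and> D c \<subseteq> A) \<and> (\<forall>B\<subseteq>\<sigma>. card B = p \<longrightarrow> kcob ord g B = z B c)" for c
  proof (cases "c \<in> J \<and> D c \<subseteq> \<sigma>")
    case False
    then have "z B c = 0" if "B \<subseteq> \<sigma>" "card B = p" for B
      using z[OF that] that unfolding strand_def by auto
    then show ?thesis by (intro exI[of _ "\<lambda>_. 0"]) (auto simp: kcob_def)
  next
    case True
    define f where "f \<gamma> = (if \<gamma> \<subseteq> \<sigma> \<and> card \<gamma> = p then z \<gamma> c else 0)" for \<gamma>
    have "\<exists>g. (\<forall>A. g A \<noteq> 0 \<longrightarrow> D c \<subseteq> A) \<and> (\<forall>B\<subseteq>\<sigma>. card B = p \<longrightarrow> kcob ord g B = f B)"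
    proof (rule boolean_cochain_exact[OF \<sigma>])
      show "D c \<subseteq> \<sigma>" "p \<le> card \<sigma>" using True p by auto
    next
      fix B assume B: "B \<subseteq> \<sigma>" "card B = Suc p"
      have "kcob ord f B = kcob ord (\<lambda>\<gamma>. z \<gamma> c) B"
      proof (rule kcob_cong)
        fix b assume "b \<in> B"
        then have "card (B - {b}) = p" using B by simp
        then show "f (B - {b}) = z (B - {b}) c" using B by (auto simp: f_def)
      qed
      then show "kcob ord f B = 0" using closed[OF B] by simp
    next
      fix A assume "f A \<noteq> 0"
      then show "D c \<subseteq> A" using z[of A] by (auto simp: f_def strand_def split: if_splits)
    next
      assume "p = card \<sigma>" "f \<sigma> \<noteq> 0"
      then show "D c \<noteq> \<sigma>" using top[of c] by (simp add: f_def)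
    qed
    then show ?thesis using True by (auto simp: f_def)
  qed
  then obtain g where g: "\<And>c A. g c A \<noteq> 0 \<Longrightarrow> c \<in> J \<and> D c \<subseteq> A"
    "\<And>c B. B \<subseteq> \<sigma> \<Longrightarrow> card B = p \<Longrightarrow> kcob ord (g c) B = z B c"
    by metis
  show ?thesis
    by (rule that[of "\<lambda>\<gamma> c. g c \<gamma>"]) (use g in \<open>auto simp: strand_def\<close>)
qed

context squarefree_resolution
begin

lemma d_kcob: "kcob ord (\<lambda>\<gamma>. d i (y \<gamma>) r) B = d i (\<lambda>c. kcob ord (\<lambda>\<gamma>. y \<gamma> c) B) r"
  unfolding d_def mat_apply_def by (rule kcob_sum_scale)

lemma aug_kcob: "kcob ord (\<lambda>\<gamma>. aug (y \<gamma>)) B = aug (\<lambda>c. kcob ord (\<lambda>\<gamma>. y \<gamma> c) B)"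
  unfolding aug_def by (rule kcob_sum_scale)

lemma kcob_in_V:
  assumes "\<And>b. b \<in> B \<Longrightarrow> u (B - {b}) \<in> V i (B - {b})"
  shows "(\<lambda>c. kcob ord (\<lambda>\<gamma>. u \<gamma> c) B) \<in> V i B"
  unfolding V_def strand_def
proof (intro CollectI allI impI)
  fix c assume "kcob ord (\<lambda>\<gamma>. u \<gamma> c) B \<noteq> 0"
  then obtain b where "b \<in> B" "u (B - {b}) c \<noteq> 0"
    unfolding kcob_def by (metis (no_types, lifting) mult_zero_right sum.neutral)
  then show "c \<in> J i \<and> D i c \<subseteq> B" using assms[of b] by (auto simp: V_def strand_def)
qed

lemma diff_in_V: "u \<in> V i \<sigma> \<Longrightarrow> v \<in> V i \<sigma> \<Longrightarrow> (\<lambda>c. u c - v c) \<in> V i \<sigma>"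
proof -
  assume uv: "u \<in> V i \<sigma>" "v \<in> V i \<sigma>"
  have "u c \<noteq> 0 \<or> v c \<noteq> 0" if "u c - v c \<noteq> 0" for c using that by auto
  then show ?thesis using uv unfolding V_def strand_def by blast
qed

lemma d_diff: "d i (\<lambda>c. u c - v c) r = d i u r - d i v r"
  by (simp add: d_def mat_apply_def algebra_simps sum_subtractf)

lemma aug_diff: "aug (\<lambda>c. u c - v c) = aug u - aug v"
  by (simp add: aug_def algebra_simps sum_subtractf)

text \<open>Dimension shifting: a Koszul cocycle in the syzygies is the coboundary of a cochain in the free
  module, whose image is a cocycle one step down in the resolution.\<close>

lemma kexact_Z_Suc:
  assumes "inj_on ord E" "\<sigma> \<subseteq> E" "Suc p \<le> card \<sigma>" "kexact ord \<sigma> (Z i) p"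
  shows "kexact ord \<sigma> (Z (Suc i)) (Suc p)"
  unfolding kexact_def
proof (intro allI impI, elim conjE)
  fix z
  assume z: "\<forall>\<gamma>\<subseteq>\<sigma>. card \<gamma> = Suc p \<longrightarrow> z \<gamma> \<in> Z (Suc i) \<gamma>"
    and closed: "\<forall>B\<subseteq>\<sigma>. card B = Suc (Suc p) \<longrightarrow> (\<forall>c. kcob ord (\<lambda>\<gamma>. z \<gamma> c) B = 0)"
  have fin: "finite \<gamma>" if "\<gamma> \<subseteq> \<sigma>" for \<gamma> using that assms(2) finite_E finite_subset by metis
  have inj: "inj_on ord \<gamma>" if "\<gamma> \<subseteq> \<sigma>" for \<gamma> using that assms(1,2) inj_on_subset by metis
  have zV: "z \<gamma> \<in> V (Suc i) \<gamma>" "d i (z \<gamma>) = 0" if "\<gamma> \<subseteq> \<sigma>" "card \<gamma> = Suc p" for \<gamma>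
    using z that assms(2) Z_Suc[of \<gamma> i] by auto
  obtain y where y: "\<And>\<gamma>. y \<gamma> \<in> V (Suc i) \<gamma>"
    "\<And>B c. B \<subseteq> \<sigma> \<Longrightarrow> card B = Suc p \<Longrightarrow> z B c = kcob ord (\<lambda>\<gamma>. y \<gamma> c) B"
    unfolding V_def
  proof (rule strand_cochain_exact[OF fin inj assms(3), of z "J (Suc i)" "D (Suc i)"])
    fix \<gamma> assume "\<gamma> \<subseteq> \<sigma>" "card \<gamma> = Suc p"
    then show "z \<gamma> \<in> strand (J (Suc i)) (D (Suc i)) \<gamma>" using zV(1) by (simp add: V_def)
  next
    \<comment> \<open>Minimality: syzygies of degree \<open>\<sigma>\<close> avoid basis elements of
      degree \<open>\<sigma>\<close>, so the obstruction of the free module never occurs.\<close>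
    fix c assume "Suc p = card \<sigma>" "z \<sigma> c \<noteq> 0"
    then show "D (Suc i) c \<noteq> \<sigma>" using z Z_support[of "z \<sigma>" "Suc i" \<sigma> c] by auto
  qed (use closed in auto)
  have "\<exists>g. (\<forall>\<gamma>\<subseteq>\<sigma>. Suc (card \<gamma>) = p \<longrightarrow> g \<gamma> \<in> Z i \<gamma>) \<and>
        (\<forall>B\<subseteq>\<sigma>. card B = p \<longrightarrow> (\<forall>c. d i (y B) c = kcob ord (\<lambda>\<gamma>. g \<gamma> c) B))"
    using assms(4) unfolding kexact_def
  proof (rule allE[of _ "\<lambda>\<gamma>. d i (y \<gamma>)"], elim impE)
    have "kcob ord (\<lambda>\<gamma>. d i (y \<gamma>) c) B = 0" if "B \<subseteq> \<sigma>" "card B = Suc p" for B c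
    proof -
      have "(\<lambda>c. kcob ord (\<lambda>\<gamma>. y \<gamma> c) B) = z B" using y(2)[OF that] by auto
      then show ?thesis using zV(2)[OF that] by (simp add: d_kcob)
    qed
    then show "(\<forall>\<gamma>\<subseteq>\<sigma>. card \<gamma> = p \<longrightarrow> d i (y \<gamma>) \<in> Z i \<gamma>) \<and>
      (\<forall>B\<subseteq>\<sigma>. card B = Suc p \<longrightarrow> (\<forall>c. kcob ord (\<lambda>\<gamma>. d i (y \<gamma>) c) B = 0))"
      using y(1) by (auto simp: Z_def)
  qed
  then obtain g where g: "\<And>\<gamma>. \<gamma> \<subseteq> \<sigma> \<Longrightarrow> Suc (card \<gamma>) = p \<Longrightarrow> g \<gamma> \<in> Z i \<gamma>"
    "\<And>B c. B \<subseteq> \<sigma> \<Longrightarrow> card B = p \<Longrightarrow> d i (y B) c = kcob ord (\<lambda>\<gamma>. g \<gamma> c) B" by auto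
  have "\<exists>u. \<forall>\<gamma>. \<gamma> \<subseteq> \<sigma> \<and> Suc (card \<gamma>) = p \<longrightarrow> u \<gamma> \<in> V (Suc i) \<gamma> \<and> g \<gamma> = d i (u \<gamma>)"
    by (rule choice) (use g(1) in \<open>auto simp: Z_def\<close>)
  then obtain u where u: "\<And>\<gamma>. \<gamma> \<subseteq> \<sigma> \<Longrightarrow> Suc (card \<gamma>) = p \<Longrightarrow> u \<gamma> \<in> V (Suc i) \<gamma> \<and> g \<gamma> = d i (u \<gamma>)"
    by auto
  \<comment> \<open>Subtracting the coboundary of the lift \<open>u\<close> makes \<open>y\<close> a
    syzygy without changing the coboundary of \<open>y\<close>, by \<open>kcob_kcob\<close>.\<close>
  define \<delta>u where "\<delta>u B = (\<lambda>c. kcob ord (\<lambda>\<gamma>. u \<gamma> c) B)" for B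
  define y' where "y' B = (\<lambda>c. y B c - \<delta>u B c)" for B
  show "\<exists>y. (\<forall>\<gamma>\<subseteq>\<sigma>. Suc (card \<gamma>) = Suc p \<longrightarrow> y \<gamma> \<in> Z (Suc i) \<gamma>) \<and>
        (\<forall>B\<subseteq>\<sigma>. card B = Suc p \<longrightarrow> (\<forall>c. z B c = kcob ord (\<lambda>\<gamma>. y \<gamma> c) B))"
  proof (intro exI[of _ y'] conjI allI impI)
    fix B assume B: "B \<subseteq> \<sigma>" "Suc (card B) = Suc p"
    have sub: "B - {b} \<subseteq> \<sigma>" "Suc (card (B - {b})) = p" if "b \<in> B" for b
      using B card_Suc_Diff1[OF fin[OF B(1)] that] by auto
    have "\<delta>u B \<in> V (Suc i) B"
      unfolding \<delta>u_def by (rule kcob_in_V) (use u sub in auto)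
    then have "y' B \<in> V (Suc i) B" unfolding y'_def using y(1) by (intro diff_in_V)
    moreover have "d i (y' B) r = 0" for r
    proof -
      have "d i (\<delta>u B) r = kcob ord (\<lambda>\<gamma>. d i (u \<gamma>) r) B"
        unfolding \<delta>u_def d_kcob ..
      also have "\<dots> = kcob ord (\<lambda>\<gamma>. g \<gamma> r) B"
        by (rule kcob_cong) (use u sub in auto)
      also have "\<dots> = d i (y B) r" using g(2)[of B r] B by simp
      finally show ?thesis unfolding y'_def d_diff by simp
    qed
    ultimately show "y' B \<in> Z (Suc i) B"
      using B(1) assms(2) by (auto simp: Z_Suc fun_eq_iff)
  next
    fix B c assume B: "B \<subseteq> \<sigma>" "card B = Suc p"
    have "kcob ord (\<lambda>\<gamma>. \<delta>u \<gamma> c) B = 0"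
      unfolding \<delta>u_def using kcob_kcob[OF fin[OF B(1)] inj[OF B(1)], of "\<lambda>\<gamma>. u \<gamma> c"] by simp
    then show "z B c = kcob ord (\<lambda>\<gamma>. y' \<gamma> c) B"
      using y(2)[OF B] by (simp add: y'_def kcob_diff)
  qed
qed

text \<open>The shift ends in the Stanley-Reisner ring: augmenting a cochain of the free module
  gives a cocycle of scalars on the independent sets, to which \<open>matroid_cochain_exact\<close>
  applies with nothing contracted. The top degree of that complex over \<open>\<sigma>\<close> is
  the rank \<open>card \<sigma> - \<nu> \<sigma>\<close>.\<close>

lemma kexact_Z_0:
  assumes "inj_on ord E" "\<sigma> \<subseteq> E" "matroid_nullity E \<nu>" "\<And>\<gamma>. \<gamma> \<subseteq> E \<Longrightarrow> \<gamma> \<in> \<Delta> \<longleftrightarrow> \<nu> \<gamma> = 0"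
    and p: "p + \<nu> \<sigma> < card \<sigma>"
  shows "kexact ord \<sigma> (Z 0) (Suc p)"
  unfolding kexact_def
proof (intro allI impI, elim conjE)
  fix z
  assume z: "\<forall>\<gamma>\<subseteq>\<sigma>. card \<gamma> = Suc p \<longrightarrow> z \<gamma> \<in> Z 0 \<gamma>"
    and closed: "\<forall>B\<subseteq>\<sigma>. card B = Suc (Suc p) \<longrightarrow> (\<forall>c. kcob ord (\<lambda>\<gamma>. z \<gamma> c) B = 0)"
  have fin: "finite \<gamma>" if "\<gamma> \<subseteq> \<sigma>" for \<gamma> using that assms(2) finite_E finite_subset by metis
  have inj: "inj_on ord \<gamma>" if "\<gamma> \<subseteq> \<sigma>" for \<gamma> using that assms(1,2) inj_on_subset by metis
  have zV: "z \<gamma> \<in> V 0 \<gamma>" "\<gamma> \<in> \<Delta> \<Longrightarrow> aug (z \<gamma>) = 0" if "\<gamma> \<subseteq> \<sigma>" "card \<gamma> = Suc p" for \<gamma>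
    using z that assms(2) Z_0[of \<gamma>] by auto
  obtain y where y: "\<And>\<gamma>. y \<gamma> \<in> V 0 \<gamma>"
    "\<And>B c. B \<subseteq> \<sigma> \<Longrightarrow> card B = Suc p \<Longrightarrow> z B c = kcob ord (\<lambda>\<gamma>. y \<gamma> c) B"
    unfolding V_def
  proof (rule strand_cochain_exact[OF fin inj, where p = "Suc p" and z = z and J = "J 0" and D = "D 0"])
    fix \<gamma> assume "\<gamma> \<subseteq> \<sigma>" "card \<gamma> = Suc p"
    then show "z \<gamma> \<in> strand (J 0) (D 0) \<gamma>" using zV(1) by (simp add: V_def)
  next
    fix c assume "Suc p = card \<sigma>" "z \<sigma> c \<noteq> 0"
    then show "D 0 c \<noteq> \<sigma>" using z Z_support[of "z \<sigma>" 0 \<sigma> c] by auto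
  qed (use closed p in auto)
  have "\<exists>g. (\<forall>A. g A \<noteq> 0 \<longrightarrow> {} \<subseteq> A) \<and>
    (\<forall>B. \<nu> B = 0 \<longrightarrow> B \<subseteq> {} \<union> \<sigma> \<longrightarrow> card B = p \<longrightarrow> kcob ord g B = aug (y B))"
  proof (rule matroid_cochain_exact[OF assms(3) finite_E assms(1) fin assms(2)])
    show "\<nu> {} = 0" using assms(3) by (simp add: matroid_nullity_def)
  next
    fix B assume B: "\<nu> B = 0" "B \<subseteq> {} \<union> \<sigma>" "card B = Suc p"
    then have "(\<lambda>c. kcob ord (\<lambda>\<gamma>. y \<gamma> c) B) = z B" using y(2)[of B] by auto
    then show "kcob ord (\<lambda>B. aug (y B)) B = 0"
      using zV(2)[of B] B assms(2,4) by (auto simp: aug_kcob)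
  qed (use p in auto)
  then obtain g where g: "\<And>B. \<nu> B = 0 \<Longrightarrow> B \<subseteq> \<sigma> \<Longrightarrow> card B = p \<Longrightarrow> kcob ord g B = aug (y B)"
    by auto
  have "\<exists>u. \<forall>\<gamma>. (\<gamma> \<subseteq> \<sigma> \<longrightarrow> u \<gamma> \<in> V 0 \<gamma>) \<and> (\<gamma> \<subseteq> \<sigma> \<and> \<gamma> \<in> \<Delta> \<longrightarrow> aug (u \<gamma>) = g \<gamma>)"
  proof (rule choice, rule allI)
    fix \<gamma>
    show "\<exists>v. (\<gamma> \<subseteq> \<sigma> \<longrightarrow> v \<in> V 0 \<gamma>) \<and> (\<gamma> \<subseteq> \<sigma> \<and> \<gamma> \<in> \<Delta> \<longrightarrow> aug v = g \<gamma>)"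
    proof (cases "\<gamma> \<subseteq> \<sigma> \<and> \<gamma> \<in> \<Delta>")
      case True
      then obtain v where v: "v \<in> V 0 \<gamma>" "aug v = 1"
        using aug_surj[of \<gamma>] assms(2) by (auto simp: V_def aug_def)
      have "aug (fscale (g \<gamma>) v) = g \<gamma> * aug v"
        by (simp add: aug_def fscale_def sum_distrib_left ac_simps)
      moreover have "fscale (g \<gamma>) v \<in> V 0 \<gamma>"
        using v(1) subspace_strand unfolding V_def by (rule fvec.subspace_scale[rotated])
      ultimately show ?thesis using v(2) by auto
    next
      case False
      have "(0 :: nat \<Rightarrow> 'k) \<in> V 0 \<gamma>" by (simp add: V_def strand_def)
      then show ?thesis using False by blast
    qed
  qed
  then obtain u where u: "\<And>\<gamma>. \<gamma> \<subseteq> \<sigma> \<Longrightarrow> u \<gamma> \<in> V 0 \<gamma>" "\<And>\<gamma>. \<gamma> \<subseteq> \<sigma> \<Longrightarrow> \<gamma> \<in> \<Delta> \<Longrightarrow> aug (u \<gamma>) = g \<gamma>"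
    by auto
  define \<delta>u where "\<delta>u B = (\<lambda>c. kcob ord (\<lambda>\<gamma>. u \<gamma> c) B)" for B
  define y' where "y' B = (\<lambda>c. y B c - \<delta>u B c)" for B
  show "\<exists>y. (\<forall>\<gamma>\<subseteq>\<sigma>. Suc (card \<gamma>) = Suc p \<longrightarrow> y \<gamma> \<in> Z 0 \<gamma>) \<and>
        (\<forall>B\<subseteq>\<sigma>. card B = Suc p \<longrightarrow> (\<forall>c. z B c = kcob ord (\<lambda>\<gamma>. y \<gamma> c) B))"
  proof (intro exI[of _ y'] conjI allI impI)
    fix B assume B: "B \<subseteq> \<sigma>" "Suc (card B) = Suc p"
    have sub: "B - {b} \<subseteq> \<sigma>" for b
      using B by auto
    have "\<delta>u B \<in> V 0 B"
      unfolding \<delta>u_def by (rule kcob_in_V) (use u(1) sub in auto)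
    then have "y' B \<in> V 0 B" unfolding y'_def using y(1) by (intro diff_in_V)
    moreover have "aug (y' B) = 0" if "B \<in> \<Delta>"
    proof -
      have BE: "B \<subseteq> E" using B assms(2) by auto
      have \<nu>B: "\<nu> B = 0" using assms(4)[OF BE] that by simp
      have sub\<Delta>: "B - {b} \<in> \<Delta>" for b
      proof -
        have "\<nu> (B - {b}) = 0"
          using matroid_nullity_mono[OF assms(3) _ BE finite_E, of "B - {b}"] \<nu>B by auto
        then show ?thesis using assms(4)[of "B - {b}"] BE by auto
      qed
      have "aug (\<delta>u B) = kcob ord (\<lambda>\<gamma>. aug (u \<gamma>)) B"
        unfolding \<delta>u_def aug_kcob ..
      also have "\<dots> = kcob ord g B"
        by (rule kcob_cong) (use u(2) sub sub\<Delta> in auto)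
      also have "\<dots> = aug (y B)" using g[of B] \<nu>B B by simp
      finally show ?thesis unfolding y'_def aug_diff by simp
    qed
    ultimately show "y' B \<in> Z 0 B"
      using B(1) assms(2) by (auto simp: Z_0)
  next
    fix B c assume B: "B \<subseteq> \<sigma>" "card B = Suc p"
    have "kcob ord (\<lambda>\<gamma>. \<delta>u \<gamma> c) B = 0"
      unfolding \<delta>u_def using kcob_kcob[OF fin[OF B(1)] inj[OF B(1)], of "\<lambda>\<gamma>. u \<gamma> c"] by simp
    then show "z B c = kcob ord (\<lambda>\<gamma>. y' \<gamma> c) B"
      using y(2)[OF B] by (simp add: y'_def kcob_diff)
  qed
qed

text \<open>A nonzero syzygy of degree \<open>{}\<close> would involve basis elements of degree
  properly below \<open>{}\<close>.\<close>

lemma kexact_Z_bot: "kexact ord \<sigma> (Z i) 0" if "\<sigma> \<subseteq> E"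
  unfolding kexact_def
proof (intro allI impI, elim conjE)
  fix z
  assume z: "\<forall>\<gamma>\<subseteq>\<sigma>. card \<gamma> = 0 \<longrightarrow> z \<gamma> \<in> Z i \<gamma>"
    and closed: "\<forall>B\<subseteq>\<sigma>. card B = Suc 0 \<longrightarrow> (\<forall>c. kcob ord (\<lambda>\<gamma>. z \<gamma> c) B = 0)"
  have "finite \<sigma>" using that finite_E finite_subset by metis
  have z0: "z {} c = 0" for c
    using z Z_support[of "z {}" i "{}" c] by auto
  have "z B c = kcob ord (\<lambda>\<gamma>. z \<gamma> c) B" if "B \<subseteq> \<sigma>" "card B = 0" for B c
  proof -
    have "B = {}" using that \<open>finite \<sigma>\<close> finite_subset by (metis card_0_eq)
    then show ?thesis by (simp add: kcob_def z0)
  qed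
  then show "\<exists>y. (\<forall>\<gamma>\<subseteq>\<sigma>. Suc (card \<gamma>) = 0 \<longrightarrow> y \<gamma> \<in> Z i \<gamma>) \<and>
        (\<forall>B\<subseteq>\<sigma>. card B = 0 \<longrightarrow> (\<forall>c. z B c = kcob ord (\<lambda>\<gamma>. y \<gamma> c) B))"
    by (intro exI[of _ z]) simp
qed

text \<open>Each shift raises the cochain degree and the homological degree together, so the range
  below the rank of \<open>\<sigma>\<close> at the start widens by one at each step.\<close>

lemma kexact_Z:
  assumes "inj_on ord E" "\<sigma> \<subseteq> E" "matroid_nullity E \<nu>" "\<And>\<gamma>. \<gamma> \<subseteq> E \<Longrightarrow> \<gamma> \<in> \<Delta> \<longleftrightarrow> \<nu> \<gamma> = 0"
  shows "p \<le> card \<sigma> \<Longrightarrow> p + \<nu> \<sigma> \<le> card \<sigma> + i \<Longrightarrow> kexact ord \<sigma> (Z i) p"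
proof (induction i arbitrary: p)
  case 0
  show ?case
  proof (cases p)
    case (Suc p')
    then show ?thesis using kexact_Z_0[OF assms, of p'] 0 by simp
  qed (simp add: kexact_Z_bot[OF assms(2)])
next
  case (Suc i)
  show ?case
  proof (cases p)
    case (Suc p')
    then show ?thesis using kexact_Z_Suc[OF assms(1,2), of p' i] Suc.IH[of p'] Suc.prems by simp
  qed (simp add: kexact_Z_bot[OF assms(2)])
qed

text \<open>If the nullity of \<open>\<sigma> = D i c0\<close> were below \<open>i\<close>, Koszul
  exactness in top degree would express the boundary of the basis vector at \<open>c0\<close> by
  vectors from the facets of \<open>\<sigma>\<close>. Subtracting them yields a syzygy whose
  coordinate at \<open>c0\<close> is \<open>1\<close>, against minimality.\<close>

lemma vanishing:
  assumes "matroid_nullity E \<nu>" "\<And>\<gamma>. \<gamma> \<subseteq> E \<Longrightarrow> \<gamma> \<in> \<Delta> \<longleftrightarrow> \<nu> \<gamma> = 0" and c0: "c0 \<in> J i"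
  shows "i \<le> \<nu> (D i c0)"
proof (rule ccontr)
  define \<sigma> where "\<sigma> = D i c0"
  assume "\<not> i \<le> \<nu> (D i c0)"
  then obtain j where j: "i = Suc j" "\<nu> \<sigma> \<le> j" by (cases i) (auto simp: \<sigma>_def)
  obtain ord :: "'e \<Rightarrow> nat" where ord: "inj_on ord E"
    using finite_imp_inj_to_nat_seg[OF finite_E] by auto
  have \<sigma>E: "\<sigma> \<subseteq> E" using D_E[OF c0] by (simp add: \<sigma>_def)
  have fin: "finite \<sigma>" using \<sigma>E finite_E finite_subset by metis
  let ?e = "unit_vec c0 :: nat \<Rightarrow> 'k"
  have eV: "?e \<in> V (Suc j) \<sigma>" using c0 j(1) by (auto simp: V_def strand_def unit_vec_def \<sigma>_def)
  have "kexact ord \<sigma> (Z j) (card \<sigma>)"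
    by (rule kexact_Z[OF ord \<sigma>E assms(1,2)]) (use j(2) in auto)
  then have "\<exists>y. (\<forall>\<gamma>\<subseteq>\<sigma>. Suc (card \<gamma>) = card \<sigma> \<longrightarrow> y \<gamma> \<in> Z j \<gamma>) \<and>
        (\<forall>B\<subseteq>\<sigma>. card B = card \<sigma> \<longrightarrow> (\<forall>c. d j ?e c = kcob ord (\<lambda>\<gamma>. y \<gamma> c) B))"
    unfolding kexact_def
  \<comment> \<open>In top degree only \<open>\<gamma> = \<sigma>\<close> is tested, and no subset
    has the next size, so the constant cochain serves and is closed.\<close>
  proof (rule allE[of _ "\<lambda>_. d j ?e"], elim impE)
    have "\<gamma> = \<sigma>" if "\<gamma> \<subseteq> \<sigma>" "card \<gamma> = card \<sigma>" for \<gamma> using that fin by (simp add: card_subset_eq)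
    moreover have "\<not> (card B = Suc (card \<sigma>))" if "B \<subseteq> \<sigma>" for B using card_mono[OF fin that] by simp
    ultimately show "(\<forall>\<gamma>\<subseteq>\<sigma>. card \<gamma> = card \<sigma> \<longrightarrow> d j ?e \<in> Z j \<gamma>) \<and>
      (\<forall>B\<subseteq>\<sigma>. card B = Suc (card \<sigma>) \<longrightarrow> (\<forall>c. kcob ord (\<lambda>\<gamma>. d j ?e c) B = 0))"
      using eV by (auto simp: Z_def)
  qed
  then obtain y where y: "\<And>\<gamma>. \<gamma> \<subseteq> \<sigma> \<Longrightarrow> Suc (card \<gamma>) = card \<sigma> \<Longrightarrow> y \<gamma> \<in> Z j \<gamma>"
    "\<And>c. d j ?e c = kcob ord (\<lambda>\<gamma>. y \<gamma> c) \<sigma>" by auto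
  have "\<exists>u. \<forall>\<gamma>. \<gamma> \<subseteq> \<sigma> \<and> Suc (card \<gamma>) = card \<sigma> \<longrightarrow> u \<gamma> \<in> V (Suc j) \<gamma> \<and> y \<gamma> = d j (u \<gamma>)"
    by (rule choice) (use y(1) in \<open>auto simp: Z_def\<close>)
  then obtain u where u: "\<And>\<gamma>. \<gamma> \<subseteq> \<sigma> \<Longrightarrow> Suc (card \<gamma>) = card \<sigma> \<Longrightarrow> u \<gamma> \<in> V (Suc j) \<gamma> \<and> y \<gamma> = d j (u \<gamma>)"
    by auto
  have sub: "\<sigma> - {b} \<subseteq> \<sigma>" "Suc (card (\<sigma> - {b})) = card \<sigma>" if "b \<in> \<sigma>" for b
    using card_Suc_Diff1[OF fin that] by auto
  define w where "w = (\<lambda>c. kcob ord (\<lambda>\<gamma>. u \<gamma> c) \<sigma>)"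
  have wV: "w \<in> V (Suc j) \<sigma>"
    unfolding w_def by (rule kcob_in_V) (use u sub in auto)
  \<comment> \<open>The parts of \<open>w\<close> come from the degrees
    \<open>\<sigma> - {b}\<close>, none of which contains \<open>D i c0 = \<sigma>\<close>.\<close>
  have "w c0 = 0"
    unfolding w_def kcob_def
  proof (rule sum.neutral, rule ballI)
    fix b assume b: "b \<in> \<sigma>"
    have "u (\<sigma> - {b}) c0 = 0"
      using u[OF sub[OF b]] b j(1) unfolding V_def strand_def \<sigma>_def by auto
    then show "ksign ord b \<sigma> * u (\<sigma> - {b}) c0 = 0" by simp
  qed
  have "d j w r = d j ?e r" for r
  proof -
    have "d j w r = kcob ord (\<lambda>\<gamma>. d j (u \<gamma>) r) \<sigma>"
      unfolding w_def d_kcob ..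
    also have "\<dots> = kcob ord (\<lambda>\<gamma>. y \<gamma> r) \<sigma>"
      by (rule kcob_cong) (use u sub in auto)
    finally show ?thesis using y(2) by simp
  qed
  then have "d j (\<lambda>c. ?e c - w c) = 0" by (auto simp: fun_eq_iff d_diff)
  then have "(\<lambda>c. ?e c - w c) \<in> Z (Suc j) \<sigma>"
    using diff_in_V[OF eV wV] by (simp add: Z_Suc[OF \<sigma>E])
  from Z_support[OF this, of c0] show False
    using \<open>w c0 = 0\<close> j(1) by (simp add: unit_vec_def \<sigma>_def)
qed

end

section \<open>Multigraded resolutions and squarefree strands\<close>

lemma lookup_set_exponent:
  "finite \<sigma> \<Longrightarrow> Poly_Mapping.lookup (set_exponent \<sigma>) e = (if e \<in> \<sigma> then 1 else 0)"
  unfolding set_exponent_def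
  by (induction \<sigma> rule: finite_induct) (auto simp: lookup_add lookup_single when_def)

lemma keys_set_exponent: "finite \<sigma> \<Longrightarrow> Poly_Mapping.keys (set_exponent \<sigma>) = \<sigma>"
  by (auto simp: in_keys_iff lookup_set_exponent split: if_splits)

definition adds_exp :: "('e \<Rightarrow>\<^sub>0 nat) \<Rightarrow> ('e \<Rightarrow>\<^sub>0 nat) \<Rightarrow> bool" where
  "adds_exp d m \<longleftrightarrow> (\<forall>e. Poly_Mapping.lookup d e \<le> Poly_Mapping.lookup m e)"

lemma adds_exp_minus_add: "adds_exp d m \<Longrightarrow> (m - d) + d = m"
  by (rule poly_mapping_eqI) (simp add: adds_exp_def lookup_add lookup_minus)

lemma adds_exp_add [simp]: "adds_exp d (u + d)" "adds_exp d (d + u)"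
  by (simp_all add: adds_exp_def lookup_add)

lemma adds_exp_trans: "adds_exp a b \<Longrightarrow> adds_exp b c \<Longrightarrow> adds_exp a c"
  by (meson adds_exp_def order_trans)

lemma keys_adds_exp: "adds_exp d m \<Longrightarrow> Poly_Mapping.keys d \<subseteq> Poly_Mapping.keys m"
  unfolding adds_exp_def by (metis in_keys_iff le_zero_eq subsetI)

lemma adds_exp_set_exponent_left:
  "finite \<sigma> \<Longrightarrow> adds_exp (set_exponent \<sigma>) m \<longleftrightarrow> \<sigma> \<subseteq> Poly_Mapping.keys m"
  by (auto simp: adds_exp_def lookup_set_exponent in_keys_iff Suc_le_eq)

lemma adds_exp_set_exponent_right:
  assumes "finite E" "\<sigma> \<subseteq> E"
  shows "adds_exp d (set_exponent \<sigma>) \<longleftrightarrow> adds_exp d (set_exponent E) \<and> Poly_Mapping.keys d \<subseteq> \<sigma>"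
proof -
  have "finite \<sigma>" using assms finite_subset by metis
  then have "adds_exp d (set_exponent \<sigma>) \<longleftrightarrow>
    (\<forall>e. if e \<in> \<sigma> then Poly_Mapping.lookup d e \<le> 1 else Poly_Mapping.lookup d e = 0)"
    by (auto simp: adds_exp_def lookup_set_exponent)
  moreover have "adds_exp d (set_exponent E) \<longleftrightarrow>
    (\<forall>e. if e \<in> E then Poly_Mapping.lookup d e \<le> 1 else Poly_Mapping.lookup d e = 0)"
    using assms(1) by (auto simp: adds_exp_def lookup_set_exponent)
  ultimately show ?thesis
    using assms(2) by (auto simp: in_keys_iff split: if_splits)
qed

lemma squarefree_exponent:
  assumes "finite E" "adds_exp d (set_exponent E)"
  shows "d = set_exponent (Poly_Mapping.keys d)"
proof (rule poly_mapping_eqI)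
  fix e
  have "Poly_Mapping.lookup d e \<le> 1"
    using assms by (auto simp: adds_exp_def lookup_set_exponent split: if_splits elim: allE[of _ e])
  then show "Poly_Mapping.lookup d e = Poly_Mapping.lookup (set_exponent (Poly_Mapping.keys d)) e"
    by (auto simp: lookup_set_exponent in_keys_iff)
qed

lemma lookup_single_times:
  fixes p :: "('e, 'k::field) mvpoly"
  shows "Poly_Mapping.lookup (Poly_Mapping.single t a * p) u =
    (if adds_exp t u then a * Poly_Mapping.lookup p (u - t) else 0)"
proof -
  have "Poly_Mapping.lookup (Poly_Mapping.single t a * p) u
      = a * (\<Sum>q. Poly_Mapping.lookup p q when u = t + q)"
    by (simp add: lookup_mult lookup_single when_mult)
  also have "\<dots> = (if adds_exp t u then a * Poly_Mapping.lookup p (u - t) else 0)"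
  proof (cases "adds_exp t u")
    case True
    then have "u = t + q \<longleftrightarrow> q = u - t" for q
      using adds_exp_minus_add[OF True] by (metis add.commute add_left_cancel)
    then show ?thesis using True by simp
  next
    case False
    then have "u \<noteq> t + q" for q by auto
    then show ?thesis using False by simp
  qed
  finally show ?thesis .
qed

text \<open>The homogeneous component of degree \<open>m\<close> as a vector of scalars. Subtraction
  of exponents is truncated, hence the divisibility guard. \<open>exp_embed\<close> puts such a
  vector back into degree \<open>m\<close>.\<close>

definition exp_strand :: "(nat \<Rightarrow> 'e \<Rightarrow>\<^sub>0 nat) \<Rightarrow> nat \<Rightarrow> ('e \<Rightarrow>\<^sub>0 nat) \<Rightarrow> (nat \<Rightarrow> ('e, 'k::field) mvpoly) \<Rightarrow> nat \<Rightarrow> 'k" where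
  "exp_strand dg b m w c = (if c < b \<and> adds_exp (dg c) m then Poly_Mapping.lookup (w c) (m - dg c) else 0)"

definition exp_embed :: "(nat \<Rightarrow> 'e \<Rightarrow>\<^sub>0 nat) \<Rightarrow> ('e \<Rightarrow>\<^sub>0 nat) \<Rightarrow> (nat \<Rightarrow> 'k::field) \<Rightarrow> nat \<Rightarrow> ('e, 'k) mvpoly" where
  "exp_embed dg m v c = Poly_Mapping.single (m - dg c) (v c)"

lemma exp_strand_embed:
  assumes "\<And>c. v c \<noteq> 0 \<Longrightarrow> c < b \<and> adds_exp (dg c) m'"
  shows "exp_strand dg b m (exp_embed dg m' v) = (if m = m' then v else 0)"
proof
  fix c
  show "exp_strand dg b m (exp_embed dg m' v) c = (if m = m' then v else 0) c"
  proof (cases "v c = 0")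
    case True
    then show ?thesis by (simp add: exp_strand_def exp_embed_def)
  next
    case False
    then have c: "c < b" "adds_exp (dg c) m'" using assms by auto
    have "m' - dg c = m - dg c \<longleftrightarrow> m = m'" if "adds_exp (dg c) m"
      using adds_exp_minus_add[OF that] adds_exp_minus_add[OF c(2)] by metis
    then show ?thesis using c by (auto simp: exp_strand_def exp_embed_def lookup_single when_def)
  qed
qed

lemma exp_strand_eqI:
  assumes "\<And>c. c \<ge> b \<Longrightarrow> w c = 0" "\<And>c. c \<ge> b \<Longrightarrow> w' c = 0"
    and "\<And>m. exp_strand dg b m w = exp_strand dg b m w'"
  shows "w = w'"
proof
  fix c
  show "w c = w' c"
  proof (cases "c < b")
    case True
    show ?thesis
    proof (rule poly_mapping_eqI)
      fix u
      show "Poly_Mapping.lookup (w c) u = Poly_Mapping.lookup (w' c) u"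
        using fun_cong[OF assms(3)[of "u + dg c"], of c] True by (simp add: exp_strand_def)
    qed
  qed (use assms in simp)
qed

lemma poly_ring_0: "0 \<in> poly_ring E"
  by (simp add: poly_ring_def)

lemma poly_ring_add: "p \<in> poly_ring E \<Longrightarrow> q \<in> poly_ring E \<Longrightarrow> p + q \<in> poly_ring E"
  unfolding poly_ring_def using keys_add[of p q] by blast

lemma poly_ring_sum: "(\<And>x. x \<in> S \<Longrightarrow> f x \<in> poly_ring E) \<Longrightarrow> sum f S \<in> poly_ring E"
  by (induction S rule: infinite_finite_induct) (auto intro: poly_ring_0 poly_ring_add)

lemma poly_ring_single: "Poly_Mapping.keys m \<subseteq> E \<Longrightarrow> Poly_Mapping.single m a \<in> poly_ring E"
  by (simp add: poly_ring_def)

lemma keys_minus_exp: "Poly_Mapping.keys (m - d) \<subseteq> Poly_Mapping.keys (m :: 'e \<Rightarrow>\<^sub>0 nat)"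
  by (auto simp: in_keys_iff lookup_minus)

lemma keys_add_exp: "Poly_Mapping.keys (m + d) = Poly_Mapping.keys m \<union> Poly_Mapping.keys (d :: 'e \<Rightarrow>\<^sub>0 nat)"
  by (auto simp: in_keys_iff lookup_add)

lemma exp_embed_free_module:
  assumes "\<And>c. v c \<noteq> 0 \<Longrightarrow> c < b" "Poly_Mapping.keys m \<subseteq> E"
  shows "exp_embed dg m v \<in> free_module E b"
proof -
  have "v c = 0" if "b \<le> c" for c using assms(1)[of c] that by auto
  moreover have "exp_embed dg m v c \<in> poly_ring E" for c
    unfolding exp_embed_def using keys_minus_exp[of m "dg c"] assms(2) by (intro poly_ring_single) blast
  ultimately show ?thesis unfolding free_module_def by (simp add: exp_embed_def)
qed

lemma exp_strand_support:
  assumes w: "w \<in> free_module E b" and dg: "\<And>c. c < b \<Longrightarrow> Poly_Mapping.keys (dg c) \<subseteq> E"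
  shows "exp_strand dg b m w \<noteq> 0 \<Longrightarrow> Poly_Mapping.keys m \<subseteq> E"
    and "finite {m. exp_strand dg b m w \<noteq> 0}"
proof -
  have key: "\<exists>c<b. \<exists>u\<in>Poly_Mapping.keys (w c). m = u + dg c" if "exp_strand dg b m w \<noteq> 0" for m
  proof -
    from that obtain c where "exp_strand dg b m w c \<noteq> 0" by (auto simp: fun_eq_iff)
    then have c: "c < b" "adds_exp (dg c) m" "Poly_Mapping.lookup (w c) (m - dg c) \<noteq> 0"
      by (auto simp: exp_strand_def split: if_splits)
    then show ?thesis using adds_exp_minus_add[OF c(2)] by (metis in_keys_iff)
  qed
  show "Poly_Mapping.keys m \<subseteq> E" if "exp_strand dg b m w \<noteq> 0"
  proof -
    obtain c u where c: "c < b" "u \<in> Poly_Mapping.keys (w c)" "m = u + dg c"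
      using key[OF \<open>exp_strand dg b m w \<noteq> 0\<close>] by auto
    then have "Poly_Mapping.keys u \<subseteq> E" using w by (auto simp: free_module_def poly_ring_def)
    then show ?thesis using dg[OF c(1)] c(3) by (simp add: keys_add_exp)
  qed
  have "{m. exp_strand dg b m w \<noteq> 0} \<subseteq> (\<Union>c<b. (\<lambda>u. u + dg c) ` Poly_Mapping.keys (w c))"
    using key by blast
  then show "finite {m. exp_strand dg b m w \<noteq> 0}"
    by (rule finite_subset) simp
qed

text \<open>By homogeneity a matrix entry is a scalar multiple of one monomial; this is the scalar.
  The guards make it \<open>0\<close> out of range, where the entry itself is unconstrained.\<close>

definition diff_coeff :: "('e, 'k::field) free_complex \<Rightarrow> nat \<Rightarrow> nat \<Rightarrow> nat \<Rightarrow> 'k" where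
  "diff_coeff F i r c = (if r < fr_rank F i \<and> c < fr_rank F (Suc i) \<and> adds_exp (fr_deg F i r) (fr_deg F (Suc i) c)
     then Poly_Mapping.lookup (fr_diff F i r c) (fr_deg F (Suc i) c - fr_deg F i r) else 0)"

definition aug_coeff :: "('e, 'k::field) free_complex \<Rightarrow> nat \<Rightarrow> 'k" where
  "aug_coeff F j = Poly_Mapping.lookup (fr_aug F j) (fr_deg F 0 j)"

lemma fr_diff_eq_single:
  assumes "multigraded_complex E F" "r < fr_rank F i" "c < fr_rank F (Suc i)"
  shows "fr_diff F i r c =
    (if adds_exp (fr_deg F i r) (fr_deg F (Suc i) c)
     then Poly_Mapping.single (fr_deg F (Suc i) c - fr_deg F i r) (diff_coeff F i r c) else 0)"
proof (rule poly_mapping_eqI)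
  fix u
  have *: "u + fr_deg F i r = fr_deg F (Suc i) c" if "Poly_Mapping.lookup (fr_diff F i r c) u \<noteq> 0"
    using assms that unfolding multigraded_complex_def by (simp add: in_keys_iff)
  show "Poly_Mapping.lookup (fr_diff F i r c) u = Poly_Mapping.lookup
    (if adds_exp (fr_deg F i r) (fr_deg F (Suc i) c)
     then Poly_Mapping.single (fr_deg F (Suc i) c - fr_deg F i r) (diff_coeff F i r c) else 0) u"
  proof (cases "Poly_Mapping.lookup (fr_diff F i r c) u = 0")
    case True
    then show ?thesis using assms(2,3) by (auto simp: lookup_single when_def diff_coeff_def)
  next
    case False
    then have eq: "fr_deg F (Suc i) c = u + fr_deg F i r" using * by simp
    then have "u = fr_deg F (Suc i) c - fr_deg F i r" by simp
    moreover have "adds_exp (fr_deg F i r) (fr_deg F (Suc i) c)" by (simp add: eq)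
    ultimately show ?thesis using assms(2,3) by (simp add: diff_coeff_def)
  qed
qed

text \<open>The monomials in the entries account exactly for the differences of degrees, so in every
  degree \<open>m\<close> the differential acts by one and the same scalar matrix.\<close>

lemma exp_strand_apply_diff:
  assumes "multigraded_complex E F"
  shows "exp_strand (fr_deg F i) (fr_rank F i) m (apply_diff F i w) =
    mat_apply (diff_coeff F i) {..<fr_rank F (Suc i)} (exp_strand (fr_deg F (Suc i)) (fr_rank F (Suc i)) m w)"
proof
  fix r
  show "exp_strand (fr_deg F i) (fr_rank F i) m (apply_diff F i w) r =
    mat_apply (diff_coeff F i) {..<fr_rank F (Suc i)} (exp_strand (fr_deg F (Suc i)) (fr_rank F (Suc i)) m w) r"
  proof (cases "r < fr_rank F i \<and> adds_exp (fr_deg F i r) m")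
    case False
    have "diff_coeff F i r c * exp_strand (fr_deg F (Suc i)) (fr_rank F (Suc i)) m w c = 0" for c
      using False adds_exp_trans by (auto simp: diff_coeff_def exp_strand_def)
    then have "mat_apply (diff_coeff F i) {..<fr_rank F (Suc i)} (exp_strand (fr_deg F (Suc i)) (fr_rank F (Suc i)) m w) r = 0"
      unfolding mat_apply_def by (intro sum.neutral ballI)
    then show ?thesis using False by (auto simp: exp_strand_def)
  next
    case True
    let ?u = "m - fr_deg F i r"
    have m: "m = ?u + fr_deg F i r" using True adds_exp_minus_add by metis
    have "exp_strand (fr_deg F i) (fr_rank F i) m (apply_diff F i w) r
        = (\<Sum>c<fr_rank F (Suc i). Poly_Mapping.lookup (fr_diff F i r c * w c) ?u)"
      using True by (simp add: exp_strand_def apply_diff_def lookup_sum)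
    also have "\<dots> = mat_apply (diff_coeff F i) {..<fr_rank F (Suc i)} (exp_strand (fr_deg F (Suc i)) (fr_rank F (Suc i)) m w) r"
      unfolding mat_apply_def
    proof (rule sum.cong[OF refl])
      fix c assume c: "c \<in> {..<fr_rank F (Suc i)}"
      show "Poly_Mapping.lookup (fr_diff F i r c * w c) ?u =
        diff_coeff F i r c * exp_strand (fr_deg F (Suc i)) (fr_rank F (Suc i)) m w c"
      proof (cases "adds_exp (fr_deg F i r) (fr_deg F (Suc i) c)")
        case False
        then show ?thesis using fr_diff_eq_single[OF assms, of r i c] True c
          by (simp add: diff_coeff_def)
      next
        case adds: True
        let ?t = "fr_deg F (Suc i) c - fr_deg F i r"
        have t: "fr_deg F (Suc i) c = ?t + fr_deg F i r" using adds_exp_minus_add[OF adds] by simp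
        have "adds_exp ?t ?u \<longleftrightarrow> adds_exp (fr_deg F (Suc i) c) m"
          by (subst (2) m, subst (2) t) (simp add: adds_exp_def lookup_add)
        moreover have "?u - ?t = m - fr_deg F (Suc i) c"
          by (subst (2) t) (simp add: diff_diff_eq add.commute)
        ultimately show ?thesis using fr_diff_eq_single[OF assms, of r i c] True c adds
          by (simp add: lookup_single_times exp_strand_def)
      qed
    qed
    finally show ?thesis .
  qed
qed

lemma lookup_apply_aug:
  assumes "multigraded_complex E F"
  shows "Poly_Mapping.lookup (apply_aug F w) m =
    (\<Sum>j<fr_rank F 0. aug_coeff F j * exp_strand (fr_deg F 0) (fr_rank F 0) m w j)"
  unfolding apply_aug_def lookup_sum
proof (rule sum.cong[OF refl])
  fix j assume j: "j \<in> {..<fr_rank F 0}"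
  have "fr_aug F j = Poly_Mapping.single (fr_deg F 0 j) (aug_coeff F j)"
  proof (rule poly_mapping_eqI)
    fix u
    have "u = fr_deg F 0 j" if "Poly_Mapping.lookup (fr_aug F j) u \<noteq> 0"
      using assms that j unfolding multigraded_complex_def by (simp add: in_keys_iff)
    then show "Poly_Mapping.lookup (fr_aug F j) u =
      Poly_Mapping.lookup (Poly_Mapping.single (fr_deg F 0 j) (aug_coeff F j)) u"
      by (auto simp: lookup_single when_def aug_coeff_def)
  qed
  then have "w j * fr_aug F j = Poly_Mapping.single (fr_deg F 0 j) (aug_coeff F j) * w j"
    by (simp add: mult.commute)
  then show "Poly_Mapping.lookup (w j * fr_aug F j) m = aug_coeff F j * exp_strand (fr_deg F 0) (fr_rank F 0) m w j"
    using j by (simp add: lookup_single_times exp_strand_def)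
qed

section \<open>Stanley-Reisner ideals and their resolutions\<close>

text \<open>The Stanley-Reisner ideal through the supports of its monomials, which makes membership
  a condition on each degree separately.\<close>

definition face_ideal :: "'e set \<Rightarrow> 'e set set \<Rightarrow> ('e, 'k::field) mvpoly set" where
  "face_ideal E \<Delta> = {p \<in> poly_ring E. \<forall>m\<in>Poly_Mapping.keys p. Poly_Mapping.keys m \<notin> \<Delta>}"

lemma poly_mapping_decomp:
  fixes p :: "('e, 'k::field) mvpoly"
  shows "p = (\<Sum>m\<in>Poly_Mapping.keys p. Poly_Mapping.single m (Poly_Mapping.lookup p m))"
  by (rule poly_mapping_eqI)
    (auto simp: lookup_sum lookup_single when_def in_keys_iff sum.delta)

text \<open>Multiplying a generator enlarges the support, and dependence is inherited upwards;
  conversely each term of \<open>p\<close> is charged to the generator of its own support, which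
  divides it.\<close>

lemma matroid_ideal_eq:
  assumes fin: "finite (ground M)"
    and up: "\<And>\<sigma> \<tau>. \<sigma> \<in> dependent_sets M \<Longrightarrow> \<sigma> \<subseteq> \<tau> \<Longrightarrow> \<tau> \<subseteq> ground M \<Longrightarrow> \<tau> \<in> dependent_sets M"
  shows "(matroid_ideal M :: ('e, 'k::field) mvpoly set) = face_ideal (ground M) (- dependent_sets M)"
proof (intro equalityI subsetI)
  fix p :: "('e, 'k) mvpoly" assume "p \<in> matroid_ideal M"
  then obtain f where f: "p = (\<Sum>\<sigma>\<in>dependent_sets M. f \<sigma> * set_monomial \<sigma>)"
    "\<And>\<sigma>. \<sigma> \<in> dependent_sets M \<Longrightarrow> f \<sigma> \<in> poly_ring (ground M)"
    by (auto simp: matroid_ideal_def)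
  have "Poly_Mapping.keys m \<subseteq> ground M \<and> Poly_Mapping.keys m \<in> dependent_sets M"
    if m: "m \<in> Poly_Mapping.keys p" for m
  proof -
    have "Poly_Mapping.lookup p m \<noteq> 0" using m by (simp add: in_keys_iff)
    then obtain \<sigma> where \<sigma>: "\<sigma> \<in> dependent_sets M" "Poly_Mapping.lookup (f \<sigma> * set_monomial \<sigma>) m \<noteq> 0"
      unfolding f(1) lookup_sum by (metis (no_types, lifting) sum.neutral)
    have \<sigma>sub: "\<sigma> \<subseteq> ground M" using \<sigma>(1) by (simp add: dependent_sets_def)
    then have fin\<sigma>: "finite \<sigma>" using fin finite_subset by metis
    have "Poly_Mapping.lookup (set_monomial \<sigma> * f \<sigma>) m \<noteq> 0" using \<sigma>(2) by (simp add: mult.commute)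
    then have m': "adds_exp (set_exponent \<sigma>) m" "Poly_Mapping.lookup (f \<sigma>) (m - set_exponent \<sigma>) \<noteq> 0"
      unfolding set_monomial_def lookup_single_times by (auto split: if_splits)
    have "Poly_Mapping.keys (m - set_exponent \<sigma>) \<subseteq> ground M"
      using f(2)[OF \<sigma>(1)] m'(2) by (auto simp: poly_ring_def in_keys_iff)
    then have "Poly_Mapping.keys m \<subseteq> ground M"
      using adds_exp_minus_add[OF m'(1)] keys_add_exp[of "m - set_exponent \<sigma>" "set_exponent \<sigma>"]
        keys_set_exponent[OF fin\<sigma>] \<sigma>sub by auto
    moreover have "\<sigma> \<subseteq> Poly_Mapping.keys m"
      using m'(1) adds_exp_set_exponent_left[OF fin\<sigma>] by blast
    ultimately show ?thesis using up[OF \<sigma>(1)] by auto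
  qed
  then show "p \<in> face_ideal (ground M) (- dependent_sets M)"
    by (auto simp: face_ideal_def poly_ring_def)
next
  fix p :: "('e, 'k) mvpoly" assume p: "p \<in> face_ideal (ground M) (- dependent_sets M)"
  define f where "f \<sigma> = (\<Sum>m | m \<in> Poly_Mapping.keys p \<and> Poly_Mapping.keys m = \<sigma>.
    Poly_Mapping.single (m - set_exponent \<sigma>) (Poly_Mapping.lookup p m))" for \<sigma>
  have finD: "finite (dependent_sets M)"
    using fin by (simp add: dependent_sets_def)
  have "(\<Sum>\<sigma>\<in>dependent_sets M. f \<sigma> * set_monomial \<sigma>) = (\<Sum>\<sigma>\<in>dependent_sets M.
    \<Sum>m | m \<in> Poly_Mapping.keys p \<and> Poly_Mapping.keys m = \<sigma>. Poly_Mapping.single m (Poly_Mapping.lookup p m))"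
  proof (rule sum.cong[OF refl])
    fix \<sigma> assume "\<sigma> \<in> dependent_sets M"
    have "m - set_exponent \<sigma> + set_exponent \<sigma> = m" if "Poly_Mapping.keys m = \<sigma>" for m
      using that by (intro adds_exp_minus_add) (auto simp: adds_exp_set_exponent_left)
    then show "f \<sigma> * set_monomial \<sigma> =
      (\<Sum>m | m \<in> Poly_Mapping.keys p \<and> Poly_Mapping.keys m = \<sigma>. Poly_Mapping.single m (Poly_Mapping.lookup p m))"
      unfolding f_def set_monomial_def sum_distrib_right mult_single by (intro sum.cong) auto
  qed
  also have "\<dots> = (\<Sum>m\<in>Poly_Mapping.keys p. Poly_Mapping.single m (Poly_Mapping.lookup p m))"
    by (rule sum.group) (use p finD in \<open>auto simp: face_ideal_def\<close>)
  also have "\<dots> = p" by (rule poly_mapping_decomp[symmetric])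
  finally have "p = (\<Sum>\<sigma>\<in>dependent_sets M. f \<sigma> * set_monomial \<sigma>)" ..
  moreover have "f \<sigma> \<in> poly_ring (ground M)" for \<sigma>
    unfolding f_def
  proof (rule poly_ring_sum, rule poly_ring_single)
    fix m assume "m \<in> {m \<in> Poly_Mapping.keys p. Poly_Mapping.keys m = \<sigma>}"
    then have "Poly_Mapping.keys m \<subseteq> ground M" using p by (auto simp: face_ideal_def poly_ring_def)
    then show "Poly_Mapping.keys (m - set_exponent \<sigma>) \<subseteq> ground M" by (rule subset_trans[OF keys_minus_exp])
  qed
  ultimately show "p \<in> matroid_ideal M" unfolding matroid_ideal_def by blast
qed

lemma mat_apply_strand:
  assumes "v \<in> strand J D \<sigma>" "J \<subseteq> {..<b}"
  shows "mat_apply A {..<b} v = mat_apply (A :: nat \<Rightarrow> nat \<Rightarrow> 'k::field) J v"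
proof
  fix r show "mat_apply A {..<b} v r = mat_apply A J v r"
    unfolding mat_apply_def
    by (rule sum.mono_neutral_right) (use assms in \<open>auto simp: strand_def\<close>)
qed

text \<open>The components in the degrees \<open>set_exponent \<sigma>\<close> see only basis
  elements of squarefree degree within \<open>E\<close>. Vectors pass between the two descriptions
  by \<open>exp_strand\<close> and \<open>exp_embed\<close>.\<close>

lemma squarefree_resolution_of_minimal:
  fixes F :: "('e, 'k::field) free_complex"
  assumes fin: "finite E" and F: "minimal_free_resolution E (face_ideal E \<Delta>) F"
  shows "squarefree_resolution E \<Delta>
    (\<lambda>i. {c. c < fr_rank F i \<and> adds_exp (fr_deg F i c) (set_exponent E)})
    (\<lambda>i c. Poly_Mapping.keys (fr_deg F i c)) (diff_coeff F) (aug_coeff F)"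
proof -
  let ?J = "\<lambda>i. {c. c < fr_rank F i \<and> adds_exp (fr_deg F i c) (set_exponent E)}"
  let ?D = "\<lambda>i c. Poly_Mapping.keys (fr_deg F i c)"
  let ?S = "\<lambda>i. exp_strand (fr_deg F i) (fr_rank F i)"
  let ?M = "\<lambda>i. exp_embed (fr_deg F i)"
  have mc: "multigraded_complex E F" and res: "resolves_quotient E (face_ideal E \<Delta>) F"
    and mini: "\<And>i r c. r < fr_rank F i \<Longrightarrow> c < fr_rank F (Suc i) \<Longrightarrow> Poly_Mapping.lookup (fr_diff F i r c) 0 = 0"
    using F by (auto simp: minimal_free_resolution_def)
  have finJ: "finite (?J i)" for i by simp
  have J_sub: "?J i \<subseteq> {..<fr_rank F i}" for i by auto
  have fin_sub: "finite \<sigma>" if "\<sigma> \<subseteq> E" for \<sigma> using that fin finite_subset by metis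
  have in_strand: "v \<in> strand (?J i) (?D i) \<sigma> \<longleftrightarrow>
      (\<forall>c. v c \<noteq> 0 \<longrightarrow> c < fr_rank F i \<and> adds_exp (fr_deg F i c) (set_exponent \<sigma>))"
    if "\<sigma> \<subseteq> E" for v :: "nat \<Rightarrow> 'k" and i \<sigma>
    unfolding strand_def using adds_exp_set_exponent_right[OF fin that] by auto
  have S_strand: "?S i (set_exponent \<sigma>) w \<in> strand (?J i) (?D i) \<sigma>" if "\<sigma> \<subseteq> E" for i \<sigma> and w :: "nat \<Rightarrow> ('e, 'k) mvpoly"
    unfolding in_strand[OF that] by (auto simp: exp_strand_def)
  have M_strand: "?S i m (?M i (set_exponent \<sigma>) v) = (if m = set_exponent \<sigma> then v else 0)"
    if "\<sigma> \<subseteq> E" "v \<in> strand (?J i) (?D i) \<sigma>" for i \<sigma> m and v :: "nat \<Rightarrow> 'k"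
    by (rule exp_strand_embed) (use that(2) in \<open>auto simp: in_strand[OF that(1)]\<close>)
  have M_free: "?M i (set_exponent \<sigma>) v \<in> free_module E (fr_rank F i)"
    if "\<sigma> \<subseteq> E" "v \<in> strand (?J i) (?D i) \<sigma>" for i \<sigma> and v :: "nat \<Rightarrow> 'k"
  proof (rule exp_embed_free_module)
    show "Poly_Mapping.keys (set_exponent \<sigma>) \<subseteq> E" using that(1) fin_sub by (simp add: keys_set_exponent)
  qed (use that(2) in \<open>auto simp: strand_def\<close>)
  have S_diff: "?S i (set_exponent \<sigma>) (apply_diff F i w) =
      mat_apply (diff_coeff F i) (?J (Suc i)) (?S (Suc i) (set_exponent \<sigma>) w)" if "\<sigma> \<subseteq> E" for i \<sigma> w
    unfolding exp_strand_apply_diff[OF mc] by (rule mat_apply_strand[OF S_strand[OF that] J_sub])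
  have diff_free: "c \<ge> fr_rank F i \<Longrightarrow> apply_diff F i w c = 0" for i w c
    by (simp add: apply_diff_def)
  have S_M_diff: "?S i m (apply_diff F i (?M (Suc i) (set_exponent \<sigma>) v)) =
      (if m = set_exponent \<sigma> then mat_apply (diff_coeff F i) (?J (Suc i)) v else 0)"
    if "\<sigma> \<subseteq> E" "v \<in> strand (?J (Suc i)) (?D (Suc i)) \<sigma>" for i \<sigma> m and v :: "nat \<Rightarrow> 'k"
  proof -
    have "mat_apply (diff_coeff F i) {..<fr_rank F (Suc i)} 0 = 0"
      by (simp add: mat_apply_def fun_eq_iff)
    then show ?thesis
      unfolding exp_strand_apply_diff[OF mc] M_strand[OF that]
      using mat_apply_strand[OF that(2) J_sub] by auto
  qed
  have image_iff: "(\<exists>w\<in>free_module E (fr_rank F (Suc i)). ?M i (set_exponent \<sigma>) v = apply_diff F i w) \<longleftrightarrow>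
      (\<exists>w\<in>strand (?J (Suc i)) (?D (Suc i)) \<sigma>. v = mat_apply (diff_coeff F i) (?J (Suc i)) w)"
    if \<sigma>: "\<sigma> \<subseteq> E" and v: "v \<in> strand (?J i) (?D i) \<sigma>" for i \<sigma> and v :: "nat \<Rightarrow> 'k"
  proof (intro iffI; elim bexE)
    fix w assume w: "w \<in> free_module E (fr_rank F (Suc i))" "?M i (set_exponent \<sigma>) v = apply_diff F i w"
    have "v = ?S i (set_exponent \<sigma>) (?M i (set_exponent \<sigma>) v)" using M_strand[OF \<sigma> v] by simp
    also have "\<dots> = mat_apply (diff_coeff F i) (?J (Suc i)) (?S (Suc i) (set_exponent \<sigma>) w)"
      unfolding w(2) by (rule S_diff[OF \<sigma>])
    finally show "\<exists>w\<in>strand (?J (Suc i)) (?D (Suc i)) \<sigma>. v = mat_apply (diff_coeff F i) (?J (Suc i)) w"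
      using S_strand[OF \<sigma>] by blast
  next
    fix w assume w: "w \<in> strand (?J (Suc i)) (?D (Suc i)) \<sigma>" "v = mat_apply (diff_coeff F i) (?J (Suc i)) w"
    have "?M i (set_exponent \<sigma>) v = apply_diff F i (?M (Suc i) (set_exponent \<sigma>) w)"
    proof (rule exp_strand_eqI[where b = "fr_rank F i" and dg = "fr_deg F i"])
      show "?M i (set_exponent \<sigma>) v c = 0" if "fr_rank F i \<le> c" for c
        using M_free[OF \<sigma> v] that by (simp add: free_module_def)
      show "?S i m (?M i (set_exponent \<sigma>) v) = ?S i m (apply_diff F i (?M (Suc i) (set_exponent \<sigma>) w))" for m
      proof -
        have "?S i m (?M i (set_exponent \<sigma>) v) = (if m = set_exponent \<sigma> then v else 0)"
          by (rule M_strand[OF \<sigma> v])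
        also have "\<dots> = ?S i m (apply_diff F i (?M (Suc i) (set_exponent \<sigma>) w))"
          unfolding S_M_diff[OF \<sigma> w(1)] using w(2) by simp
        finally show ?thesis .
      qed
    qed (rule diff_free)
    then show "\<exists>w\<in>free_module E (fr_rank F (Suc i)). ?M i (set_exponent \<sigma>) v = apply_diff F i w"
      using M_free[OF \<sigma> w(1)] by blast
  qed
  have lookup_aug: "Poly_Mapping.lookup (apply_aug F (?M 0 (set_exponent \<sigma>) v)) m =
      (if m = set_exponent \<sigma> then \<Sum>c\<in>?J 0. aug_coeff F c * v c else 0)"
    if \<sigma>: "\<sigma> \<subseteq> E" and v: "v \<in> strand (?J 0) (?D 0) \<sigma>" for \<sigma> m and v :: "nat \<Rightarrow> 'k"
  proof -
    have "(\<Sum>c<fr_rank F 0. aug_coeff F c * v c) = (\<Sum>c\<in>?J 0. aug_coeff F c * v c)"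
      by (rule sum.mono_neutral_right) (use v in \<open>auto simp: strand_def\<close>)
    then show ?thesis
      unfolding lookup_apply_aug[OF mc] M_strand[OF \<sigma> v] by auto
  qed
  show ?thesis
  proof
    show "finite E" by (rule fin)
    show "finite (?J i)" for i by (rule finJ)
  next
    fix c i assume "c \<in> ?J i"
    then show "?D i c \<subseteq> E" using keys_adds_exp[of "fr_deg F i c" "set_exponent E"] by (simp add: keys_set_exponent fin)
  next
    fix c i r assume c: "c \<in> ?J (Suc i)" and nz: "diff_coeff F i r c \<noteq> 0"
    then have r: "r < fr_rank F i" and adds: "adds_exp (fr_deg F i r) (fr_deg F (Suc i) c)"
      by (auto simp: diff_coeff_def split: if_splits)
    then have rJ: "r \<in> ?J i" using c adds_exp_trans by blast
    \<comment> \<open>Squarefree degrees with equal supports coincide, and then the scalar would be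
      the constant term of the entry, which minimality makes zero.\<close>
    have "?D i r \<noteq> ?D (Suc i) c"
    proof
      assume "?D i r = ?D (Suc i) c"
      then have "fr_deg F i r = fr_deg F (Suc i) c"
        using squarefree_exponent[OF fin, of "fr_deg F i r"] squarefree_exponent[OF fin, of "fr_deg F (Suc i) c"]
          c rJ by simp
      then show False using nz mini[OF r, of c] c by (simp add: diff_coeff_def split: if_splits)
    qed
    then show "r \<in> ?J i \<and> ?D i r \<subset> ?D (Suc i) c" using rJ keys_adds_exp[OF adds] by blast
  next
    fix \<sigma> assume \<sigma>: "\<sigma> \<in> \<Delta>" "\<sigma> \<subseteq> E"
    \<comment> \<open>The squarefree monomial of a face is hit modulo the ideal, and the ideal has
      no term in that degree, so its coefficient is matched exactly.\<close>
    let ?p = "Poly_Mapping.single (set_exponent \<sigma>) 1 :: ('e, 'k) mvpoly"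
    have "?p \<in> poly_ring E" using \<sigma>(2) fin_sub by (intro poly_ring_single) (simp add: keys_set_exponent)
    then obtain w where w: "?p - apply_aug F w \<in> face_ideal E \<Delta>"
      using res unfolding resolves_quotient_def by blast
    have "Poly_Mapping.keys (set_exponent \<sigma>) \<in> \<Delta>" using \<sigma> fin_sub by (simp add: keys_set_exponent)
    then have "set_exponent \<sigma> \<notin> Poly_Mapping.keys (?p - apply_aug F w)"
      using w unfolding face_ideal_def by blast
    then have "Poly_Mapping.lookup (apply_aug F w) (set_exponent \<sigma>) = 1"
      by (simp add: in_keys_iff lookup_minus)
    then have "(\<Sum>j<fr_rank F 0. aug_coeff F j * ?S 0 (set_exponent \<sigma>) w j) = 1"
      by (simp add: lookup_apply_aug[OF mc])
    also have "(\<Sum>j<fr_rank F 0. aug_coeff F j * ?S 0 (set_exponent \<sigma>) w j) =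
      (\<Sum>j\<in>?J 0. aug_coeff F j * ?S 0 (set_exponent \<sigma>) w j)"
      by (rule sum.mono_neutral_right) (use S_strand[OF \<sigma>(2), of 0 w] in \<open>auto simp: strand_def\<close>)
    finally show "\<exists>v\<in>strand (?J 0) (?D 0) \<sigma>. (\<Sum>c\<in>?J 0. aug_coeff F c * v c) = 1"
      using S_strand[OF \<sigma>(2)] by blast
  next
    fix \<sigma> and v :: "nat \<Rightarrow> 'k" assume \<sigma>: "\<sigma> \<subseteq> E" and v: "v \<in> strand (?J 0) (?D 0) \<sigma>"
    have "(\<sigma> \<in> \<Delta> \<longrightarrow> (\<Sum>c\<in>?J 0. aug_coeff F c * v c) = 0) \<longleftrightarrow>
      apply_aug F (?M 0 (set_exponent \<sigma>) v) \<in> face_ideal E \<Delta>"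
    proof -
      have keys\<sigma>: "Poly_Mapping.keys (set_exponent \<sigma>) = \<sigma>" using \<sigma> fin_sub by (simp add: keys_set_exponent)
      have "m \<in> Poly_Mapping.keys (apply_aug F (?M 0 (set_exponent \<sigma>) v)) \<longleftrightarrow>
        m = set_exponent \<sigma> \<and> (\<Sum>c\<in>?J 0. aug_coeff F c * v c) \<noteq> 0" for m
        unfolding in_keys_iff lookup_aug[OF \<sigma> v] by simp
      then show ?thesis unfolding face_ideal_def poly_ring_def using keys\<sigma> \<sigma> by auto
    qed
    also have "\<dots> \<longleftrightarrow> (\<exists>w\<in>free_module E (fr_rank F (Suc 0)). ?M 0 (set_exponent \<sigma>) v = apply_diff F 0 w)"
      using res M_free[OF \<sigma> v] unfolding resolves_quotient_def by simp
    also note image_iff[OF \<sigma> v]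
    finally show "(\<sigma> \<in> \<Delta> \<longrightarrow> (\<Sum>c\<in>?J 0. aug_coeff F c * v c) = 0) \<longleftrightarrow>
      (\<exists>w\<in>strand (?J 1) (?D 1) \<sigma>. v = mat_apply (diff_coeff F 0) (?J 1) w)" by simp
  next
    fix \<sigma> i and v :: "nat \<Rightarrow> 'k" assume \<sigma>: "\<sigma> \<subseteq> E" and v: "v \<in> strand (?J (Suc i)) (?D (Suc i)) \<sigma>"
    have "mat_apply (diff_coeff F i) (?J (Suc i)) v = 0 \<longleftrightarrow>
      apply_diff F i (?M (Suc i) (set_exponent \<sigma>) v) = (\<lambda>_. 0)"
    proof
      assume *: "mat_apply (diff_coeff F i) (?J (Suc i)) v = 0"
      show "apply_diff F i (?M (Suc i) (set_exponent \<sigma>) v) = (\<lambda>_. 0)"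
      proof (rule exp_strand_eqI[where b = "fr_rank F i" and dg = "fr_deg F i"])
        show "?S i m (apply_diff F i (?M (Suc i) (set_exponent \<sigma>) v)) = ?S i m (\<lambda>_. 0)" for m
          unfolding S_M_diff[OF \<sigma> v] * by (auto simp: exp_strand_def fun_eq_iff)
      qed (auto simp: apply_diff_def)
    next
      assume "apply_diff F i (?M (Suc i) (set_exponent \<sigma>) v) = (\<lambda>_. 0)"
      then have "?S i (set_exponent \<sigma>) (apply_diff F i (?M (Suc i) (set_exponent \<sigma>) v)) = 0"
        by (auto simp: exp_strand_def fun_eq_iff)
      then show "mat_apply (diff_coeff F i) (?J (Suc i)) v = 0"
        unfolding S_M_diff[OF \<sigma> v] by simp
    qed
    also have "\<dots> \<longleftrightarrow> (\<exists>w\<in>free_module E (fr_rank F (Suc (Suc i))).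
      ?M (Suc i) (set_exponent \<sigma>) v = apply_diff F (Suc i) w)"
      using res M_free[OF \<sigma> v] unfolding resolves_quotient_def by simp
    also note image_iff[OF \<sigma> v]
    finally show "mat_apply (diff_coeff F i) (?J (Suc i)) v = 0 \<longleftrightarrow>
      (\<exists>w\<in>strand (?J (Suc (Suc i))) (?D (Suc (Suc i))) \<sigma>.
        v = mat_apply (diff_coeff F (Suc i)) (?J (Suc (Suc i))) w)" .
  qed
qed

text \<open>Homogenization: each scalar is multiplied by the monomial of the difference of
  degrees.\<close>

definition squarefree_complex ::
    "(nat \<Rightarrow> nat) \<Rightarrow> (nat \<Rightarrow> nat \<Rightarrow> 'e set) \<Rightarrow> (nat \<Rightarrow> nat \<Rightarrow> nat \<Rightarrow> 'k::field) \<Rightarrow> (nat \<Rightarrow> 'k) \<Rightarrow> ('e, 'k) free_complex" where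
  "squarefree_complex b D A a = \<lparr>fr_rank = b, fr_deg = (\<lambda>i c. set_exponent (D i c)),
     fr_diff = (\<lambda>i r c. Poly_Mapping.single (set_exponent (D (Suc i) c - D i r)) (A i r c)),
     fr_aug = (\<lambda>j. Poly_Mapping.single (set_exponent (D 0 j)) (a j))\<rparr>"

text \<open>All basis degrees are squarefree, so the component in an arbitrary degree
  \<open>m\<close> is the strand over the support of \<open>m\<close>. Exactness over the subsets of
  \<open>E\<close> therefore gives exactness in every degree.\<close>

lemma minimal_of_squarefree_resolution:
  fixes A :: "nat \<Rightarrow> nat \<Rightarrow> nat \<Rightarrow> 'k::field" and D :: "nat \<Rightarrow> nat \<Rightarrow> 'e set"
  assumes "squarefree_resolution E \<Delta> (\<lambda>i. {..<b i}) D A a"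
  shows "minimal_free_resolution E (face_ideal E \<Delta>) (squarefree_complex b D A a)"
proof -
  interpret squarefree_resolution E \<Delta> "\<lambda>i. {..<b i}" D A a by fact
  let ?F = "squarefree_complex b D A a"
  let ?S = "\<lambda>i. exp_strand (fr_deg ?F i) (fr_rank ?F i)"
  have F: "fr_rank ?F = b" "fr_deg ?F i c = set_exponent (D i c)"
    "fr_diff ?F i r c = Poly_Mapping.single (set_exponent (D (Suc i) c - D i r)) (A i r c)"
    "fr_aug ?F c = Poly_Mapping.single (set_exponent (D 0 c)) (a c)" for i r c
    by (simp_all add: squarefree_complex_def)
  have finD: "finite (D i c)" if "c < b i" for i c
    using D_E[of c i] that finite_E finite_subset by (metis lessThan_iff)
  have keysD: "Poly_Mapping.keys (set_exponent (D i c)) = D i c" if "c < b i" for i c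
    using finD[OF that] by (rule keys_set_exponent)
  have sub_exp: "set_exponent (D (Suc i) c - D i r) + set_exponent (D i r) = set_exponent (D (Suc i) c)"
    if "c < b (Suc i)" "D i r \<subseteq> D (Suc i) c" for i r c
  proof -
    have f: "finite (D (Suc i) c)" "finite (D i r)" using finD[OF that(1)] that(2) finite_subset by auto
    show ?thesis by (rule poly_mapping_eqI) (use f that(2) in \<open>auto simp: lookup_add lookup_set_exponent\<close>)
  qed
  have mc: "multigraded_complex E ?F"
    unfolding multigraded_complex_def
  proof (intro conjI allI impI ballI)
    fix i j assume "j < fr_rank ?F i"
    then show "Poly_Mapping.keys (fr_deg ?F i j) \<subseteq> E" using D_E[of j i] by (simp add: F keysD)
  next
    fix j assume j: "j < fr_rank ?F 0"
    show "fr_aug ?F j \<in> poly_ring E" unfolding F using j D_E[of j 0]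
      by (intro poly_ring_single) (simp add: F keysD)
    show "m = fr_deg ?F 0 j" if "m \<in> Poly_Mapping.keys (fr_aug ?F j)" for m
      using that by (simp add: F split: if_splits)
  next
    fix i r c assume r: "r < fr_rank ?F i" and c: "c < fr_rank ?F (Suc i)"
    have "finite (D (Suc i) c - D i r)" "D (Suc i) c - D i r \<subseteq> E"
      using finD[of c "Suc i"] c D_E[of c "Suc i"] by (auto simp: F)
    then show "fr_diff ?F i r c \<in> poly_ring E" unfolding F
      by (intro poly_ring_single) (simp add: keys_set_exponent)
    show "m + fr_deg ?F i r = fr_deg ?F (Suc i) c" if "m \<in> Poly_Mapping.keys (fr_diff ?F i r c)" for m
      using that sub_exp[of c i r] A_support[of c i r] c by (auto simp: F split: if_splits)
  qed
  have coeff: "diff_coeff ?F i r c = A i r c" if c: "c < b (Suc i)" for i r c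
  proof (cases "A i r c = 0")
    case True
    then show ?thesis by (simp add: diff_coeff_def F)
  next
    case False
    then have r: "r < b i" "D i r \<subseteq> D (Suc i) c" using A_support[of c i r] c by auto
    have eq: "set_exponent (D (Suc i) c) - set_exponent (D i r) = set_exponent (D (Suc i) c - D i r)"
      using sub_exp[OF c r(2)] by (metis add_diff_cancel_right')
    have "adds_exp (set_exponent (D i r)) (set_exponent (D (Suc i) c))"
      using sub_exp[OF c r(2)] by (metis adds_exp_add(1))
    then show ?thesis using r c by (simp add: diff_coeff_def F eq)
  qed
  have mat_coeff: "mat_apply (diff_coeff ?F i) {..<b (Suc i)} v = mat_apply (A i) {..<b (Suc i)} v" for i v
    unfolding mat_apply_def by (intro ext sum.cong) (auto simp: coeff)
  have aug_a: "aug_coeff ?F j = a j" for j by (simp add: aug_coeff_def F)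
  have S_diff: "?S i m (apply_diff ?F i w) = mat_apply (A i) {..<b (Suc i)} (?S (Suc i) m w)" for i m w
    unfolding exp_strand_apply_diff[OF mc] by (simp add: F mat_coeff)
  have S_aug: "Poly_Mapping.lookup (apply_aug ?F w) m = (\<Sum>j<b 0. a j * ?S 0 m w j)" for m w
    unfolding lookup_apply_aug[OF mc] by (simp add: F aug_a)
  have S_strand: "?S i m w \<in> strand {..<b i} (D i) (Poly_Mapping.keys m)" for i m w
    unfolding strand_def by (auto simp: exp_strand_def F adds_exp_set_exponent_left finD split: if_splits)
  have keysE: "Poly_Mapping.keys (fr_deg ?F i c) \<subseteq> E" if "c < fr_rank ?F i" for i c
    using that D_E[of c i] by (simp add: F keysD)
  have S_supp: "Poly_Mapping.keys m \<subseteq> E" if "w \<in> free_module E (b i)" "?S i m w \<noteq> 0" for i m w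
    by (rule exp_strand_support(1)[OF _ keysE that(2)]) (simp add: F that)
  have S_fin: "finite {m. ?S i m w \<noteq> 0}" if "w \<in> free_module E (b i)" for i w
    by (rule exp_strand_support(2)[OF _ keysE]) (simp add: F that)
  \<comment> \<open>A family of components comes from an element of the free module only if finitely
    many are nonzero, whence the finite set \<open>X\<close>.\<close>
  have assemble: "\<exists>w\<in>free_module E (b i). \<forall>m. ?S i m w = (if m \<in> X then u m else 0)"
    if X: "finite X" "\<And>m. m \<in> X \<Longrightarrow> Poly_Mapping.keys m \<subseteq> E \<and> u m \<in> strand {..<b i} (D i) (Poly_Mapping.keys m)"
    for i X u
  proof -
    have emb: "?S i m (exp_embed (fr_deg ?F i) m' (u m')) = (if m = m' then u m' else 0)" if "m' \<in> X" for m m'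
      by (rule exp_strand_embed) (use X(2)[OF that] in \<open>auto simp: strand_def F adds_exp_set_exponent_left finD\<close>)
    define w where "w = (\<lambda>c. \<Sum>m\<in>X. exp_embed (fr_deg ?F i) m (u m) c)"
    have "w \<in> free_module E (b i)"
    proof -
      have "exp_embed (fr_deg ?F i) m (u m) \<in> free_module E (b i)" if "m \<in> X" for m
        by (rule exp_embed_free_module) (use X(2)[OF that] in \<open>auto simp: strand_def\<close>)
      then show ?thesis unfolding w_def free_module_def by (auto intro!: poly_ring_sum)
    qed
    moreover have "?S i m w = (if m \<in> X then u m else 0)" for m
    proof
      fix c
      have "?S i m w c = (\<Sum>m'\<in>X. ?S i m (exp_embed (fr_deg ?F i) m' (u m')) c)"
        by (cases "c < fr_rank ?F i \<and> adds_exp (fr_deg ?F i c) m") (auto simp: w_def exp_strand_def lookup_sum)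
      also have "\<dots> = (\<Sum>m'\<in>X. if m = m' then u m c else 0)"
        by (rule sum.cong) (auto simp: emb)
      also have "\<dots> = (if m \<in> X then u m else 0) c" using X(1) by simp
      finally show "?S i m w c = (if m \<in> X then u m else 0) c" .
    qed
    ultimately show ?thesis by blast
  qed
  have lift: "\<exists>w\<in>free_module E (b (Suc i)). v = apply_diff ?F i w"
    if v: "v \<in> free_module E (b i)"
      and im: "\<And>m. Poly_Mapping.keys m \<subseteq> E \<Longrightarrow> \<exists>w\<in>strand {..<b (Suc i)} (D (Suc i)) (Poly_Mapping.keys m).
        ?S i m v = mat_apply (A i) {..<b (Suc i)} w" for i v
  proof -
    let ?X = "{m. ?S i m v \<noteq> 0}"
    have "\<exists>u. \<forall>m. m \<in> ?X \<longrightarrow> u m \<in> strand {..<b (Suc i)} (D (Suc i)) (Poly_Mapping.keys m) \<and>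
      ?S i m v = mat_apply (A i) {..<b (Suc i)} (u m)"
    proof (rule choice, rule allI)
      fix m
      show "\<exists>u. m \<in> ?X \<longrightarrow> u \<in> strand {..<b (Suc i)} (D (Suc i)) (Poly_Mapping.keys m) \<and>
        ?S i m v = mat_apply (A i) {..<b (Suc i)} u"
        using im[of m] S_supp[OF v, of m] by auto
    qed
    then obtain u where u0: "\<forall>m. m \<in> ?X \<longrightarrow> u m \<in> strand {..<b (Suc i)} (D (Suc i)) (Poly_Mapping.keys m) \<and>
      ?S i m v = mat_apply (A i) {..<b (Suc i)} (u m)" by (rule exE)
    note u = u0[rule_format, THEN conjunct1] u0[rule_format, THEN conjunct2]
    obtain w where w: "w \<in> free_module E (b (Suc i))" "\<And>m. ?S (Suc i) m w = (if m \<in> ?X then u m else 0)"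
      using assemble[OF S_fin[OF v], of u "Suc i"] u(1) S_supp[OF v] by auto
    have "v = apply_diff ?F i w"
    proof (rule exp_strand_eqI[where b = "b i" and dg = "fr_deg ?F i"])
      show "v c = 0" if "b i \<le> c" for c using v that by (simp add: free_module_def)
      show "apply_diff ?F i w c = 0" if "b i \<le> c" for c using that by (simp add: apply_diff_def F)
      show "exp_strand (fr_deg ?F i) (b i) m v = exp_strand (fr_deg ?F i) (b i) m (apply_diff ?F i w)" for m
      proof -
        have z: "mat_apply (A i) {..<b (Suc i)} 0 = 0" by (simp add: mat_apply_def fun_eq_iff)
        have "?S i m v = ?S i m (apply_diff ?F i w)"
          unfolding S_diff w(2) using u(2)[of m] z by auto
        then show ?thesis by (simp add: F(1))
      qed
    qed
    then show ?thesis using w(1) by blast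
  qed
  have res: "resolves_quotient E (face_ideal E \<Delta>) ?F"
    unfolding resolves_quotient_def F(1)
  proof (intro conjI ballI allI iffI)
    fix p :: "('e, 'k) mvpoly" assume p: "p \<in> poly_ring E"
    \<comment> \<open>Terms whose support is not a face already lie in the ideal, so preimages are
      taken only for the others.\<close>
    let ?X = "{m \<in> Poly_Mapping.keys p. Poly_Mapping.keys m \<in> \<Delta>}"
    have "\<exists>u. \<forall>m. m \<in> ?X \<longrightarrow> u m \<in> strand {..<b 0} (D 0) (Poly_Mapping.keys m) \<and>
      (\<Sum>j<b 0. a j * u m j) = Poly_Mapping.lookup p m"
    proof (rule choice, rule allI)
      fix m
      show "\<exists>u. m \<in> ?X \<longrightarrow> u \<in> strand {..<b 0} (D 0) (Poly_Mapping.keys m) \<and>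
        (\<Sum>j<b 0. a j * u j) = Poly_Mapping.lookup p m"
      proof (cases "m \<in> ?X")
        case True
        then have "Poly_Mapping.keys m \<subseteq> E" using p by (auto simp: poly_ring_def)
        then obtain v where v: "v \<in> strand {..<b 0} (D 0) (Poly_Mapping.keys m)" "(\<Sum>j<b 0. a j * v j) = 1"
          using aug_surj[of "Poly_Mapping.keys m"] True by auto
        let ?u = "fscale (Poly_Mapping.lookup p m) v"
        have "(\<Sum>j<b 0. a j * ?u j) = Poly_Mapping.lookup p m * (\<Sum>j<b 0. a j * v j)"
          by (simp add: fscale_def sum_distrib_left ac_simps)
        moreover have "?u \<in> strand {..<b 0} (D 0) (Poly_Mapping.keys m)"
          by (rule fvec.subspace_scale[OF subspace_strand v(1)])
        ultimately show ?thesis using v(2) by (intro exI[of _ ?u]) simp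
      next
        case False
        then show ?thesis by blast
      qed
    qed
    then obtain u where u0: "\<forall>m. m \<in> ?X \<longrightarrow> u m \<in> strand {..<b 0} (D 0) (Poly_Mapping.keys m) \<and>
      (\<Sum>j<b 0. a j * u m j) = Poly_Mapping.lookup p m" by (rule exE)
    note u = u0[rule_format, THEN conjunct1] u0[rule_format, THEN conjunct2]
    obtain w where w: "w \<in> free_module E (b 0)" "\<And>m. ?S 0 m w = (if m \<in> ?X then u m else 0)"
      using assemble[of ?X u 0] u(1) p by (auto simp: poly_ring_def)
    have lk: "Poly_Mapping.lookup (p - apply_aug ?F w) m =
        (if Poly_Mapping.keys m \<in> \<Delta> then 0 else Poly_Mapping.lookup p m)" for m
      using u(2)[of m] unfolding lookup_minus S_aug w(2) by (auto simp: in_keys_iff)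
    have "Poly_Mapping.keys m \<subseteq> E \<and> Poly_Mapping.keys m \<notin> \<Delta>"
      if "m \<in> Poly_Mapping.keys (p - apply_aug ?F w)" for m
    proof -
      have "Poly_Mapping.keys m \<notin> \<Delta>" "m \<in> Poly_Mapping.keys p"
        using that unfolding in_keys_iff lk by (auto split: if_splits)
      then show ?thesis using p by (simp add: poly_ring_def)
    qed
    then have "p - apply_aug ?F w \<in> face_ideal E \<Delta>"
      by (auto simp: face_ideal_def poly_ring_def)
    then show "\<exists>v\<in>free_module E (b 0). p - apply_aug ?F v \<in> face_ideal E \<Delta>" using w(1) by blast
  next
    fix v assume v: "v \<in> free_module E (b 0)" and I: "apply_aug ?F v \<in> face_ideal E \<Delta>"
    show "\<exists>w\<in>free_module E (b 1). v = apply_diff ?F 0 w"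
      unfolding One_nat_def
    proof (rule lift[OF v])
      fix m :: "'e \<Rightarrow>\<^sub>0 nat" assume m: "Poly_Mapping.keys m \<subseteq> E"
      have "(\<Sum>j<b 0. a j * ?S 0 m v j) = 0" if "Poly_Mapping.keys m \<in> \<Delta>"
        using I that unfolding S_aug[symmetric] face_ideal_def by (auto simp: in_keys_iff)
      then show "\<exists>w\<in>strand {..<b (Suc 0)} (D (Suc 0)) (Poly_Mapping.keys m).
        ?S 0 m v = mat_apply (A 0) {..<b (Suc 0)} w"
        using exact_0[OF m S_strand[of 0 m v]] by auto
    qed
  next
    fix v assume v: "v \<in> free_module E (b 0)" and "\<exists>w\<in>free_module E (b 1). v = apply_diff ?F 0 w"
    then obtain w where w: "w \<in> free_module E (b 1)" "v = apply_diff ?F 0 w" by blast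
    have "Poly_Mapping.keys m \<subseteq> E \<and> Poly_Mapping.keys m \<notin> \<Delta>"
      if "m \<in> Poly_Mapping.keys (apply_aug ?F v)" for m
    proof -
      have nz: "(\<Sum>j<b 0. a j * ?S 0 m v j) \<noteq> 0" using that by (simp add: in_keys_iff S_aug)
      then have "?S 0 m v \<noteq> 0" by auto
      then have m: "Poly_Mapping.keys m \<subseteq> E" by (rule S_supp[OF v])
      have "?S 0 m v = mat_apply (A 0) {..<b 1} (?S 1 m w)"
        unfolding w(2) S_diff by simp
      then show ?thesis using exact_0[OF m S_strand[of 0 m v]] S_strand[of 1 m w] nz m by blast
    qed
    then show "apply_aug ?F v \<in> face_ideal E \<Delta>" by (auto simp: face_ideal_def poly_ring_def)
  next
    fix i v assume v: "v \<in> free_module E (b (Suc i))" and I: "apply_diff ?F i v = (\<lambda>_. 0)"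
    show "\<exists>w\<in>free_module E (b (Suc (Suc i))). v = apply_diff ?F (Suc i) w"
    proof (rule lift[OF v])
      fix m :: "'e \<Rightarrow>\<^sub>0 nat" assume m: "Poly_Mapping.keys m \<subseteq> E"
      have "mat_apply (A i) {..<b (Suc i)} (?S (Suc i) m v) = 0"
        unfolding S_diff[symmetric] I by (auto simp: exp_strand_def fun_eq_iff)
      then show "\<exists>w\<in>strand {..<b (Suc (Suc i))} (D (Suc (Suc i))) (Poly_Mapping.keys m).
        ?S (Suc i) m v = mat_apply (A (Suc i)) {..<b (Suc (Suc i))} w"
        using exact_Suc[OF m S_strand[of "Suc i" m v]] by auto
    qed
  next
    fix i v assume v: "v \<in> free_module E (b (Suc i))"
      and "\<exists>w\<in>free_module E (b (Suc (Suc i))). v = apply_diff ?F (Suc i) w"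
    then obtain w where w: "w \<in> free_module E (b (Suc (Suc i)))" "v = apply_diff ?F (Suc i) w" by blast
    show "apply_diff ?F i v = (\<lambda>_. 0)"
    proof (rule exp_strand_eqI[where b = "b i" and dg = "fr_deg ?F i"])
      show "exp_strand (fr_deg ?F i) (b i) m (apply_diff ?F i v) = exp_strand (fr_deg ?F i) (b i) m (\<lambda>_. 0)" for m
      proof -
        have "mat_apply (A i) {..<b (Suc i)} (?S (Suc i) m v) = 0"
        proof (cases "?S (Suc i) m v = 0")
          case True
          then show ?thesis by (simp add: mat_apply_def fun_eq_iff)
        next
          case False
          then have m: "Poly_Mapping.keys m \<subseteq> E" by (rule S_supp[OF v])
          have "?S (Suc i) m v = mat_apply (A (Suc i)) {..<b (Suc (Suc i))} (?S (Suc (Suc i)) m w)"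
            unfolding w(2) S_diff by simp
          then show ?thesis using exact_Suc[OF m S_strand[of "Suc i" m v]] S_strand[of "Suc (Suc i)" m w] by blast
        qed
        then have "?S i m (apply_diff ?F i v) = 0" by (simp add: S_diff)
        then show ?thesis by (auto simp: F(1) exp_strand_def fun_eq_iff)
      qed
    qed (auto simp: apply_diff_def F(1))
  qed
  show ?thesis
    unfolding minimal_free_resolution_def
  proof (intro conjI mc res allI impI)
    fix i r c assume r: "r < fr_rank ?F i" and c: "c < fr_rank ?F (Suc i)"
    show "Poly_Mapping.lookup (fr_diff ?F i r c) 0 = 0"
    proof (cases "A i r c = 0")
      case False
      then obtain e where e: "e \<in> D (Suc i) c - D i r" using A_support[of c i r] c by (auto simp: F)
      have "finite (D (Suc i) c - D i r)" using finD c by (simp add: F)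
      then have "Poly_Mapping.lookup (set_exponent (D (Suc i) c - D i r)) e = 1"
        using e by (simp add: lookup_set_exponent)
      then have "set_exponent (D (Suc i) c - D i r) \<noteq> 0" by auto
      then show ?thesis by (simp add: F lookup_single when_def)
    qed (simp add: F)
  qed
qed

section \<open>Existence of minimal resolutions\<close>

text \<open>The images of the elements of \<open>G\<close> form a basis of \<open>V / L\<close>.\<close>

lemma (in vector_space) complement_basis:
  assumes "subspace V" "L \<subseteq> V" "V \<subseteq> span W" "finite W"
  obtains G where "finite G" "G \<subseteq> V" "V \<subseteq> span (L \<union> G)"
    and "\<And>s g. (\<Sum>g\<in>G. s g *s g) \<in> span L \<Longrightarrow> g \<in> G \<Longrightarrow> s g = 0"
proof -
  obtain B where B: "B \<subseteq> L" "independent B" "L \<subseteq> span B"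
    by (rule maximal_independent_subset[of L])
  obtain C where C: "B \<subseteq> C" "C \<subseteq> V" "independent C" "V \<subseteq> span C"
    by (rule maximal_independent_subset_extend[of B V]) (use B assms(2) in auto)
  have finC: "finite C"
    by (rule conjunct1[OF independent_span_bound[OF assms(4) C(3)]]) (use C(2) assms(3) in blast)
  show ?thesis
  proof
    show "finite (C - B)" "C - B \<subseteq> V" using finC C(2) by auto
    have "C \<subseteq> L \<union> (C - B)" using B(1) by auto
    then show "V \<subseteq> span (L \<union> (C - B))" using C(4) span_mono by blast
  next
    fix s g assume s: "(\<Sum>g\<in>C - B. s g *s g) \<in> span L" and g: "g \<in> C - B"
    have LB: "span L \<subseteq> span B" using B(3) by (intro span_minimal) auto
    have "(\<Sum>g\<in>C - B. s g *s g) \<in> span (C - B)"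
      by (intro span_sum span_scale span_base)
    then have "(\<Sum>g\<in>C - B. s g *s g) = 0"
      using independent_span_Diff_eq_0[OF C(3,1)] s LB by blast
    then show "s g = 0"
      using independentD[OF C(3), of "C - B" s g] finC g by auto
  qed
qed

section \<open>Minimal covers of syzygies\<close>

definition kernel_family :: "nat \<Rightarrow> (nat \<Rightarrow> 'e set) \<Rightarrow> (nat \<Rightarrow> nat \<Rightarrow> 'k::field) \<Rightarrow> 'e set \<Rightarrow> (nat \<Rightarrow> 'k) set" where
  "kernel_family b D A \<sigma> = {v \<in> strand {..<b} D \<sigma>. mat_apply A {..<b} v = 0}"

text \<open>The invariant of the construction. Support in properly smaller degrees is minimality;
  monotonicity in \<open>\<sigma>\<close> expresses closure under multiplication by squarefree
  monomials.\<close>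

definition syzygy_family :: "'e set \<Rightarrow> nat \<Rightarrow> (nat \<Rightarrow> 'e set) \<Rightarrow> ('e set \<Rightarrow> (nat \<Rightarrow> 'k::field) set) \<Rightarrow> bool" where
  "syzygy_family E b D Z \<longleftrightarrow> (\<forall>c<b. D c \<subseteq> E) \<and>
     (\<forall>\<sigma>\<subseteq>E. fvec.subspace (Z \<sigma>) \<and> (\<forall>v\<in>Z \<sigma>. \<forall>c. v c \<noteq> 0 \<longrightarrow> c < b \<and> D c \<subset> \<sigma>) \<and>
        (\<forall>\<tau>\<subseteq>\<sigma>. Z \<tau> \<subseteq> Z \<sigma>))"

lemma mat_apply_as_sum: "mat_apply A J v = (\<Sum>c\<in>J. fscale (v c) (\<lambda>r. A r c :: 'k::field))"
proof
  fix r
  have "(\<Sum>c\<in>J. fscale (v c) (\<lambda>r. A r c)) r = (\<Sum>c\<in>J. fscale (v c) (\<lambda>r. A r c) r)"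
    by (induction J rule: infinite_finite_induct) auto
  then show "mat_apply A J v r = (\<Sum>c\<in>J. fscale (v c) (\<lambda>r. A r c)) r"
    by (simp add: mat_apply_def fscale_def mult.commute)
qed

text \<open>Graded Nakayama: in each degree \<open>\<sigma>\<close> the generators are a basis of
  \<open>Z \<sigma>\<close> modulo what smaller degrees supply. Induction on \<open>\<sigma>\<close>
  shows that they generate, and independence modulo the smaller degrees makes the next syzygies
  minimal.\<close>

lemma syzygy_family_cover:
  fixes Z :: "'e set \<Rightarrow> (nat \<Rightarrow> 'k::field) set"
  assumes fin: "finite E" and Z: "syzygy_family E b D Z"
  shows "\<exists>b' D' A. (\<forall>c<b'. \<forall>r. A r c \<noteq> 0 \<longrightarrow> r < b \<and> D r \<subset> D' c) \<and>
    (\<forall>\<sigma>\<subseteq>E. Z \<sigma> = mat_apply A {..<b'} ` strand {..<b'} D' \<sigma>) \<and>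
    syzygy_family E b' D' (kernel_family b' D' A)"
proof -
  have sub: "fvec.subspace (Z \<sigma>)" and supp: "\<And>v c. v \<in> Z \<sigma> \<Longrightarrow> v c \<noteq> 0 \<Longrightarrow> c < b \<and> D c \<subset> \<sigma>"
    and mono: "\<And>\<tau>. \<tau> \<subseteq> \<sigma> \<Longrightarrow> Z \<tau> \<subseteq> Z \<sigma>" if "\<sigma> \<subseteq> E" for \<sigma>
    using Z that unfolding syzygy_family_def by blast+
  \<comment> \<open>What arrives from below: the elements of \<open>Z \<sigma>\<close> obtained by
    multiplying with a variable. It is a union of subspaces, and its span is taken where a subspace
    is required.\<close>
  define L where "L \<sigma> = (\<Union>e\<in>\<sigma>. Z (\<sigma> - {e}))" for \<sigma>
  have LZ: "L \<sigma> \<subseteq> Z \<sigma>" if "\<sigma> \<subseteq> E" for \<sigma> using mono[OF that] by (auto simp: L_def)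
  have span_b: "Z \<sigma> \<subseteq> fvec.span (unit_vec ` {c \<in> {..<b}. D c \<subseteq> \<sigma>})" if "\<sigma> \<subseteq> E" for \<sigma>
    unfolding strand_eq_span[OF finite_lessThan, symmetric] strand_def using supp[OF that] by blast
  have "\<exists>G. \<forall>\<sigma>. \<sigma> \<subseteq> E \<longrightarrow> finite (G \<sigma>) \<and> G \<sigma> \<subseteq> Z \<sigma> \<and> Z \<sigma> \<subseteq> fvec.span (L \<sigma> \<union> G \<sigma>) \<and>
    (\<forall>s. (\<Sum>g\<in>G \<sigma>. fscale (s g) g) \<in> fvec.span (L \<sigma>) \<longrightarrow> (\<forall>g\<in>G \<sigma>. s g = 0))"
  proof (rule choice, intro allI)
    fix \<sigma>
    show "\<exists>G. \<sigma> \<subseteq> E \<longrightarrow> finite G \<and> G \<subseteq> Z \<sigma> \<and> Z \<sigma> \<subseteq> fvec.span (L \<sigma> \<union> G) \<and>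
      (\<forall>s. (\<Sum>g\<in>G. fscale (s g) g) \<in> fvec.span (L \<sigma>) \<longrightarrow> (\<forall>g\<in>G. s g = 0))"
    proof (cases "\<sigma> \<subseteq> E")
      case True
      show ?thesis
      proof (rule fvec.complement_basis[OF sub[OF True] LZ[OF True] span_b[OF True]])
        show "finite (unit_vec ` {c \<in> {..<b}. D c \<subseteq> \<sigma>})" by simp
        fix G assume g: "finite G" "G \<subseteq> Z \<sigma>" "Z \<sigma> \<subseteq> fvec.span (L \<sigma> \<union> G)"
        "\<And>s g. (\<Sum>g\<in>G. fscale (s g) g) \<in> fvec.span (L \<sigma>) \<Longrightarrow> g \<in> G \<Longrightarrow> s g = 0"
        show ?thesis
        proof (intro exI[of _ G] impI conjI allI ballI)
          fix s g assume "(\<Sum>g\<in>G. fscale (s g) g) \<in> fvec.span (L \<sigma>)" "g \<in> G"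
          then show "s g = 0" by (rule g(4))
        qed (rule g(1-3))+
      qed
    qed simp
  qed
  then obtain G where G0: "\<forall>\<sigma>. \<sigma> \<subseteq> E \<longrightarrow> finite (G \<sigma>) \<and> G \<sigma> \<subseteq> Z \<sigma> \<and> Z \<sigma> \<subseteq> fvec.span (L \<sigma> \<union> G \<sigma>) \<and>
    (\<forall>s. (\<Sum>g\<in>G \<sigma>. fscale (s g) g) \<in> fvec.span (L \<sigma>) \<longrightarrow> (\<forall>g\<in>G \<sigma>. s g = 0))"
    by (rule exE)
  note G = G0[rule_format, THEN conjunct1] G0[rule_format, THEN conjunct2, THEN conjunct1]
    G0[rule_format, THEN conjunct2, THEN conjunct2, THEN conjunct1]
    G0[rule_format, THEN conjunct2, THEN conjunct2, THEN conjunct2, rule_format]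
  \<comment> \<open>Each generator is tagged with its degree, since the same vector may be chosen in
    several degrees.\<close>
  let ?P = "Sigma (Pow E) G"
  have "finite ?P" using fin G(1) by (intro finite_SigmaI) auto
  then obtain h where h: "bij_betw h {..<card ?P} ?P"
    using ex_bij_betw_nat_finite by (metis atLeast0LessThan)
  define b' where "b' = card ?P"
  define D' where "D' c = fst (h c)" for c
  define A where "A r c = snd (h c) r" for r c
  have hP: "D' c \<subseteq> E" "(\<lambda>r. A r c) \<in> G (D' c)" if "c < b'" for c
  proof -
    have "h c \<in> ?P" using bij_betwE[OF h] that by (simp add: b'_def)
    then have "fst (h c) \<in> Pow E" "snd (h c) \<in> G (fst (h c))" by (simp_all add: mem_Times_iff split_beta Sigma_def) auto
    then show "D' c \<subseteq> E" "(\<lambda>r. A r c) \<in> G (D' c)" by (simp_all add: D'_def A_def)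
  qed
  have h_surj: "\<exists>c<b'. h c = x" if "x \<in> ?P" for x
  proof -
    have "x \<in> h ` {..<b'}" unfolding b'_def bij_betw_imp_surj_on[OF h] by (rule that)
    then show ?thesis by (elim imageE) (simp, blast)
  qed
  have AZ: "(\<lambda>r. A r c) \<in> Z (D' c)" if "c < b'" for c using hP[OF that] G(2) by blast
  let ?Im = "\<lambda>\<sigma>. mat_apply A {..<b'} ` strand {..<b'} D' \<sigma>"
  have sub_Im: "fvec.subspace (?Im \<sigma>)" for \<sigma>
    by (rule fvec_pair.linear_subspace_image[OF linear_mat_apply subspace_strand])
  have Im_mono: "?Im \<tau> \<subseteq> ?Im \<sigma>" if "\<tau> \<subseteq> \<sigma>" for \<sigma> \<tau>
    by (rule image_mono) (use that in \<open>auto simp: strand_def\<close>)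
  have Z_Im: "Z \<sigma> \<subseteq> ?Im \<sigma>" if "\<sigma> \<subseteq> E" for \<sigma>
  proof -
    have "finite \<sigma>" using that fin finite_subset by metis
    then show ?thesis using that
    proof (induction rule: finite_psubset_induct)
      case (psubset \<sigma>)
      have "L \<sigma> \<subseteq> ?Im \<sigma>"
        unfolding L_def
      proof (rule UN_least)
        fix e assume "e \<in> \<sigma>"
        then have "\<sigma> - {e} \<subset> \<sigma>" "\<sigma> - {e} \<subseteq> E" using psubset.prems by auto
        then have "Z (\<sigma> - {e}) \<subseteq> ?Im (\<sigma> - {e})" by (rule psubset.IH)
        also have "\<dots> \<subseteq> ?Im \<sigma>" by (rule Im_mono) auto
        finally show "Z (\<sigma> - {e}) \<subseteq> ?Im \<sigma>" .
      qed
      moreover have "G \<sigma> \<subseteq> ?Im \<sigma>"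
      proof
        fix g assume "g \<in> G \<sigma>"
        then have "(\<sigma>, g) \<in> ?P" using psubset.prems by simp
        from h_surj[OF this] obtain c where c: "c < b'" "h c = (\<sigma>, g)" by (elim exE conjE)
        have "mat_apply A {..<b'} (unit_vec c) = g"
          using c by (auto simp: mat_apply_def unit_vec_def A_def if_distrib cong: if_cong)
        moreover have "unit_vec c \<in> strand {..<b'} D' \<sigma>"
          using c by (auto simp: strand_def unit_vec_def D'_def split: if_splits)
        ultimately show "g \<in> ?Im \<sigma>" by blast
      qed
      ultimately have "fvec.span (L \<sigma> \<union> G \<sigma>) \<subseteq> ?Im \<sigma>"
        by (intro fvec.span_minimal[OF _ sub_Im]) auto
      then show ?case using G(3)[OF psubset.prems] by blast
    qed
  qed
  have Im_Z: "?Im \<sigma> \<subseteq> Z \<sigma>" if "\<sigma> \<subseteq> E" for \<sigma>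
  proof (rule image_subsetI)
    fix v :: "nat \<Rightarrow> 'k" assume v: "v \<in> strand {..<b'} D' \<sigma>"
    show "mat_apply A {..<b'} v \<in> Z \<sigma>"
      unfolding mat_apply_as_sum
    proof (rule fvec.subspace_sum[OF sub[OF that]])
      fix c assume c: "c \<in> {..<b'}"
      show "fscale (v c) (\<lambda>r. A r c) \<in> Z \<sigma>"
      proof (cases "v c = 0")
        case True
        then show ?thesis using fvec.subspace_0[OF sub[OF that]] by simp
      next
        case False
        then have "Z (D' c) \<subseteq> Z \<sigma>" using v mono[OF that] by (auto simp: strand_def)
        then show ?thesis using AZ[of c] c fvec.subspace_scale[OF sub[OF that]] by blast
      qed
    qed
  qed
  have mini: "D' c \<noteq> \<sigma>" if \<sigma>: "\<sigma> \<subseteq> E" and v: "v \<in> kernel_family b' D' A \<sigma>" and c: "v c \<noteq> 0" for \<sigma> v c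
  proof
    assume Dc: "D' c = \<sigma>"
    have vs: "v \<in> strand {..<b'} D' \<sigma>" and v0: "mat_apply A {..<b'} v = 0"
      using v by (auto simp: kernel_family_def)
    have cb: "c < b'" using vs c by (auto simp: strand_def)
    \<comment> \<open>A relation in degree \<open>\<sigma>\<close> splits into generators of degree
      \<open>\<sigma>\<close> and of smaller degree. The latter fall into the span of
      \<open>L \<sigma>\<close>, so the former combine to an element of it and their coefficients
      vanish.\<close>
    let ?T = "{j \<in> {..<b'}. D' j = \<sigma>}"
    let ?f = "\<lambda>j. fscale (v j) (\<lambda>r. A r j)"
    have low: "?f j \<in> fvec.span (L \<sigma>)" if "j \<in> {..<b'} - ?T" for j
    proof (cases "v j = 0")
      case True
      then show ?thesis using fvec.span_zero by simp
    next
      case False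
      then have "D' j \<subset> \<sigma>" using vs that by (auto simp: strand_def)
      then obtain e where e: "e \<in> \<sigma>" "D' j \<subseteq> \<sigma> - {e}" by blast
      have "Z (D' j) \<subseteq> Z (\<sigma> - {e})" by (rule mono) (use e \<sigma> in auto)
      then have "(\<lambda>r. A r j) \<in> L \<sigma>" using e(1) AZ[of j] that unfolding L_def by blast
      then show ?thesis by (intro fvec.span_scale fvec.span_base)
    qed
    have "(\<Sum>j\<in>{..<b'}. ?f j) = (\<Sum>j\<in>?T. ?f j) + (\<Sum>j\<in>{..<b'} - ?T. ?f j)"
      by (subst sum.subset_diff[of ?T "{..<b'}"]) auto
    then have "(\<Sum>j\<in>?T. ?f j) = - (\<Sum>j\<in>{..<b'} - ?T. ?f j)"
      using v0 unfolding mat_apply_as_sum by (simp add: eq_neg_iff_add_eq_0)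
    then have T_low: "(\<Sum>j\<in>?T. ?f j) \<in> fvec.span (L \<sigma>)"
      using fvec.span_neg[OF fvec.span_sum[of "{..<b'} - ?T", OF low]] by simp
    have inj: "inj_on (\<lambda>j. snd (h j)) ?T"
    proof (rule inj_onI)
      fix i j assume "i \<in> ?T" "j \<in> ?T" "snd (h i) = snd (h j)"
      then have "h i = h j" "i < b'" "j < b'" by (auto simp: D'_def prod_eq_iff)
      then show "i = j" using bij_betw_imp_inj_on[OF h] by (auto simp: b'_def dest: inj_onD)
    qed
    have img: "(\<lambda>j. snd (h j)) ` ?T = G \<sigma>"
    proof (intro equalityI subsetI)
      fix g assume "g \<in> (\<lambda>j. snd (h j)) ` ?T"
      then show "g \<in> G \<sigma>" using hP by (auto simp: A_def)
    next
      fix g assume "g \<in> G \<sigma>"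
      then have "(\<sigma>, g) \<in> ?P" using \<sigma> by simp
      from h_surj[OF this] obtain j where "j < b'" "h j = (\<sigma>, g)" by (elim exE conjE)
      then show "g \<in> (\<lambda>j. snd (h j)) ` ?T" by (force simp: D'_def)
    qed
    define s where "s g = v (the_inv_into ?T (\<lambda>j. snd (h j)) g)" for g
    have s: "s (snd (h j)) = v j" if "j \<in> ?T" for j
      unfolding s_def using the_inv_into_f_f[OF inj that] by simp
    have "(\<Sum>g\<in>G \<sigma>. fscale (s g) g) = (\<Sum>j\<in>?T. fscale (s (snd (h j))) (snd (h j)))"
      unfolding img[symmetric] sum.reindex[OF inj] comp_def ..
    also have "\<dots> = (\<Sum>j\<in>?T. ?f j)"
      by (rule sum.cong[OF refl]) (simp only: s A_def)
    finally have "(\<Sum>g\<in>G \<sigma>. fscale (s g) g) \<in> fvec.span (L \<sigma>)" using T_low by simp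
    then have "s (snd (h c)) = 0"
      by (rule G(4)[OF \<sigma>]) (use img cb Dc in blast)
    then show False using s[of c] cb Dc c by simp
  qed
  have "syzygy_family E b' D' (kernel_family b' D' A)"
    unfolding syzygy_family_def
  proof (intro conjI allI impI ballI)
    show "D' c \<subseteq> E" if "c < b'" for c using hP(1)[OF that] .
  next
    fix \<sigma>
    show "fvec.subspace (kernel_family b' D' A \<sigma>)"
      using fvec.subspace_inter[OF subspace_strand
          fvec_pair.linear_subspace_kernel[OF linear_mat_apply]]
      by (simp add: kernel_family_def Collect_conj_eq)
    fix \<tau> assume "\<tau> \<subseteq> \<sigma>"
    then show "kernel_family b' D' A \<tau> \<subseteq> kernel_family b' D' A \<sigma>"
      by (auto simp: kernel_family_def strand_def)
  next
    fix \<sigma> v c assume "\<sigma> \<subseteq> E" "v \<in> kernel_family b' D' A \<sigma>" "v c \<noteq> 0"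
    then show "c < b'" "D' c \<subset> \<sigma>"
      using mini[of \<sigma> v c] by (auto simp: kernel_family_def strand_def)
  qed
  moreover have "\<forall>c<b'. \<forall>r. A r c \<noteq> 0 \<longrightarrow> r < b \<and> D r \<subset> D' c"
  proof (intro allI impI)
    fix c r assume "c < b'" "A r c \<noteq> 0"
    then show "r < b \<and> D r \<subset> D' c" using supp[OF hP(1) AZ, of c r] by simp
  qed
  moreover have "\<forall>\<sigma>\<subseteq>E. Z \<sigma> = ?Im \<sigma>"
    using Z_Im Im_Z by (intro allI impI equalityI)
  ultimately show ?thesis by blast
qed

text \<open>Covers are iterated by dependent choice, starting from one basis element of degree
  \<open>{}\<close> and the kernel of its augmentation. The state holds rank, degrees and syzygies;
  the differentials are recovered afterwards from the relation \<open>Q\<close>.\<close>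

lemma squarefree_resolution_exists:
  fixes E :: "'e set"
  assumes fin: "finite E" and \<Delta>: "{} \<in> \<Delta>" "\<And>\<sigma> \<tau>. \<sigma> \<in> \<Delta> \<Longrightarrow> \<tau> \<subseteq> \<sigma> \<Longrightarrow> \<tau> \<in> \<Delta>"
  shows "\<exists>b D (A :: nat \<Rightarrow> nat \<Rightarrow> nat \<Rightarrow> 'k::field) a. squarefree_resolution E \<Delta> (\<lambda>i. {..<b i}) D A a"
proof -
  let ?Z0 = "\<lambda>\<sigma>. {v :: nat \<Rightarrow> 'k. v \<in> strand {..<1} (\<lambda>_. {}) \<sigma> \<and> (\<sigma> \<in> \<Delta> \<longrightarrow> v 0 = 0)}"
  define P where "P n x \<longleftrightarrow> (case x of (b, D, Z) \<Rightarrow> syzygy_family E b D Z \<and>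
    (n = 0 \<longrightarrow> b = 1 \<and> D = (\<lambda>_. {}) \<and> Z = ?Z0))" for n :: nat and x
  define Q where "Q n x y \<longleftrightarrow> (case x of (b, D, Z) \<Rightarrow> case y of (b', D', Z') \<Rightarrow>
    \<exists>A. (\<forall>c<b'. \<forall>r. A r c \<noteq> 0 \<longrightarrow> r < b \<and> D r \<subset> D' c) \<and>
    (\<forall>\<sigma>\<subseteq>E. Z \<sigma> = mat_apply A {..<b'} ` strand {..<b'} D' \<sigma>) \<and> Z' = kernel_family b' D' A)"
    for n :: nat and x y :: "nat \<times> (nat \<Rightarrow> 'e set) \<times> ('e set \<Rightarrow> (nat \<Rightarrow> 'k) set)"
  have "\<exists>f. \<forall>n. P n (f n) \<and> Q n (f n) (f (Suc n))"
  proof (rule dependent_nat_choice)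
    have "syzygy_family E 1 (\<lambda>_. {}) ?Z0"
      unfolding syzygy_family_def
    proof (intro conjI allI impI ballI)
      fix \<sigma>
      have "fvec.subspace {v :: nat \<Rightarrow> 'k. \<sigma> \<in> \<Delta> \<longrightarrow> v 0 = 0}"
        by (auto simp: fvec.subspace_def fscale_def)
      then show "fvec.subspace (?Z0 \<sigma>)"
        using fvec.subspace_inter[OF subspace_strand] by (metis (no_types) Collect_conj_eq Collect_mem_eq)
      show "?Z0 \<tau> \<subseteq> ?Z0 \<sigma>" if "\<tau> \<subseteq> \<sigma>" for \<tau>
        using \<Delta>(2)[OF _ that] by (auto simp: strand_def)
    next
      fix \<sigma> v c assume v: "v \<in> ?Z0 \<sigma>" "v c \<noteq> 0"
      then show "c < 1" by (auto simp: strand_def)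
      \<comment> \<open>Since \<open>{}\<close> is a face, the kernel in degree \<open>{}\<close> is
        zero; this is minimality at the start.\<close>
      then have "\<sigma> \<noteq> {}" using v \<Delta>(1) by auto
      then show "{} \<subset> \<sigma>" by auto
    qed auto
    then show "\<exists>x. P 0 x" unfolding P_def by blast
  next
    fix x n assume x: "P n x"
    obtain b D Z where bDZ: "x = (b, D, Z)" by (cases x)
    then have "syzygy_family E b D Z" using x by (simp add: P_def)
    from syzygy_family_cover[OF fin this] obtain b' D' A where A:
      "\<forall>c<b'. \<forall>r. A r c \<noteq> 0 \<longrightarrow> r < b \<and> D r \<subset> D' c"
      "\<forall>\<sigma>\<subseteq>E. Z \<sigma> = mat_apply A {..<b'} ` strand {..<b'} D' \<sigma>"
      "syzygy_family E b' D' (kernel_family b' D' A)" by (elim exE conjE)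
    have "P (Suc n) (b', D', kernel_family b' D' A)"
      unfolding P_def using A(3) by simp
    moreover have "Q n x (b', D', kernel_family b' D' A)"
      unfolding Q_def bDZ prod.case using A(1,2) by (intro exI[of _ A] conjI refl)
    ultimately show "\<exists>y. P (Suc n) y \<and> Q n x y" by blast
  qed
  then obtain f where f: "\<And>n. P n (f n)" "\<And>n. Q n (f n) (f (Suc n))" by blast
  define b where "b n = fst (f n)" for n
  define D where "D n = fst (snd (f n))" for n
  define Z where "Z n = snd (snd (f n))" for n
  have f_eq: "f n = (b n, D n, Z n)" for n by (simp add: b_def D_def Z_def)
  have syz: "syzygy_family E (b n) (D n) (Z n)" for n
    using f(1)[of n] by (simp add: P_def f_eq)
  have init: "b 0 = 1" "D 0 = (\<lambda>_. {})" "Z 0 = ?Z0"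
    using f(1)[of 0] by (simp_all add: P_def f_eq)
  have "\<forall>n. \<exists>A. (\<forall>c<b (Suc n). \<forall>r. A r c \<noteq> 0 \<longrightarrow> r < b n \<and> D n r \<subset> D (Suc n) c) \<and>
    (\<forall>\<sigma>\<subseteq>E. Z n \<sigma> = mat_apply A {..<b (Suc n)} ` strand {..<b (Suc n)} (D (Suc n)) \<sigma>) \<and>
    Z (Suc n) = kernel_family (b (Suc n)) (D (Suc n)) A"
    using f(2) by (simp add: Q_def f_eq)
  from choice[OF this] obtain A where A0: "\<forall>n. (\<forall>c<b (Suc n). \<forall>r. A n r c \<noteq> 0 \<longrightarrow> r < b n \<and> D n r \<subset> D (Suc n) c) \<and>
    (\<forall>\<sigma>\<subseteq>E. Z n \<sigma> = mat_apply (A n) {..<b (Suc n)} ` strand {..<b (Suc n)} (D (Suc n)) \<sigma>) \<and>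
    Z (Suc n) = kernel_family (b (Suc n)) (D (Suc n)) (A n)"
    by (rule exE)
  have A: "\<And>n c r. c < b (Suc n) \<Longrightarrow> A n r c \<noteq> 0 \<Longrightarrow> r < b n \<and> D n r \<subset> D (Suc n) c"
    "\<And>n \<sigma>. \<sigma> \<subseteq> E \<Longrightarrow> Z n \<sigma> = mat_apply (A n) {..<b (Suc n)} ` strand {..<b (Suc n)} (D (Suc n)) \<sigma>"
    "\<And>n. Z (Suc n) = kernel_family (b (Suc n)) (D (Suc n)) (A n)"
    by (fact A0[THEN spec, THEN conjunct1, rule_format]
      A0[THEN spec, THEN conjunct2, THEN conjunct1, rule_format]
      A0[THEN spec, THEN conjunct2, THEN conjunct2])+
  have "squarefree_resolution E \<Delta> (\<lambda>i. {..<b i}) D A (\<lambda>_. 1)"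
  proof
    show "D i c \<subseteq> E" if "c \<in> {..<b i}" for i c
      using syz[of i] that by (simp add: syzygy_family_def)
    show "r \<in> {..<b i} \<and> D i r \<subset> D (Suc i) c" if "c \<in> {..<b (Suc i)}" "A i r c \<noteq> 0" for i r c
      using A(1)[of c i r] that by simp
    show "\<exists>v\<in>strand {..<b 0} (D 0) \<sigma>. (\<Sum>c\<in>{..<b 0}. 1 * v c) = (1 :: 'k)" for \<sigma>
      by (rule bexI[of _ "unit_vec 0"]) (auto simp: init strand_def unit_vec_def split: if_splits)
    show "(\<sigma> \<in> \<Delta> \<longrightarrow> (\<Sum>c\<in>{..<b 0}. 1 * v c) = 0) \<longleftrightarrow>
      (\<exists>w\<in>strand {..<b 1} (D 1) \<sigma>. v = mat_apply (A 0) {..<b 1} w)"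
      if "\<sigma> \<subseteq> E" "v \<in> strand {..<b 0} (D 0) \<sigma>" for \<sigma> and v :: "nat \<Rightarrow> 'k"
    proof -
      have "(\<sigma> \<in> \<Delta> \<longrightarrow> (\<Sum>c\<in>{..<b 0}. 1 * v c) = 0) \<longleftrightarrow> v \<in> Z 0 \<sigma>"
        using that(2) unfolding init by auto
      then show ?thesis unfolding A(2)[OF that(1)] by (auto simp: image_iff)
    qed
    show "mat_apply (A i) {..<b (Suc i)} v = 0 \<longleftrightarrow>
      (\<exists>w\<in>strand {..<b (Suc (Suc i))} (D (Suc (Suc i))) \<sigma>. v = mat_apply (A (Suc i)) {..<b (Suc (Suc i))} w)"
      if "\<sigma> \<subseteq> E" "v \<in> strand {..<b (Suc i)} (D (Suc i)) \<sigma>" for \<sigma> i and v :: "nat \<Rightarrow> 'k"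
    proof -
      have "mat_apply (A i) {..<b (Suc i)} v = 0 \<longleftrightarrow> v \<in> Z (Suc i) \<sigma>"
        using that(2) unfolding A(3) by (simp add: kernel_family_def)
      then show ?thesis unfolding A(2)[OF that(1)] by (auto simp: image_iff)
    qed
  qed (simp_all add: fin)
  then show ?thesis by blast
qed

lemma minimal_free_resolution_exists:
  assumes "finite E" "{} \<in> \<Delta>" "\<And>\<sigma> \<tau>. \<sigma> \<in> \<Delta> \<Longrightarrow> \<tau> \<subseteq> \<sigma> \<Longrightarrow> \<tau> \<in> \<Delta>"
  shows "\<exists>F :: ('e, 'k::field) free_complex. minimal_free_resolution E (face_ideal E \<Delta>) F"
proof -
  obtain b D and A :: "nat \<Rightarrow> nat \<Rightarrow> nat \<Rightarrow> 'k" and a where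
    "squarefree_resolution E \<Delta> (\<lambda>i. {..<b i}) D A a"
    using squarefree_resolution_exists[OF assms(1,2), where ?'k = 'k] assms(3) by auto
  from minimal_of_squarefree_resolution[OF this] show ?thesis by (rule exI)
qed

text \<open>Existence turns the \<open>SOME\<close> into an actual minimal resolution, to which the
  Euler characteristic applies. Any \<open>k\<close> above all nullities is allowed, so one bound
  can serve all elongations.\<close>

lemma multigraded_betti_matroid:
  fixes M :: "'e matroid"
  assumes fin: "finite (ground M)" and \<nu>: "matroid_nullity (ground M) \<nu>"
    and dep: "\<And>\<sigma>. \<sigma> \<subseteq> ground M \<Longrightarrow> \<sigma> \<in> dependent_sets M \<longleftrightarrow> \<nu> \<sigma> \<noteq> 0"
    and \<sigma>: "\<sigma> \<subseteq> ground M" and k: "\<nu> (ground M) \<le> k"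
  shows "(\<Sum>i\<le>k. (-1) ^ i * int (multigraded_betti TYPE('k::field) M i \<sigma>)) =
    (\<Sum>\<gamma>\<in>Pow \<sigma>. (-1) ^ (card \<sigma> + card \<gamma>) * (if \<nu> \<gamma> = 0 then 1 else 0))"
proof -
  let ?E = "ground M" and ?\<Delta> = "- dependent_sets M"
  have dep_sub: "\<sigma> \<subseteq> ?E" if "\<sigma> \<in> dependent_sets M" for \<sigma> using that by (simp add: dependent_sets_def)
  have up: "\<tau> \<in> dependent_sets M" if "\<sigma> \<in> dependent_sets M" "\<sigma> \<subseteq> \<tau>" "\<tau> \<subseteq> ?E" for \<sigma> \<tau>
    using matroid_nullity_mono[OF \<nu> that(2,3) fin] dep[OF that(3)] dep[OF dep_sub[OF that(1)]] that(1) by simp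
  \<comment> \<open>The complement of the dependent sets also contains sets that leave the ground
    set; intersecting with \<open>Pow ?E\<close> makes it closed under subsets and keeps the
    ideal.\<close>
  have ideal: "(matroid_ideal M :: ('e, 'k) mvpoly set) = face_ideal ?E (?\<Delta> \<inter> Pow ?E)"
  proof -
    have "(matroid_ideal M :: ('e, 'k) mvpoly set) = face_ideal ?E ?\<Delta>"
      by (rule matroid_ideal_eq[OF fin]) (rule up)
    then show ?thesis by (auto simp: face_ideal_def poly_ring_def)
  qed
  have "\<exists>F :: ('e, 'k) free_complex. minimal_free_resolution ?E (face_ideal ?E (?\<Delta> \<inter> Pow ?E)) F"
  proof (rule minimal_free_resolution_exists[OF fin])
    show "{} \<in> ?\<Delta> \<inter> Pow ?E" using dep[of "{}"] \<nu> by (simp add: matroid_nullity_def)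
    show "\<tau> \<in> ?\<Delta> \<inter> Pow ?E" if "\<sigma> \<in> ?\<Delta> \<inter> Pow ?E" "\<tau> \<subseteq> \<sigma>" for \<sigma> \<tau>
      using that up[of \<tau> \<sigma>] by auto
  qed
  then obtain F where F: "F = (SOME F :: ('e, 'k) free_complex. minimal_free_resolution ?E (matroid_ideal M) F)"
    "minimal_free_resolution ?E (face_ideal ?E (?\<Delta> \<inter> Pow ?E)) F"
    unfolding ideal by (metis someI_ex)
  let ?J = "\<lambda>i. {c. c < fr_rank F i \<and> adds_exp (fr_deg F i c) (set_exponent ?E)}"
  let ?D = "\<lambda>i c. Poly_Mapping.keys (fr_deg F i c)"
  interpret squarefree_resolution ?E "?\<Delta> \<inter> Pow ?E" ?J ?D "diff_coeff F" "aug_coeff F"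
    by (rule squarefree_resolution_of_minimal[OF fin F(2)])
  have \<Delta>: "\<gamma> \<in> ?\<Delta> \<inter> Pow ?E \<longleftrightarrow> \<nu> \<gamma> = 0" if "\<gamma> \<subseteq> ?E" for \<gamma>
    using dep[OF that] that by auto
  have fin\<sigma>: "finite \<sigma>" using \<sigma> fin finite_subset by metis
  have betti: "multigraded_betti TYPE('k) M i \<sigma> = card {c \<in> ?J i. ?D i c = \<sigma>}" for i
  proof -
    have "fr_deg F i j = set_exponent \<sigma> \<longleftrightarrow> adds_exp (fr_deg F i j) (set_exponent ?E) \<and> ?D i j = \<sigma>" for j
    proof
      assume *: "fr_deg F i j = set_exponent \<sigma>"
      show "adds_exp (fr_deg F i j) (set_exponent ?E) \<and> ?D i j = \<sigma>"
        unfolding * using fin\<sigma> \<sigma> fin by (simp add: adds_exp_set_exponent_left keys_set_exponent)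
    next
      assume "adds_exp (fr_deg F i j) (set_exponent ?E) \<and> ?D i j = \<sigma>"
      then show "fr_deg F i j = set_exponent \<sigma>" using squarefree_exponent[OF fin] by metis
    qed
    then show ?thesis unfolding multigraded_betti_def F(1)[symmetric] Let_def
      by (intro arg_cong[where f = card]) auto
  qed
  have van: False if "k < i" "c \<in> ?J i" for i c
  proof -
    have "i \<le> \<nu> (?D i c)" by (rule vanishing[OF \<nu> \<Delta> that(2)])
    also have "\<dots> \<le> \<nu> ?E" by (rule matroid_nullity_mono[OF \<nu> D_E[OF that(2)] subset_refl fin])
    finally show False using k that(1) by simp
  qed
  have "(\<Sum>i\<le>k. (-1) ^ i * int (multigraded_betti TYPE('k) M i \<sigma>)) =
    (\<Sum>\<gamma>\<in>Pow \<sigma>. (-1) ^ (card \<sigma> + card \<gamma>) * (if \<gamma> \<in> ?\<Delta> \<inter> Pow ?E then 1 else 0))"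
    unfolding betti by (rule euler[OF \<sigma> van])
  also have "\<dots> = (\<Sum>\<gamma>\<in>Pow \<sigma>. (-1) ^ (card \<sigma> + card \<gamma>) * (if \<nu> \<gamma> = 0 then 1 else 0))"
  proof (rule sum.cong[OF refl])
    fix \<gamma> assume "\<gamma> \<in> Pow \<sigma>"
    then have "\<gamma> \<subseteq> ?E" using \<sigma> by auto
    from \<Delta>[OF this] show "(-1) ^ (card \<sigma> + card \<gamma>) * (if \<gamma> \<in> ?\<Delta> \<inter> Pow ?E then 1 else 0)
      = (-1) ^ (card \<sigma> + card \<gamma>) * (if \<nu> \<gamma> = 0 then 1 else (0 :: int))" by simp
  qed
  finally show ?thesis .
qed

section \<open>Duality and Moebius inversion for subspaces\<close>

text \<open>Linearity is asked on \<open>V\<close> only, because \<open>basis_dot b\<close> is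
  linear only on the span of \<open>b\<close>. A vector \<open>w\<close> with
  \<open>g w \<noteq> 0\<close> spans \<open>V\<close> together with the kernel.\<close>

lemma dim_hyperplane:
  fixes V :: "('a::field ^ 'n) set"
  assumes V: "vec.subspace V"
    and add: "\<And>x y. x \<in> V \<Longrightarrow> y \<in> V \<Longrightarrow> g (x + y) = g x + g y"
    and scale: "\<And>c x. x \<in> V \<Longrightarrow> g (c *s x) = c * (g x :: 'a)"
  shows "vec.subspace {v \<in> V. g v = 0}" and "vec.dim V \<le> vec.dim {v \<in> V. g v = 0} + 1"
proof -
  let ?K = "{v \<in> V. g v = 0}"
  show K: "vec.subspace ?K"
    using V add scale scale[OF vec.subspace_0[OF V], of 0]
    by (auto simp: vec.subspace_def)
  show "vec.dim V \<le> vec.dim ?K + 1"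
  proof (cases "V \<subseteq> ?K")
    case True
    then show ?thesis using vec.dim_subset[of V ?K] by simp
  next
    case False
    then obtain w where w: "w \<in> V" "g w \<noteq> 0" by auto
    have "V \<subseteq> vec.span (insert w ?K)"
    proof
      fix v assume v: "v \<in> V"
      let ?c = "g v / g w"
      have wV: "?c *s w \<in> V" by (rule vec.subspace_scale[OF V w(1)])
      have neg: "- (?c *s w) \<in> V" by (rule vec.subspace_neg[OF V wV])
      have "g (v + - (?c *s w)) = g v + g ((- ?c) *s w)"
        using add[OF v neg] by (simp add: vec.scale_minus_left)
      then have "g (v - ?c *s w) = 0" using scale[OF w(1), of "- ?c"] w(2) by simp
      then have "v - ?c *s w \<in> ?K" using vec.subspace_diff[OF V v wV] by simp
      then have "v - ?c *s w \<in> vec.span (insert w ?K)" by (intro vec.span_base) simp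
      moreover have "?c *s w \<in> vec.span (insert w ?K)" by (intro vec.span_scale vec.span_base) simp
      ultimately have "v - ?c *s w + ?c *s w \<in> vec.span (insert w ?K)" by (rule vec.span_add)
      then show "v \<in> vec.span (insert w ?K)" by simp
    qed
    then have "vec.dim V \<le> vec.dim (insert w ?K)" by (rule vec.dim_mono)
    also have "\<dots> \<le> vec.dim ?K + 1" by (simp add: vec.dim_insert)
    finally show ?thesis .
  qed
qed

definition subspace_sum :: "('a::field ^ 'n) set \<Rightarrow> ('a ^ 'n) set \<Rightarrow> ('a ^ 'n) set" where
  "subspace_sum X Y = {x + y | x y. x \<in> X \<and> y \<in> Y}"

lemma subspace_subspace_sum: "vec.subspace X \<Longrightarrow> vec.subspace Y \<Longrightarrow> vec.subspace (subspace_sum X Y)"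
  unfolding subspace_sum_def by (rule vec.subspace_sums)

lemma subspace_sum_least:
  "X \<subseteq> Z \<Longrightarrow> Y \<subseteq> Z \<Longrightarrow> vec.subspace Z \<Longrightarrow> subspace_sum X Y \<subseteq> Z"
  unfolding subspace_sum_def using vec.subspace_add by blast

lemma span_subspace_eq: "vec.subspace X \<Longrightarrow> vec.span X = X"
  by (rule vec.span_eq_iff[THEN iffD2])

lemma span_Un_eq_subspace_sum: "vec.span (S \<union> T) = subspace_sum (vec.span S) (vec.span T)"
  unfolding subspace_sum_def by (rule vec.span_Un)

text \<open>Serves both \<open>std_dot\<close> on the whole space and \<open>basis_dot b\<close> on
  a subspace. Isotropic vectors may exist, so a subspace and its \<open>perp\<close> need not be
  complementary, and dimensions are found by counting equations.\<close>

locale inner_space =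
  fixes f :: "'a::field ^ 'n \<Rightarrow> 'a ^ 'n \<Rightarrow> 'a" and U :: "('a ^ 'n) set"
  assumes U: "vec.subspace U"
    and add_right: "\<And>x y z. x \<in> U \<Longrightarrow> y \<in> U \<Longrightarrow> z \<in> U \<Longrightarrow> f x (y + z) = f x y + f x z"
    and scale_right: "\<And>c x y. x \<in> U \<Longrightarrow> y \<in> U \<Longrightarrow> f x (c *s y) = c * f x y"
    and sym: "\<And>x y. x \<in> U \<Longrightarrow> y \<in> U \<Longrightarrow> f x y = f y x"
    and nondeg: "\<And>y. y \<in> U \<Longrightarrow> (\<And>x. x \<in> U \<Longrightarrow> f x y = 0) \<Longrightarrow> y = 0"
begin

lemma perp_subset: "perp f U X \<subseteq> U"
  by (auto simp: perp_def)

lemma perp_antimono: "X \<subseteq> Y \<Longrightarrow> perp f U Y \<subseteq> perp f U X"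
  by (auto simp: perp_def)

lemma perp_insert: "perp f U (insert x X) = {y \<in> perp f U X. f x y = 0}"
  by (auto simp: perp_def)

lemma subspace_ortho: "x \<in> U \<Longrightarrow> vec.subspace {y \<in> U. f x y = 0}"
  by (rule dim_hyperplane(1)[OF U]) (auto simp: add_right scale_right)

lemma subspace_perp: assumes "X \<subseteq> U" shows "vec.subspace (perp f U X)"
proof -
  have "perp f U X = U \<inter> (\<Inter>x\<in>X. {y \<in> U. f x y = 0})" by (auto simp: perp_def)
  also have "vec.subspace \<dots>"
    using assms subspace_ortho by (intro vec.subspace_inter U vec.subspace_Inter) auto
  finally show ?thesis .
qed

lemma perp_span: assumes "S \<subseteq> U" shows "perp f U (vec.span S) = perp f U S"
proof
  show "perp f U (vec.span S) \<subseteq> perp f U S" by (rule perp_antimono[OF vec.span_superset])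
  show "perp f U S \<subseteq> perp f U (vec.span S)"
  proof
    fix y assume y: "y \<in> perp f U S"
    then have yU: "y \<in> U" by (simp add: perp_def)
    have "vec.span S \<subseteq> {x \<in> U. f y x = 0}"
      by (rule vec.span_minimal[OF _ subspace_ortho[OF yU]])
        (use y assms sym[OF yU] in \<open>auto simp: perp_def\<close>)
    then show "y \<in> perp f U (vec.span S)" using yU sym[OF yU] by (auto simp: perp_def)
  qed
qed

lemma perp_U: "perp f U U = {0}"
proof
  show "perp f U U \<subseteq> {0}" using nondeg by (auto simp: perp_def)
  show "{0} \<subseteq> perp f U U" using vec.subspace_0[OF subspace_perp[of U]] by simp
qed

lemma perp_0: "perp f U {0} = U"
proof -
  have "f 0 y = 0" if "y \<in> U" for y
    using scale_right[OF that, of 0 0] sym[OF that, of 0] vec.subspace_0[OF U] by simp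
  then show ?thesis by (auto simp: perp_def)
qed

lemma dim_perp_Un:
  assumes "finite T" "S \<subseteq> U" "T \<subseteq> U"
  shows "vec.dim (perp f U S) \<le> vec.dim (perp f U (S \<union> T)) + card T"
  using assms(1,3)
proof (induction T rule: finite_induct)
  case (insert x T)
  have "vec.dim (perp f U (S \<union> T)) \<le> vec.dim {v \<in> perp f U (S \<union> T). f x v = 0} + 1"
    by (rule dim_hyperplane(2)[OF subspace_perp])
      (use insert.prems assms(2) perp_subset in \<open>auto intro!: add_right scale_right\<close>)
  then show ?case using insert by (simp add: perp_insert)
qed simp

text \<open>A basis of \<open>X\<close> imposes \<open>vec.dim X\<close> equations on
  \<open>U\<close>, and the further vectors of a basis of \<open>U\<close> cut
  \<open>perp f U X\<close> down to zero; these give the two inequalities.\<close>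

lemma dim_perp:
  assumes X: "vec.subspace X" "X \<subseteq> U"
  shows "vec.dim (perp f U X) + vec.dim X = vec.dim U"
proof -
  obtain B where B: "B \<subseteq> X" "vec.independent B" "X \<subseteq> vec.span B" "card B = vec.dim X"
    by (rule vec.basis_exists)
  obtain C where C: "B \<subseteq> C" "C \<subseteq> U" "vec.independent C" "U \<subseteq> vec.span C"
    by (rule vec.maximal_independent_subset_extend[of B U]) (use B X in auto)
  have fin: "finite B" "finite C" using B(2) C(3) vec.finiteI_independent by auto
  have cC: "card C = vec.dim U" by (rule vec.basis_card_eq_dim[OF C(2,4,3)])
  have "vec.span B = X" using B X(1) by (metis subset_antisym vec.span_minimal)
  then have PB: "perp f U B = perp f U X" using perp_span[of B] B(1) X(2) by auto
  have "vec.span C = U" using C U by (metis subset_antisym vec.span_minimal)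
  then have PC: "perp f U C = {0}" using perp_span[OF C(2)] perp_U by simp
  have "vec.dim U \<le> vec.dim (perp f U X) + vec.dim X"
    using dim_perp_Un[OF fin(1), of "{}"] B X(2) PB by (auto simp: perp_def[of _ _ "{}"])
  moreover have "vec.dim (perp f U X) \<le> card (C - B)"
  proof -
    have "B \<union> (C - B) = C" "B \<subseteq> U" "C - B \<subseteq> U" using B(1) X(2) C(1,2) by auto
    then show ?thesis using dim_perp_Un[of "C - B" B] fin PB PC by simp
  qed
  moreover have "card (C - B) = vec.dim U - vec.dim X"
    using card_Diff_subset[OF fin(1) C(1)] cC B(4) by simp
  moreover have "vec.dim X \<le> vec.dim U" by (rule vec.dim_subset[OF X(2)])
  ultimately show ?thesis by simp
qed

lemma perp_perp:
  assumes X: "vec.subspace X" "X \<subseteq> U"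
  shows "perp f U (perp f U X) = X"
proof -
  have sub: "X \<subseteq> perp f U (perp f U X)"
    using X(2) sym by (auto simp: perp_def)
  have "X = perp f U (perp f U X)"
  proof (rule vec.subspace_dim_equal[OF X(1) subspace_perp[OF perp_subset] sub])
    show "vec.dim (perp f U (perp f U X)) \<le> vec.dim X"
      using dim_perp[OF X] dim_perp[OF subspace_perp[OF X(2)] perp_subset] by simp
  qed
  then show ?thesis ..
qed

lemma perp_subspace_sum:
  assumes X: "vec.subspace X" "X \<subseteq> U" and Y: "vec.subspace Y" "Y \<subseteq> U"
  shows "perp f U (subspace_sum X Y) = perp f U X \<inter> perp f U Y"
proof -
  have "subspace_sum X Y = vec.span (X \<union> Y)"
    unfolding span_Un_eq_subspace_sum using X Y by (simp add: span_subspace_eq)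
  then show ?thesis using perp_span[of "X \<union> Y"] X Y by (auto simp: perp_def)
qed

lemma perp_Int:
  assumes X: "vec.subspace X" "X \<subseteq> U" and Y: "vec.subspace Y" "Y \<subseteq> U"
  shows "perp f U (X \<inter> Y) = subspace_sum (perp f U X) (perp f U Y)"
proof -
  let ?S = "subspace_sum (perp f U X) (perp f U Y)"
  have S: "vec.subspace ?S" "?S \<subseteq> U"
    by (intro subspace_subspace_sum subspace_perp X Y) (intro subspace_sum_least perp_subset U)
  have "perp f U ?S = X \<inter> Y"
    using perp_subspace_sum[OF subspace_perp[OF X(2)] perp_subset subspace_perp[OF Y(2)] perp_subset]
    by (simp add: perp_perp X Y)
  then show ?thesis using perp_perp[OF S] by simp
qed

end

lemma inner_space_basis_dot:
  assumes "vec.independent b" "vec.span b = U"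
  shows "inner_space (basis_dot b) U"
proof
  show "vec.subspace U" using assms(2) vec.subspace_span by blast
  have fin: "finite b" by (rule vec.finiteI_independent[OF assms(1)])
  fix x y z :: "'a ^ 'b" and c :: 'a
  show "basis_dot b x (y + z) = basis_dot b x y + basis_dot b x z" if "x \<in> U" "y \<in> U" "z \<in> U"
    using that assms(2) by (simp add: basis_dot_def vec.representation_add[OF assms(1)] algebra_simps sum.distrib)
  show "basis_dot b x (c *s y) = c * basis_dot b x y" if "x \<in> U" "y \<in> U"
    using that assms(2) by (simp add: basis_dot_def vec.representation_scale[OF assms(1)] sum_distrib_left ac_simps)
  show "basis_dot b x y = basis_dot b y x"
    by (simp add: basis_dot_def mult.commute)
  show "y = 0" if y: "y \<in> U" "\<And>x. x \<in> U \<Longrightarrow> basis_dot b x y = 0"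
  proof -
    have "vec.representation b y v = 0" if v: "v \<in> b" for v
    proof -
      have "basis_dot b v y = (\<Sum>w\<in>b. if w = v then vec.representation b y w else 0)"
        unfolding basis_dot_def using v
        by (intro sum.cong) (auto simp: vec.representation_basis[OF assms(1)])
      then have "basis_dot b v y = vec.representation b y v" using v fin by simp
      then show ?thesis using y(2)[of v] v assms(2) vec.span_base by auto
    qed
    then have "(\<Sum>v\<in>b. vec.representation b y v *s v) = 0" by simp
    then show "y = 0"
      using vec.sum_representation_eq[OF assms(1) _ fin subset_refl, of y] y(1) assms(2) by simp
  qed
qed

lemma inner_space_std_dot: "inner_space (std_dot :: 'a::field ^ 'n \<Rightarrow> _) UNIV"
proof
  fix x y z :: "'a ^ 'n" and c :: 'a
  show "std_dot x (y + z) = std_dot x y + std_dot x z"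
    by (simp add: std_dot_def algebra_simps sum.distrib)
  show "std_dot x (c *s y) = c * std_dot x y"
    by (simp add: std_dot_def sum_distrib_left ac_simps)
  show "std_dot x y = std_dot y x"
    by (simp add: std_dot_def mult.commute)
  show "y = 0" if "\<And>x. x \<in> UNIV \<Longrightarrow> std_dot x y = 0"
  proof -
    have "y $ i = 0" for i
    proof -
      have "std_dot (axis i 1) y = (\<Sum>j\<in>UNIV. if j = i then y $ j else 0)"
        unfolding std_dot_def by (intro sum.cong) (auto simp: axis_def)
      then show ?thesis using that[of "axis i 1"] by simp
    qed
    then show ?thesis by (simp add: vec_eq_iff)
  qed
qed simp

section \<open>Alternating sums over supersets\<close>

text \<open>A Moebius transform over supersets rather than subsets, since dual nullities are read
  from the span of the complementary points.\<close>

definition superset_sum :: "'e set \<Rightarrow> ('e set \<Rightarrow> 'r::comm_ring_1) \<Rightarrow> 'e set \<Rightarrow> 'r" where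
  "superset_sum E F A = (\<Sum>\<tau> | A \<subseteq> \<tau> \<and> \<tau> \<subseteq> E. (-1) ^ (card \<tau> + card A) * F \<tau>)"

lemma sum_toggle_eq_0:
  fixes G :: "'e set \<Rightarrow> 'r::comm_ring_1"
  assumes "finite E" "x \<in> E" "x \<notin> A"
    and "\<And>\<tau>. A \<subseteq> \<tau> \<Longrightarrow> \<tau> \<subseteq> E \<Longrightarrow> x \<notin> \<tau> \<Longrightarrow> G (insert x \<tau>) = - G \<tau>"
  shows "(\<Sum>\<tau> | A \<subseteq> \<tau> \<and> \<tau> \<subseteq> E. G \<tau>) = 0"
proof -
  let ?T = "{\<tau>. A \<subseteq> \<tau> \<and> \<tau> \<subseteq> E \<and> x \<notin> \<tau>}"
  have fin: "finite ?T" by (rule finite_subset[of _ "Pow E"]) (use assms in auto)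
  have split: "{\<tau>. A \<subseteq> \<tau> \<and> \<tau> \<subseteq> E} = ?T \<union> insert x ` ?T"
  proof (intro equalityI subsetI)
    fix \<tau> assume t: "\<tau> \<in> {\<tau>. A \<subseteq> \<tau> \<and> \<tau> \<subseteq> E}"
    show "\<tau> \<in> ?T \<union> insert x ` ?T"
    proof (cases "x \<in> \<tau>")
      case True
      then have "\<tau> = insert x (\<tau> - {x})" "\<tau> - {x} \<in> ?T" using t assms(3) by auto
      then show ?thesis by blast
    qed (use t in auto)
  qed (use assms in auto)
  have inj: "inj_on (insert x) ?T" by (auto simp: inj_on_def)
  have "(\<Sum>\<tau> | A \<subseteq> \<tau> \<and> \<tau> \<subseteq> E. G \<tau>) = sum G ?T + sum G (insert x ` ?T)"
    unfolding split by (rule sum.union_disjoint) (use fin in auto)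
  also have "sum G (insert x ` ?T) = (\<Sum>\<tau>\<in>?T. - G \<tau>)"
    unfolding sum.reindex[OF inj] by (rule sum.cong) (use assms(4) in auto)
  finally show ?thesis by (simp add: sum_negf)
qed

lemma superset_sum_eq_0:
  assumes "finite E" "x \<in> E" "x \<notin> A"
    and "\<And>\<tau>. A \<subseteq> \<tau> \<Longrightarrow> \<tau> \<subseteq> E \<Longrightarrow> x \<notin> \<tau> \<Longrightarrow> F (insert x \<tau>) = F \<tau>"
  shows "superset_sum E F A = 0"
  unfolding superset_sum_def
proof (rule sum_toggle_eq_0[OF assms(1-3)])
  fix \<tau> assume t: "A \<subseteq> \<tau>" "\<tau> \<subseteq> E" "x \<notin> \<tau>"
  then have "finite \<tau>" using assms(1) finite_subset by metis
  then show "(-1) ^ (card (insert x \<tau>) + card A) * F (insert x \<tau>) = - ((-1) ^ (card \<tau> + card A) * F \<tau>)"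
    using t assms(4) by simp
qed

lemma sum_superset_sum:
  fixes F :: "'e set \<Rightarrow> 'r::comm_ring_1"
  assumes fin: "finite E" and A: "A \<subseteq> E"
  shows "(\<Sum>B | A \<subseteq> B \<and> B \<subseteq> E. superset_sum E F B) = F A"
proof -
  let ?S = "{B. A \<subseteq> B \<and> B \<subseteq> E}"
  have finS: "finite ?S" by (rule finite_subset[of _ "Pow E"]) (use fin in auto)
  have inner: "(\<Sum>B | A \<subseteq> B \<and> B \<subseteq> \<tau>. (-1) ^ (card \<tau> + card B) * F \<tau>) = (if \<tau> = A then F A else 0)"
    if t: "\<tau> \<in> ?S" for \<tau>
  proof (cases "\<tau> = A")
    case True
    then have "{B. A \<subseteq> B \<and> B \<subseteq> \<tau>} = {A}" by auto
    then show ?thesis using True by (simp flip: mult_2)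
  next
    case False
    then obtain x where x: "x \<in> \<tau>" "x \<notin> A" using t by auto
    have fint: "finite \<tau>" using t fin finite_subset by auto
    have "(\<Sum>B | A \<subseteq> B \<and> B \<subseteq> \<tau>. (-1) ^ (card \<tau> + card B) * F \<tau>) = 0"
    proof (rule sum_toggle_eq_0[OF fint x])
      fix B assume "A \<subseteq> B" "B \<subseteq> \<tau>" "x \<notin> B"
      then have "finite B" using fint finite_subset by metis
      then show "(-1) ^ (card \<tau> + card (insert x B)) * F \<tau> = - ((-1) ^ (card \<tau> + card B) * F \<tau>)"
        using \<open>x \<notin> B\<close> by simp
    qed
    then show ?thesis using False by simp
  qed
  have "(\<Sum>B\<in>?S. superset_sum E F B) =
      (\<Sum>B\<in>?S. \<Sum>\<tau>\<in>?S. if B \<subseteq> \<tau> then (-1) ^ (card \<tau> + card B) * F \<tau> else 0)"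
    unfolding superset_sum_def
  proof (rule sum.cong[OF refl])
    fix B assume B: "B \<in> ?S"
    have "{\<tau>. B \<subseteq> \<tau> \<and> \<tau> \<subseteq> E} = ?S \<inter> {\<tau>. B \<subseteq> \<tau>}" using B by auto
    then show "(\<Sum>\<tau> | B \<subseteq> \<tau> \<and> \<tau> \<subseteq> E. (-1) ^ (card \<tau> + card B) * F \<tau>) =
      (\<Sum>\<tau>\<in>?S. if B \<subseteq> \<tau> then (-1) ^ (card \<tau> + card B) * F \<tau> else 0)"
      using sum.inter_restrict[OF finS, of "\<lambda>\<tau>. (-1) ^ (card \<tau> + card B) * F \<tau>" "{\<tau>. B \<subseteq> \<tau>}"] by simp
  qed
  also have "\<dots> = (\<Sum>\<tau>\<in>?S. \<Sum>B\<in>?S. if B \<subseteq> \<tau> then (-1) ^ (card \<tau> + card B) * F \<tau> else 0)"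
    by (rule sum.swap)
  also have "\<dots> = (\<Sum>\<tau>\<in>?S. if \<tau> = A then F A else 0)"
  proof (rule sum.cong[OF refl])
    fix \<tau> assume t: "\<tau> \<in> ?S"
    have "{B. A \<subseteq> B \<and> B \<subseteq> \<tau>} = ?S \<inter> {B. B \<subseteq> \<tau>}" using t by auto
    then show "(\<Sum>B\<in>?S. if B \<subseteq> \<tau> then (-1) ^ (card \<tau> + card B) * F \<tau> else 0) = (if \<tau> = A then F A else 0)"
      using inner[OF t] sum.inter_restrict[OF finS, of "\<lambda>B. (-1) ^ (card \<tau> + card B) * F \<tau>" "{B. B \<subseteq> \<tau>}"]
      by simp
  qed
  also have "\<dots> = F A" using finS A by simp
  finally show ?thesis .
qed

section \<open>Points, flats and Moebius inversion on subspaces\<close>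

lemma span_singleton_point:
  assumes "x \<noteq> (0 :: 'a::field ^ 'n)"
  shows "vec.subspace (vec.span {x}) \<and> vec.dim (vec.span {x}) = 1"
  using assms by simp

lemma point_of_nonzero:
  assumes "vec.subspace U" "x \<in> U" "x \<noteq> (0 :: 'a::field ^ 'n)"
  shows "vec.span {x} \<in> points U"
proof -
  have "vec.span {x} \<subseteq> U" by (rule vec.span_minimal) (use assms in auto)
  then show ?thesis using span_singleton_point[OF assms(3)] by (simp add: points_def)
qed

lemma span_points:
  assumes "vec.subspace (U :: ('a::field ^ 'n) set)"
  shows "vec.span (\<Union>(points U)) = U"
proof
  show "vec.span (\<Union>(points U)) \<subseteq> U"
    by (rule vec.span_minimal[OF _ assms]) (auto simp: points_def)
  show "U \<subseteq> vec.span (\<Union>(points U))"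
  proof
    fix x assume x: "x \<in> U"
    show "x \<in> vec.span (\<Union>(points U))"
    proof (cases "x = 0")
      case True
      then show ?thesis using vec.span_zero by simp
    next
      case False
      have "x \<in> vec.span {x}" by (rule vec.span_base) simp
      then have "x \<in> \<Union>(points U)" using point_of_nonzero[OF assms x False] by blast
      then show ?thesis by (rule vec.span_base)
    qed
  qed
qed

lemma points_mono: "U \<subseteq> V \<Longrightarrow> points U \<subseteq> points V"
  by (auto simp: points_def)

lemma span_Union_subset:
  "\<tau> \<subseteq> points U \<Longrightarrow> vec.subspace U \<Longrightarrow> vec.span (\<Union>\<tau>) \<subseteq> U"
  by (rule vec.span_minimal) (auto simp: points_def)

lemma subset_points_span: "\<tau> \<subseteq> points U \<Longrightarrow> \<tau> \<subseteq> points (vec.span (\<Union>\<tau>))"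
  unfolding points_def using vec.span_superset[of "\<Union>\<tau>"] by blast

lemma points_0: "points {0 :: 'a::field ^ 'n} = {}"
proof (rule equals0I)
  fix L :: "('a ^ 'n) set" assume "L \<in> points {0}"
  then have "L \<subseteq> {0}" "vec.dim L = 1" by (simp_all add: points_def)
  then show False using vec.dim_eq_0[of L] by simp
qed

definition span_superset_sum :: "(('a::field ^ 'n) set \<Rightarrow> 'r::comm_ring_1) \<Rightarrow> ('a ^ 'n) set \<Rightarrow> ('a ^ 'n) set set \<Rightarrow> 'r" where
  "span_superset_sum h U = superset_sum (points U) (\<lambda>\<tau>. h (vec.span (\<Union>\<tau>)))"

lemma span_superset_sum_nonflat:
  fixes U :: "('a::{field,finite} ^ 'n) set"
  assumes "A \<subseteq> points U" "L \<in> points U" "L \<notin> A" "L \<subseteq> vec.span (\<Union>A)"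
  shows "span_superset_sum h U A = 0"
  unfolding span_superset_sum_def
proof (rule superset_sum_eq_0[OF _ assms(2,3)])
  fix \<tau> assume "A \<subseteq> \<tau>"
  then have "L \<subseteq> vec.span (\<Union>\<tau>)" using assms(4) vec.span_mono[of "\<Union>A" "\<Union>\<tau>"] by blast
  then have "vec.span (L \<union> \<Union>\<tau>) \<subseteq> vec.span (\<Union>\<tau>)"
    using vec.span_superset[of "\<Union>\<tau>"] by (intro vec.span_minimal) auto
  moreover have "vec.span (\<Union>\<tau>) \<subseteq> vec.span (L \<union> \<Union>\<tau>)" by (rule vec.span_mono) auto
  ultimately have "vec.span (\<Union>(insert L \<tau>)) = vec.span (\<Union>\<tau>)" by simp
  then show "h (vec.span (\<Union>(insert L \<tau>))) = h (vec.span (\<Union>\<tau>))" by simp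
qed simp

lemma span_superset_sum_flat:
  fixes U :: "('a::{field,finite} ^ 'n) set"
  assumes "A \<subseteq> points U" "vec.subspace U" "span_superset_sum h U A \<noteq> 0"
  shows "A = points (vec.span (\<Union>A))"
proof
  show "A \<subseteq> points (vec.span (\<Union>A))" by (rule subset_points_span[OF assms(1)])
  show "points (vec.span (\<Union>A)) \<subseteq> A"
  proof (rule ccontr)
    assume "\<not> points (vec.span (\<Union>A)) \<subseteq> A"
    then obtain L where L: "L \<in> points (vec.span (\<Union>A))" "L \<notin> A" by auto
    then have "L \<in> points U" using points_mono[OF span_Union_subset[OF assms(1,2)]] by auto
    moreover have "L \<subseteq> vec.span (\<Union>A)" using L(1) by (simp add: points_def)
    ultimately show False using span_superset_sum_nonflat[OF assms(1)] L(2) assms(3) by metis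
  qed
qed

lemma inj_on_points: "inj_on points {X :: ('a::field ^ 'n) set. vec.subspace X}"
  by (rule inj_on_inverseI[of _ "\<lambda>S. vec.span (\<Union>S)"]) (simp add: span_points)

text \<open>Moebius inversion over sets of points collapses to subspaces, because only point sets of
  subspaces contribute. So \<open>X \<mapsto> span_superset_sum h U (points X)\<close> is the
  Moebius inverse of \<open>h\<close> on the subspace lattice.\<close>

lemma sum_span_superset_sum:
  fixes h :: "('a::{field,finite} ^ 'n) set \<Rightarrow> 'r::comm_ring_1"
  assumes U: "vec.subspace U" and Y: "vec.subspace Y" "Y \<subseteq> U"
  shows "(\<Sum>X | vec.subspace X \<and> Y \<subseteq> X \<and> X \<subseteq> U. span_superset_sum h U (points X)) = h Y"
proof -
  let ?S = "{X. vec.subspace X \<and> Y \<subseteq> X \<and> X \<subseteq> U}"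
  have "h Y = h (vec.span (\<Union>(points Y)))" by (simp add: span_points[OF Y(1)])
  also have "\<dots> = (\<Sum>B | points Y \<subseteq> B \<and> B \<subseteq> points U. span_superset_sum h U B)"
    unfolding span_superset_sum_def
    by (rule sum_superset_sum[symmetric]) (use points_mono[OF Y(2)] in auto)
  also have "\<dots> = (\<Sum>B\<in>points ` ?S. span_superset_sum h U B)"
  proof (rule sum.mono_neutral_right)
    show "points ` ?S \<subseteq> {B. points Y \<subseteq> B \<and> B \<subseteq> points U}"
      using points_mono by blast
    show "\<forall>B\<in>{B. points Y \<subseteq> B \<and> B \<subseteq> points U} - points ` ?S. span_superset_sum h U B = 0"
    proof (rule ballI, rule ccontr)
      fix B assume B: "B \<in> {B. points Y \<subseteq> B \<and> B \<subseteq> points U} - points ` ?S"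
        and nz: "span_superset_sum h U B \<noteq> 0"
      have eq: "B = points (vec.span (\<Union>B))" by (rule span_superset_sum_flat[OF _ U nz]) (use B in auto)
      have "vec.span (\<Union>(points Y)) \<subseteq> vec.span (\<Union>B)" by (rule vec.span_mono) (use B in auto)
      then have "Y \<subseteq> vec.span (\<Union>B)" by (simp add: span_points[OF Y(1)])
      moreover have "vec.span (\<Union>B) \<subseteq> U" by (rule span_Union_subset[OF _ U]) (use B in auto)
      ultimately have "vec.span (\<Union>B) \<in> ?S" by simp
      then have "B \<in> points ` ?S" using eq by blast
      then show False using B by blast
    qed
  qed simp
  also have "\<dots> = (\<Sum>X\<in>?S. span_superset_sum h U (points X))"
    by (subst sum.reindex) (auto intro: inj_on_subset[OF inj_on_points])
  finally show ?thesis ..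
qed

text \<open>Taking \<open>perp\<close> turns the subspaces above \<open>perp f U V\<close> into
  those below \<open>V\<close>, the form in which \<open>subspace_moebius_unique\<close> compares
  functions.\<close>

lemma sum_span_superset_sum_perp:
  fixes h :: "('a::{field,finite} ^ 'n) set \<Rightarrow> 'r::comm_ring_1"
  assumes "inner_space f U" and V: "vec.subspace V" "V \<subseteq> U"
  shows "(\<Sum>X | vec.subspace X \<and> X \<subseteq> V. span_superset_sum h U (points (perp f U X))) = h (perp f U V)"
proof -
  interpret inner_space f U by fact
  let ?g = "\<lambda>X. span_superset_sum h U (points X)"
  have "(\<Sum>X | vec.subspace X \<and> X \<subseteq> V. ?g (perp f U X)) =
    (\<Sum>Y | vec.subspace Y \<and> perp f U V \<subseteq> Y \<and> Y \<subseteq> U. ?g Y)"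
  proof (rule sum.reindex_bij_witness[of _ "perp f U" "perp f U"])
    fix X assume "X \<in> {X. vec.subspace X \<and> X \<subseteq> V}"
    then have X: "vec.subspace X" "X \<subseteq> V" "X \<subseteq> U" using V(2) by auto
    show "perp f U (perp f U X) = X" by (rule perp_perp[OF X(1,3)])
    show "perp f U X \<in> {Y. vec.subspace Y \<and> perp f U V \<subseteq> Y \<and> Y \<subseteq> U}"
      using subspace_perp[OF X(3)] perp_antimono[OF X(2)] perp_subset by simp
  next
    fix Y assume "Y \<in> {Y. vec.subspace Y \<and> perp f U V \<subseteq> Y \<and> Y \<subseteq> U}"
    then have Y: "vec.subspace Y" "perp f U V \<subseteq> Y" "Y \<subseteq> U" by auto
    show "perp f U (perp f U Y) = Y" by (rule perp_perp[OF Y(1,3)])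
    show "perp f U Y \<in> {X. vec.subspace X \<and> X \<subseteq> V}"
      using subspace_perp[OF Y(3)] perp_antimono[OF Y(2)] perp_perp[OF V] by simp
  qed simp
  also have "\<dots> = h (perp f U V)"
    by (rule sum_span_superset_sum[OF U subspace_perp[OF V(2)] perp_subset])
  finally show ?thesis .
qed

text \<open>By induction the terms for proper subspaces agree, so equal sums leave equal terms at
  \<open>V\<close>. Two functions are compared this way without an explicit Moebius function of the
  lattice.\<close>

lemma subspace_moebius_unique:
  fixes a b :: "('a::{field,finite} ^ 'n) set \<Rightarrow> 'r::ab_group_add"
  assumes "\<And>V. vec.subspace V \<Longrightarrow> V \<subseteq> U \<Longrightarrow>
      (\<Sum>X | vec.subspace X \<and> X \<subseteq> V. a X) = (\<Sum>X | vec.subspace X \<and> X \<subseteq> V. b X)"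
  shows "vec.subspace V \<Longrightarrow> V \<subseteq> U \<Longrightarrow> a V = b V"
proof (induction "card V" arbitrary: V rule: less_induct)
  case less
  let ?S = "{X. vec.subspace X \<and> X \<subseteq> V}"
  have V: "V \<in> ?S" using less.prems by simp
  have "a X = b X" if "X \<in> ?S - {V}" for X
  proof (rule less.hyps)
    show "card X < card V" by (rule psubset_card_mono) (use that in auto)
  qed (use that less.prems in auto)
  then have "sum a (?S - {V}) = sum b (?S - {V})" by (intro sum.cong) auto
  moreover have "sum a ?S = sum b ?S" by (rule assms[OF less.prems])
  moreover have "sum a ?S = a V + sum a (?S - {V})" "sum b ?S = b V + sum b (?S - {V})"
    using V by (simp_all add: sum.remove)
  ultimately show ?case by simp
qed

section \<open>Counting vectors and points\<close>

lemma card_span_independent: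
  fixes B :: "('a::{field,finite} ^ 'n) set"
  assumes "vec.independent B"
  shows "card (vec.span B) = CARD('a) ^ card B"
proof -
  have "finite B" by simp
  then show ?thesis using assms
  proof (induction B rule: finite_induct)
    case (insert x B)
    have B: "vec.independent B" "x \<notin> vec.span B"
      using insert.prems insert.hyps(2) by (auto simp: vec.independent_insert split: if_splits)
    let ?g = "\<lambda>(a, y). a *s x + y"
    have inj: "inj_on ?g (UNIV \<times> vec.span B)"
    proof (rule inj_onI, clarify)
      fix a y a' y' assume y: "y \<in> vec.span B" "y' \<in> vec.span B" and eq: "a *s x + y = a' *s x + y'"
      have "(a - a') *s x = y' - y" using eq by (simp add: vec.scale_left_diff_distrib algebra_simps)
      then have in_span: "(a - a') *s x \<in> vec.span B" using y by (simp add: vec.span_diff)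
      have "a = a'"
      proof (rule ccontr)
        assume "a \<noteq> a'"
        then have "x \<in> vec.span B" using vec.span_scale[OF in_span, of "inverse (a - a')"] by simp
        then show False using B(2) by simp
      qed
      then show "a = a' \<and> y = y'" using eq by simp
    qed
    have "vec.span (insert x B) = ?g ` (UNIV \<times> vec.span B)"
    proof (intro equalityI subsetI)
      fix z assume "z \<in> vec.span (insert x B)"
      then obtain k where "z - k *s x \<in> vec.span B" using vec.span_breakdown_eq by blast
      then show "z \<in> ?g ` (UNIV \<times> vec.span B)" by (intro image_eqI[of _ _ "(k, z - k *s x)"]) auto
    next
      fix z assume "z \<in> ?g ` (UNIV \<times> vec.span B)"
      then obtain a y where "z = a *s x + y" "y \<in> vec.span B" by auto
      moreover have "vec.span B \<subseteq> vec.span (insert x B)" by (rule vec.span_mono) auto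
      moreover have "a *s x \<in> vec.span (insert x B)"
        by (intro vec.span_scale vec.span_base) simp
      ultimately show "z \<in> vec.span (insert x B)"
        by (auto intro: vec.span_add)
    qed
    then have "card (vec.span (insert x B)) = CARD('a) * card (vec.span B)"
      using inj by (simp add: card_image card_cartesian_product)
    then show ?case using insert B(1) by simp
  qed simp
qed

lemma card_subspace:
  fixes V :: "('a::{field,finite} ^ 'n) set"
  assumes "vec.subspace V"
  shows "card V = CARD('a) ^ vec.dim V"
proof -
  obtain B where B: "B \<subseteq> V" "vec.independent B" "V \<subseteq> vec.span B" "card B = vec.dim V"
    by (rule vec.basis_exists)
  then have "vec.span B = V" using assms by (metis subset_antisym vec.span_minimal)
  then show ?thesis using card_span_independent[OF B(2)] B(4) by simp
qed

text \<open>Each nonzero vector lies on exactly one point, and each point carries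
  \<open>CARD('a) - 1\<close> of them. The product form avoids a quotient.\<close>

lemma card_points:
  fixes U :: "('a::{field,finite} ^ 'n) set"
  assumes "vec.subspace U"
  shows "card (points U) * (CARD('a) - 1) + 1 = CARD('a) ^ vec.dim U"
proof -
  have L: "L = vec.span {x}" if "L \<in> points U" "x \<in> L" "x \<noteq> 0" for L x
  proof -
    have "vec.span {x} = L"
      by (rule vec.subspace_dim_equal) (use that in \<open>auto simp: points_def intro: vec.span_minimal[THEN subsetD]\<close>)
    then show ?thesis ..
  qed
  have "U - {0} = (\<Union>L\<in>points U. L - {0})"
  proof (intro equalityI subsetI)
    fix x assume "x \<in> U - {0}"
    then have "vec.span {x} \<in> points U" using point_of_nonzero[OF assms] by auto
    moreover have "x \<in> vec.span {x} - {0}" using \<open>x \<in> U - {0}\<close> by (auto intro: vec.span_base)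
    ultimately show "x \<in> (\<Union>L\<in>points U. L - {0})" by blast
  qed (auto simp: points_def)
  moreover have "card (\<Union>L\<in>points U. L - {0}) = (\<Sum>L\<in>points U. card (L - {0}))"
    by (rule card_UN_disjoint) (auto dest: L)
  moreover have "card (L - {0}) = CARD('a) - 1" if "L \<in> points U" for L
    using that card_subspace[of L] vec.subspace_0[of L] by (simp add: points_def)
  ultimately have "card (U - {0}) = card (points U) * (CARD('a) - 1)" by simp
  moreover have "card (U - {0}) = CARD('a) ^ vec.dim U - 1"
    using card_subspace[OF assms] vec.subspace_0[OF assms] by simp
  moreover have "CARD('a) ^ vec.dim U \<ge> 1" by simp
  ultimately show ?thesis by (metis le_add_diff_inverse2)
qed

section \<open>Weight polynomials of q-matroids\<close>

lemma q_matroidD: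
  assumes "q_matroid U \<rho>"
  shows "vec.subspace U"
    and "vec.subspace X \<Longrightarrow> X \<subseteq> U \<Longrightarrow> \<rho> X \<le> vec.dim X"
    and "vec.subspace X \<Longrightarrow> vec.subspace Y \<Longrightarrow> X \<subseteq> Y \<Longrightarrow> Y \<subseteq> U \<Longrightarrow> \<rho> X \<le> \<rho> Y"
    and "vec.subspace X \<Longrightarrow> X \<subseteq> U \<Longrightarrow> vec.subspace Y \<Longrightarrow> Y \<subseteq> U \<Longrightarrow>
      \<rho> (subspace_sum X Y) + \<rho> (X \<inter> Y) \<le> \<rho> X + \<rho> Y"
  using assms unfolding q_matroid_def subspace_sum_def by simp_all

text \<open>Submodularity with a linear complement of \<open>X\<close> in \<open>Y\<close>, whose
  rank is at most its dimension. Sums on both sides keep truncated subtraction out.\<close>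

lemma q_matroid_rank_growth:
  assumes M: "q_matroid U \<rho>" and X: "vec.subspace X" and Y: "vec.subspace Y" "Y \<subseteq> U" and "X \<subseteq> Y"
  shows "\<rho> Y + vec.dim X \<le> \<rho> X + vec.dim Y"
proof -
  obtain B where B: "B \<subseteq> X" "vec.independent B" "X \<subseteq> vec.span B" "card B = vec.dim X"
    by (rule vec.basis_exists)
  obtain C where C: "B \<subseteq> C" "C \<subseteq> Y" "vec.independent C" "Y \<subseteq> vec.span C"
    by (rule vec.maximal_independent_subset_extend[of B Y]) (use B assms(5) in auto)
  have fin: "finite B" using B(2) vec.finiteI_independent by auto
  have cC: "card C = vec.dim Y" by (rule vec.basis_card_eq_dim[OF C(2,4,3)])
  let ?Z = "vec.span (C - B)"
  have Z: "vec.subspace ?Z" "?Z \<subseteq> Y"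
    by (rule vec.subspace_span) (rule vec.span_minimal[OF _ Y(1)], use C(2) in auto)
  have "vec.span B = X" using B X by (metis subset_antisym vec.span_minimal)
  moreover have "vec.span C = Y" using C Y(1) by (metis subset_antisym vec.span_minimal)
  moreover have "B \<union> (C - B) = C" using C(1) by auto
  ultimately have "subspace_sum X ?Z = Y" using span_Un_eq_subspace_sum[of B "C - B"] by simp
  then have "\<rho> Y \<le> \<rho> X + \<rho> ?Z"
    using q_matroidD(4)[OF M X _ Z(1)] assms(5) Y(2) Z(2) by force
  moreover have "\<rho> ?Z \<le> vec.dim ?Z" using q_matroidD(2)[OF M Z(1)] Z(2) Y(2) by auto
  moreover have "vec.dim ?Z = card (C - B)"
    by (rule vec.dim_span_eq_card_independent) (use C(3) vec.independent_mono in blast)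
  moreover have "card (C - B) + vec.dim X = vec.dim Y"
    using card_Diff_subset[OF fin C(1)] cC B(4) vec.dim_subset[OF assms(5)] by simp
  ultimately show ?thesis by simp
qed

section \<open>The dual of the classical matroid and its elongations\<close>

text \<open>The nullity of \<open>mdual (Cl U \<rho>)\<close> after \<open>card \<gamma>\<close> has
  cancelled. In this form it visibly depends on a span only and never exceeds
  \<open>\<rho> U\<close>.\<close>

definition point_nullity :: "('a::field ^ 'n) set \<Rightarrow> (('a ^ 'n) set \<Rightarrow> nat) \<Rightarrow> ('a ^ 'n) set set \<Rightarrow> nat" where
  "point_nullity U \<rho> \<gamma> = \<rho> U - \<rho> (vec.span (\<Union>(points U - \<gamma>)))"

lemma span_Union_mono: "\<sigma> \<subseteq> \<tau> \<Longrightarrow> vec.span (\<Union>\<sigma>) \<subseteq> vec.span (\<Union>\<tau>)"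
  by (rule vec.span_mono) auto

lemma span_Union_insert:
  assumes "a \<in> points U"
  shows "vec.span (\<Union>(insert a \<tau>)) = subspace_sum a (vec.span (\<Union>\<tau>))"
proof -
  have a: "vec.span a = a" by (rule span_subspace_eq) (use assms in \<open>simp add: points_def\<close>)
  show ?thesis using span_Un_eq_subspace_sum[of a "\<Union>\<tau>"] unfolding a Union_insert .
qed

context
  fixes U :: "('a::{field,finite} ^ 'n) set" and \<rho> :: "('a ^ 'n) set \<Rightarrow> nat"
  assumes M: "q_matroid U \<rho>"
begin

lemma span_rank_mono:
  assumes "\<sigma> \<subseteq> \<tau>" "\<tau> \<subseteq> points U"
  shows "\<rho> (vec.span (\<Union>\<sigma>)) \<le> \<rho> (vec.span (\<Union>\<tau>))"
  by (rule q_matroidD(3)[OF M vec.subspace_span vec.subspace_span span_Union_mono[OF assms(1)]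
      span_Union_subset[OF assms(2) q_matroidD(1)[OF M]]])

lemma span_rank_le: "\<tau> \<subseteq> points U \<Longrightarrow> \<rho> (vec.span (\<Union>\<tau>)) \<le> \<rho> U"
  using span_rank_mono[of \<tau> "points U"] span_points[OF q_matroidD(1)[OF M]] by simp

lemma span_rank_insert:
  assumes "\<tau> \<subseteq> points U" "a \<in> points U"
  shows "\<rho> (vec.span (\<Union>(insert a \<tau>))) \<le> \<rho> (vec.span (\<Union>\<tau>)) + 1"
proof -
  have a: "vec.subspace a" "a \<subseteq> U" "\<rho> a \<le> 1"
    using assms(2) q_matroidD(2)[OF M, of a] by (auto simp: points_def)
  show ?thesis
    using q_matroidD(4)[OF M a(1,2), of "vec.span (\<Union>\<tau>)"] a(3)
      span_Union_subset[OF assms(1) q_matroidD(1)[OF M]]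
    unfolding span_Union_insert[OF assms(2)] by simp
qed

text \<open>Submodularity for the spans of \<open>\<sigma>\<close> and of
  \<open>insert a \<tau>\<close>: their sum is the span of \<open>insert a \<sigma>\<close>, and
  their intersection contains the span of \<open>\<tau>\<close>.\<close>

lemma span_rank_diminishing:
  assumes "\<tau> \<subseteq> \<sigma>" "\<sigma> \<subseteq> points U" "a \<in> points U"
  shows "\<rho> (vec.span (\<Union>(insert a \<sigma>))) + \<rho> (vec.span (\<Union>\<tau>)) \<le>
    \<rho> (vec.span (\<Union>\<sigma>)) + \<rho> (vec.span (\<Union>(insert a \<tau>)))"
proof -
  let ?X = "vec.span (\<Union>\<sigma>)" and ?Y = "vec.span (\<Union>(insert a \<tau>))"
  have sub: "?X \<subseteq> U" "?Y \<subseteq> U"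
    by (rule span_Union_subset[OF _ q_matroidD(1)[OF M]]; use assms in auto)+
  have "\<Union>(insert a \<sigma>) = \<Union>\<sigma> \<union> \<Union>(insert a \<tau>)" using assms(1) by auto
  then have "vec.span (\<Union>(insert a \<sigma>)) = subspace_sum ?X ?Y"
    by (simp only: span_Un_eq_subspace_sum)
  moreover have "\<rho> (vec.span (\<Union>\<tau>)) \<le> \<rho> (?X \<inter> ?Y)"
  proof (rule q_matroidD(3)[OF M])
    show "vec.span (\<Union>\<tau>) \<subseteq> ?X \<inter> ?Y"
      using span_Union_mono[OF assms(1)] span_Union_mono[of \<tau> "insert a \<tau>"] by auto
  qed (use sub in \<open>auto intro: vec.subspace_inter\<close>)
  ultimately show ?thesis
    using q_matroidD(4)[OF M _ sub(1) _ sub(2)] by simp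
qed

lemma matroid_nullity_point_nullity: "matroid_nullity (points U) (point_nullity U \<rho>)"
  unfolding matroid_nullity_def
proof (intro conjI allI impI ballI)
  show "point_nullity U \<rho> {} = 0"
    by (simp add: point_nullity_def span_points[OF q_matroidD(1)[OF M]])
next
  fix A a assume A: "A \<subseteq> points U" "a \<in> points U"
  show "point_nullity U \<rho> A \<le> point_nullity U \<rho> (insert a A)"
    unfolding point_nullity_def by (intro diff_le_mono2 span_rank_mono) auto
  have "\<rho> (vec.span (\<Union>(points U - A))) \<le> \<rho> (vec.span (\<Union>(insert a (points U - insert a A))))"
    by (rule span_rank_mono) (use A in auto)
  also have "\<dots> \<le> \<rho> (vec.span (\<Union>(points U - insert a A))) + 1"
    by (rule span_rank_insert) (use A in auto)
  finally show "point_nullity U \<rho> (insert a A) \<le> point_nullity U \<rho> A + 1"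
    unfolding point_nullity_def by simp
next
  fix B A a assume B: "B \<subseteq> points U" "A \<subseteq> B" "a \<in> points U - B"
    and less: "point_nullity U \<rho> A < point_nullity U \<rho> (insert a A)"
  let ?S = "points U - insert a A" and ?T = "points U - insert a B"
  have eq: "points U - A = insert a ?S" "points U - B = insert a ?T" using B by auto
  have "\<rho> (vec.span (\<Union>(insert a ?S))) + \<rho> (vec.span (\<Union>?T)) \<le>
    \<rho> (vec.span (\<Union>?S)) + \<rho> (vec.span (\<Union>(insert a ?T)))"
    by (rule span_rank_diminishing) (use B in auto)
  moreover have "\<rho> (vec.span (\<Union>?S)) < \<rho> (vec.span (\<Union>(insert a ?S)))"
    using less unfolding point_nullity_def eq by simp
  moreover have "\<rho> (vec.span (\<Union>(insert a ?T))) \<le> \<rho> U"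
    by (rule span_rank_le) (use B in auto)
  ultimately show "point_nullity U \<rho> B < point_nullity U \<rho> (insert a B)"
    unfolding point_nullity_def eq by simp
qed

text \<open>Removing one point lowers the rank of the span by at most one. This makes the
  subtraction in \<open>mdual\<close> genuine.\<close>

lemma rank_le_card_plus:
  assumes "\<gamma> \<subseteq> points U"
  shows "\<rho> U \<le> card \<gamma> + \<rho> (vec.span (\<Union>(points U - \<gamma>)))"
proof -
  have "finite \<gamma>" by simp
  then have "point_nullity U \<rho> \<gamma> \<le> card \<gamma>" using assms
  proof (induction \<gamma> rule: finite_induct)
    case empty
    then show ?case using matroid_nullity_point_nullity by (simp add: matroid_nullity_def)
  next
    case (insert a \<gamma>)
    have "point_nullity U \<rho> (insert a \<gamma>) \<le> point_nullity U \<rho> \<gamma> + 1"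
      using matroid_nullity_point_nullity insert.prems unfolding matroid_nullity_def by simp
    then show ?case using insert by simp
  qed
  then show ?thesis by (simp add: point_nullity_def)
qed

lemma ground_mdual_Cl: "ground (mdual (Cl U \<rho>)) = points U"
  by (simp add: mdual_def Cl_def)

lemma rnk_mdual_Cl:
  "rnk (mdual (Cl U \<rho>)) \<gamma> = card \<gamma> + \<rho> (vec.span (\<Union>(points U - \<gamma>))) - \<rho> U"
  by (simp add: mdual_def Cl_def span_points[OF q_matroidD(1)[OF M]])

lemma nullity_mdual_Cl:
  assumes "\<gamma> \<subseteq> points U"
  shows "nullity (mdual (Cl U \<rho>)) \<gamma> = \<rho> U - \<rho> (vec.span (\<Union>(points U - \<gamma>)))"
  unfolding nullity_def rnk_mdual_Cl
  using rank_le_card_plus[OF assms] span_rank_le[of "points U - \<gamma>"] by simp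

text \<open>Elongation by \<open>l\<close> lowers the nullity by \<open>l\<close>, stopping at zero,
  which the truncated subtraction expresses.\<close>

lemma dependent_elongation:
  assumes "\<sigma> \<subseteq> points U"
  shows "\<sigma> \<in> dependent_sets (elongation l (mdual (Cl U \<rho>))) \<longleftrightarrow> point_nullity U \<rho> \<sigma> - l \<noteq> 0"
  using assms rank_le_card_plus[OF assms] span_rank_le[of "points U - \<sigma>"]
  by (auto simp: dependent_sets_def elongation_def ground_mdual_Cl rnk_mdual_Cl point_nullity_def)

lemma matroid_nullity_elongation:
  "matroid_nullity (points U) (\<lambda>\<gamma>. point_nullity U \<rho> \<gamma> - l)"
  unfolding matroid_nullity_def
proof (intro conjI allI impI ballI)
  note N = matroid_nullity_point_nullity[unfolded matroid_nullity_def]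
  show "point_nullity U \<rho> {} - l = 0" using N by simp
  fix A a assume A: "A \<subseteq> points U" "a \<in> points U"
  have "point_nullity U \<rho> A \<le> point_nullity U \<rho> (insert a A) \<and>
      point_nullity U \<rho> (insert a A) \<le> point_nullity U \<rho> A + 1"
    using N A by simp
  then show "point_nullity U \<rho> A - l \<le> point_nullity U \<rho> (insert a A) - l"
    "point_nullity U \<rho> (insert a A) - l \<le> point_nullity U \<rho> A - l + 1" by auto
next
  note N = matroid_nullity_point_nullity[unfolded matroid_nullity_def]
  fix B A a assume B: "B \<subseteq> points U" "A \<subseteq> B" "a \<in> points U - B"
    and less: "point_nullity U \<rho> A - l < point_nullity U \<rho> (insert a A) - l"
  \<comment> \<open>A rise of the truncated nullity at \<open>A\<close> forces the nullity there to
    be at least \<open>l\<close>; then the same holds at \<open>B\<close>, where truncation no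
    longer interferes.\<close>
  have "point_nullity U \<rho> A \<le> point_nullity U \<rho> B"
    by (rule matroid_nullity_mono[OF matroid_nullity_point_nullity B(2,1)]) simp
  moreover have "point_nullity U \<rho> B < point_nullity U \<rho> (insert a B)"
    using N B less by simp
  moreover have "point_nullity U \<rho> (insert a A) \<le> point_nullity U \<rho> A + 1"
    using N B by auto
  ultimately show "point_nullity U \<rho> B - l < point_nullity U \<rho> (insert a B) - l"
    using less by simp
qed

text \<open>All nullities are at most \<open>\<rho> U\<close>, so the one range of \<open>i\<close>
  works for every \<open>l\<close> and every \<open>\<sigma>\<close>.\<close>

lemma alternating_betti_elongation:
  "(\<Sum>i\<le>\<rho> U. (-1) ^ i * int (betti TYPE('k::field) (elongation l (mdual (Cl U \<rho>))) i j)) =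
    (\<Sum>\<sigma> | \<sigma> \<subseteq> points U \<and> card \<sigma> = j. \<Sum>\<gamma>\<in>Pow \<sigma>.
      (-1) ^ (card \<sigma> + card \<gamma>) * (if point_nullity U \<rho> \<gamma> \<le> l then 1 else 0))"
proof -
  let ?M = "elongation l (mdual (Cl U \<rho>))"
  have g: "ground ?M = points U" by (simp add: elongation_def ground_mdual_Cl)
  have "(\<Sum>i\<le>\<rho> U. (-1) ^ i * int (betti TYPE('k) ?M i j)) =
    (\<Sum>i\<le>\<rho> U. \<Sum>\<sigma> | \<sigma> \<subseteq> points U \<and> card \<sigma> = j. (-1) ^ i * int (multigraded_betti TYPE('k) ?M i \<sigma>))"
    by (simp add: betti_def g sum_distrib_left)
  also have "\<dots> = (\<Sum>\<sigma> | \<sigma> \<subseteq> points U \<and> card \<sigma> = j.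
      \<Sum>i\<le>\<rho> U. (-1) ^ i * int (multigraded_betti TYPE('k) ?M i \<sigma>))"
    by (rule sum.swap)
  also have "\<dots> = (\<Sum>\<sigma> | \<sigma> \<subseteq> points U \<and> card \<sigma> = j. \<Sum>\<gamma>\<in>Pow \<sigma>.
      (-1) ^ (card \<sigma> + card \<gamma>) * (if point_nullity U \<rho> \<gamma> - l = 0 then 1 else 0))"
  proof (rule sum.cong[OF refl])
    fix \<sigma> assume "\<sigma> \<in> {\<sigma>. \<sigma> \<subseteq> points U \<and> card \<sigma> = j}"
    then have \<sigma>: "\<sigma> \<subseteq> points U" by simp
    show "(\<Sum>i\<le>\<rho> U. (-1) ^ i * int (multigraded_betti TYPE('k) ?M i \<sigma>)) =
      (\<Sum>\<gamma>\<in>Pow \<sigma>. (-1) ^ (card \<sigma> + card \<gamma>) * (if point_nullity U \<rho> \<gamma> - l = 0 then 1 else 0))"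
      by (rule multigraded_betti_matroid; unfold g)
        (use \<sigma> dependent_elongation matroid_nullity_elongation in \<open>auto simp: point_nullity_def\<close>)
  qed
  finally show ?thesis by simp
qed

text \<open>Consecutive elongations count sets of nullity at most \<open>l\<close> and at most
  \<open>l - 1\<close>; the difference selects nullity exactly \<open>l\<close>. For
  \<open>l = 0\<close> the convention at index \<open>-1\<close> removes the second term.\<close>

lemma sum_elongation_betti:
  "(\<Sum>i=0..\<rho> U. (-1) ^ i *
      (elongation_betti TYPE('k::field) (int l) (mdual (Cl U \<rho>)) i j -
       elongation_betti TYPE('k) (int l - 1) (mdual (Cl U \<rho>)) i j)) =
    (\<Sum>\<sigma> | \<sigma> \<subseteq> points U \<and> card \<sigma> = j. \<Sum>\<gamma>\<in>Pow \<sigma>.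
      (-1) ^ (card \<sigma> + card \<gamma>) * (if point_nullity U \<rho> \<gamma> = l then 1 else 0))"
  (is "?L = ?R")
proof -
  let ?b = "\<lambda>l. \<Sum>i\<le>\<rho> U. (-1) ^ i * int (betti TYPE('k) (elongation l (mdual (Cl U \<rho>))) i j)"
  have L: "?L = ?b l - (if l = 0 then 0 else ?b (l - 1))"
  proof -
    have "elongation_betti TYPE('k) (int l - 1) (mdual (Cl U \<rho>)) i j =
      (if l = 0 then 0 else int (betti TYPE('k) (elongation (l - 1) (mdual (Cl U \<rho>))) i j))" for i
      by (auto simp: elongation_betti_def nat_diff_distrib)
    moreover have "elongation_betti TYPE('k) (int l) (mdual (Cl U \<rho>)) i j =
      int (betti TYPE('k) (elongation l (mdual (Cl U \<rho>))) i j)" for i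
      by (simp add: elongation_betti_def)
    ultimately show ?thesis
      by (simp add: atLeast0AtMost algebra_simps sum_subtractf)
  qed
  show ?thesis
    unfolding L alternating_betti_elongation
  proof (cases l)
    case 0
    then show "(\<Sum>\<sigma> | \<sigma> \<subseteq> points U \<and> card \<sigma> = j. \<Sum>\<gamma>\<in>Pow \<sigma>.
        (-1) ^ (card \<sigma> + card \<gamma>) * (if point_nullity U \<rho> \<gamma> \<le> l then 1 else 0)) -
      (if l = 0 then 0 else \<Sum>\<sigma> | \<sigma> \<subseteq> points U \<and> card \<sigma> = j. \<Sum>\<gamma>\<in>Pow \<sigma>.
        (-1) ^ (card \<sigma> + card \<gamma>) * (if point_nullity U \<rho> \<gamma> \<le> l - 1 then 1 else 0)) = ?R" by simp
  next
    case (Suc l')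
    have key: "(-1) ^ (card \<sigma> + card \<gamma>) * (if point_nullity U \<rho> \<gamma> \<le> l then 1 else 0) -
        (-1) ^ (card \<sigma> + card \<gamma>) * (if point_nullity U \<rho> \<gamma> \<le> l - 1 then 1 else 0) =
        (-1) ^ (card \<sigma> + card \<gamma>) * (if point_nullity U \<rho> \<gamma> = l then 1 else (0 :: int))" for \<sigma> \<gamma>
      using Suc by auto
    have nz: "(l = 0) = False" using Suc by simp
    show "(\<Sum>\<sigma> | \<sigma> \<subseteq> points U \<and> card \<sigma> = j. \<Sum>\<gamma>\<in>Pow \<sigma>.
        (-1) ^ (card \<sigma> + card \<gamma>) * (if point_nullity U \<rho> \<gamma> \<le> l then 1 else 0)) -
      (if l = 0 then 0 else \<Sum>\<sigma> | \<sigma> \<subseteq> points U \<and> card \<sigma> = j. \<Sum>\<gamma>\<in>Pow \<sigma>.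
        (-1) ^ (card \<sigma> + card \<gamma>) * (if point_nullity U \<rho> \<gamma> \<le> l - 1 then 1 else 0)) = ?R"
      by (simp only: nz if_False sum_subtractf[symmetric] key)
  qed
qed

text \<open>Complementation turns subsets of \<open>\<sigma>\<close> into supersets of its
  complement. Passing to the complement on both sets keeps the parity of the sum of the two
  cardinalities, so the signs agree.\<close>

lemma sum_Pow_span_superset_sum:
  fixes x :: "'r::comm_ring_1"
  assumes "\<sigma> \<subseteq> points U"
  shows "(\<Sum>\<gamma>\<in>Pow \<sigma>. (-1) ^ (card \<sigma> + card \<gamma>) * x ^ point_nullity U \<rho> \<gamma>) =
    span_superset_sum (\<lambda>Y. x ^ (\<rho> U - \<rho> Y)) U (points U - \<sigma>)"
  unfolding span_superset_sum_def superset_sum_def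
proof (rule sum.reindex_bij_witness[of _ "\<lambda>\<tau>. points U - \<tau>" "\<lambda>\<gamma>. points U - \<gamma>"])
  fix \<gamma> assume g: "\<gamma> \<in> Pow \<sigma>"
  then have "\<gamma> \<subseteq> points U" using assms by auto
  then have "card (points U - \<gamma>) + card \<gamma> = card (points U)" "card (points U - \<sigma>) + card \<sigma> = card (points U)"
    using assms by (simp_all add: card_Diff_subset card_mono)
  then have "even (card (points U - \<gamma>) + card (points U - \<sigma>)) \<longleftrightarrow> even (card \<sigma> + card \<gamma>)"
    by presburger
  then show "(-1) ^ (card (points U - \<gamma>) + card (points U - \<sigma>)) * x ^ (\<rho> U - \<rho> (vec.span (\<Union> (points U - \<gamma>)))) =
    (-1) ^ (card \<sigma> + card \<gamma>) * x ^ point_nullity U \<rho> \<gamma>"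
    by (simp add: point_nullity_def minus_one_power_iff)
qed (use assms in auto)

text \<open>The base \<open>x\<close> lies in an arbitrary commutative ring to serve both halves of
  the theorem: the indeterminate for the weight polynomial, the integer \<open>CARD('c)\<close> for
  codes.\<close>

lemma sum_elongation_betti_power:
  fixes x :: "'r::comm_ring_1"
  shows "(\<Sum>l=0..\<rho> U. of_int (\<Sum>i=0..\<rho> U. (-1) ^ i *
      (elongation_betti TYPE('k::field) (int l) (mdual (Cl U \<rho>)) i j -
       elongation_betti TYPE('k) (int l - 1) (mdual (Cl U \<rho>)) i j)) * x ^ l) =
    (\<Sum>\<sigma> | \<sigma> \<subseteq> points U \<and> card \<sigma> = j. span_superset_sum (\<lambda>Y. x ^ (\<rho> U - \<rho> Y)) U (points U - \<sigma>))"
proof -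
  let ?S = "{\<sigma>. \<sigma> \<subseteq> points U \<and> card \<sigma> = j}"
  let ?e = "\<lambda>\<sigma> \<gamma>. (-1) ^ (card \<sigma> + card \<gamma>) :: 'r"
  have "(\<Sum>l=0..\<rho> U. of_int (\<Sum>i=0..\<rho> U. (-1) ^ i *
      (elongation_betti TYPE('k::field) (int l) (mdual (Cl U \<rho>)) i j -
       elongation_betti TYPE('k) (int l - 1) (mdual (Cl U \<rho>)) i j)) * x ^ l) =
    (\<Sum>l=0..\<rho> U. \<Sum>\<sigma>\<in>?S. \<Sum>\<gamma>\<in>Pow \<sigma>. ?e \<sigma> \<gamma> * (if point_nullity U \<rho> \<gamma> = l then x ^ l else 0))"
    unfolding sum_elongation_betti
    by (simp add: sum_distrib_right mult.assoc if_distrib[of of_int] if_distrib[of "\<lambda>c. c * _"] cong: if_cong)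
  also have "\<dots> = (\<Sum>\<sigma>\<in>?S. \<Sum>l=0..\<rho> U. \<Sum>\<gamma>\<in>Pow \<sigma>. ?e \<sigma> \<gamma> * (if point_nullity U \<rho> \<gamma> = l then x ^ l else 0))"
    by (rule sum.swap)
  also have "\<dots> = (\<Sum>\<sigma>\<in>?S. \<Sum>\<gamma>\<in>Pow \<sigma>. \<Sum>l=0..\<rho> U. ?e \<sigma> \<gamma> * (if point_nullity U \<rho> \<gamma> = l then x ^ l else 0))"
    by (intro sum.cong refl sum.swap)
  also have "\<dots> = (\<Sum>\<sigma>\<in>?S. \<Sum>\<gamma>\<in>Pow \<sigma>. ?e \<sigma> \<gamma> * x ^ point_nullity U \<rho> \<gamma>)"
  proof (intro sum.cong refl)
    fix \<sigma> \<gamma>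
    have "point_nullity U \<rho> \<gamma> \<le> \<rho> U" by (simp add: point_nullity_def)
    then show "(\<Sum>l=0..\<rho> U. ?e \<sigma> \<gamma> * (if point_nullity U \<rho> \<gamma> = l then x ^ l else 0)) = ?e \<sigma> \<gamma> * x ^ point_nullity U \<rho> \<gamma>"
      by (simp flip: sum_distrib_left)
  qed
  also have "\<dots> = (\<Sum>\<sigma>\<in>?S. span_superset_sum (\<lambda>Y. x ^ (\<rho> U - \<rho> Y)) U (points U - \<sigma>))"
    by (rule sum.cong) (auto simp: sum_Pow_span_superset_sum)
  finally show ?thesis .
qed

end

section \<open>Sets of points with a flat complement\<close>

text \<open>A geometric sum; together with \<open>card_points\<close> it identifies
  \<open>[s]\<close> as the number of points outside a subspace of dimension
  \<open>n - s\<close>.\<close>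

lemma q_bracket_mult:
  assumes "s \<le> n" "q \<ge> 1"
  shows "q_bracket q n s * (q - 1) + q ^ (n - s) = q ^ n"
  using assms(1)
proof (induction s)
  case 0
  then show ?case by (simp add: q_bracket_def)
next
  case (Suc s)
  have "n - s = Suc (n - Suc s)" using Suc.prems by simp
  then have "q ^ (n - s) = q * q ^ (n - Suc s)" by simp
  also have "q = (q - 1) + 1" using assms(2) by simp
  then have "q * q ^ (n - Suc s) = (q - 1) * q ^ (n - Suc s) + q ^ (n - Suc s)"
    by (metis add_mult_distrib mult_1)
  finally have "q ^ (n - s) = q ^ (n - Suc s) * (q - 1) + q ^ (n - Suc s)" by (simp only: mult.commute)
  moreover have "q_bracket q n (Suc s) = q_bracket q n s + q ^ (n - Suc s)" by (simp add: q_bracket_def)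
  moreover have "q_bracket q n s * (q - 1) + q ^ (n - s) = q ^ n" using Suc by simp
  ultimately show ?case by (simp only: add_mult_distrib)
qed

lemma card_field_ge_2: "CARD('a::{field,finite}) \<ge> 2"
proof -
  have "card {0, 1 :: 'a} \<le> CARD('a)" by (rule card_mono) auto
  then show ?thesis by simp
qed

text \<open>Multiplied by \<open>?q - 1\<close>, the point counts become powers of \<open>?q\<close>
  up to constants, and equal powers have equal exponents since \<open>?q \<ge> 2\<close>.\<close>

lemma card_points_q_bracket:
  fixes X :: "('a::{field,finite} ^ 'n) set"
  assumes X: "vec.subspace X" and "s \<le> CARD('n)"
  shows "card (points X) + q_bracket CARD('a) CARD('n) s = card (points (UNIV :: ('a ^ 'n) set)) \<longleftrightarrow>
    vec.dim X = CARD('n) - s"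
proof -
  let ?q = "CARD('a)" and ?n = "CARD('n)" and ?E = "points (UNIV :: ('a ^ 'n) set)"
  have q: "?q \<ge> 2" by (rule card_field_ge_2)
  have 1: "card (points X) * (?q - 1) + 1 = ?q ^ vec.dim X" by (rule card_points[OF X])
  have 2: "card ?E * (?q - 1) + 1 = ?q ^ ?n"
    using card_points[OF vec.subspace_UNIV, where ?'a = 'a and ?'n = 'n] by (simp add: vec_dim_card del: vec.dim_UNIV)
  have 3: "q_bracket ?q ?n s * (?q - 1) + ?q ^ (?n - s) = ?q ^ ?n" by (rule q_bracket_mult) (use assms q in auto)
  have "card (points X) + q_bracket ?q ?n s = card ?E \<longleftrightarrow>
    (card (points X) + q_bracket ?q ?n s) * (?q - 1) = card ?E * (?q - 1)" using q by auto
  also have "\<dots> \<longleftrightarrow> card (points X) * (?q - 1) + 1 = ?q ^ (?n - s)"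
    using 2 3 unfolding add_mult_distrib by linarith
  also have "\<dots> \<longleftrightarrow> vec.dim X = ?n - s" unfolding 1 using q by simp
  finally show ?thesis .
qed

text \<open>Of the sets of \<open>[s]\<close> points only the complements of subspaces contribute;
  these subspaces have dimension \<open>n - s\<close>, and \<open>perp\<close> matches them with the
  \<open>U\<close> of dimension \<open>s\<close>.\<close>

lemma sum_span_superset_sum_card:
  fixes h :: "('a::{field,finite} ^ 'n) set \<Rightarrow> 'r::comm_ring_1"
  assumes s: "s \<le> CARD('n)"
  shows "(\<Sum>\<sigma> | \<sigma> \<subseteq> points UNIV \<and> card \<sigma> = q_bracket CARD('a) CARD('n) s.
      span_superset_sum h UNIV (points UNIV - \<sigma>)) =
    (\<Sum>U | vec.subspace U \<and> vec.dim U = s. span_superset_sum h UNIV (points (perp std_dot UNIV U)))"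
proof -
  let ?E = "points (UNIV :: ('a ^ 'n) set)" and ?b = "q_bracket CARD('a) CARD('n) s"
  let ?g = "span_superset_sum h UNIV"
  interpret inner_space "std_dot :: 'a ^ 'n \<Rightarrow> _" UNIV by (rule inner_space_std_dot)
  let ?T = "{A. A \<subseteq> ?E \<and> card A + ?b = card ?E}"
  let ?Y = "{X :: ('a ^ 'n) set. vec.subspace X \<and> vec.dim X = CARD('n) - s}"
  have compl: "card (?E - A) + card A = card ?E" if "A \<subseteq> ?E" for A
    using card_Diff_subset[of A ?E] card_mono[of ?E A] that by simp
  have "(\<Sum>\<sigma> | \<sigma> \<subseteq> ?E \<and> card \<sigma> = ?b. ?g (?E - \<sigma>)) = (\<Sum>A\<in>?T. ?g A)"
  proof (rule sum.reindex_bij_witness[of _ "\<lambda>A. ?E - A" "\<lambda>A. ?E - A"])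
    fix \<sigma> assume s: "\<sigma> \<in> {\<sigma>. \<sigma> \<subseteq> ?E \<and> card \<sigma> = ?b}"
    then have "card (?E - \<sigma>) + card \<sigma> = card ?E" by (intro compl) blast
    then have "card (?E - \<sigma>) + ?b = card ?E" using s unfolding mem_Collect_eq by linarith
    then show "?E - \<sigma> \<in> ?T" by blast
  next
    fix A assume A: "A \<in> ?T"
    then have "card (?E - A) + card A = card ?E" by (intro compl) blast
    then have "card (?E - A) = ?b" using A unfolding mem_Collect_eq by linarith
    then show "?E - A \<in> {\<sigma>. \<sigma> \<subseteq> ?E \<and> card \<sigma> = ?b}" by blast
  qed auto
  also have "\<dots> = (\<Sum>A\<in>points ` ?Y. ?g A)"
  proof (rule sum.mono_neutral_right)
    show "points ` ?Y \<subseteq> ?T"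
      using points_mono[of _ UNIV] card_points_q_bracket[OF _ s, where ?'a = 'a] by auto
    show "\<forall>A\<in>?T - points ` ?Y. ?g A = 0"
    proof (rule ballI, rule ccontr)
      fix A assume A: "A \<in> ?T - points ` ?Y" and nz: "?g A \<noteq> 0"
      have eq: "A = points (vec.span (\<Union>A))"
        by (rule span_superset_sum_flat[OF _ vec.subspace_UNIV nz]) (use A in auto)
      then have "vec.dim (vec.span (\<Union>A)) = CARD('n) - s"
        using A card_points_q_bracket[OF vec.subspace_span s, of "\<Union>A"] by simp
      then have "vec.span (\<Union>A) \<in> ?Y" by simp
      then show False using eq A by blast
    qed
  qed simp
  also have "\<dots> = (\<Sum>X\<in>?Y. ?g (points X))"
    by (subst sum.reindex) (auto intro: inj_on_subset[OF inj_on_points])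
  also have "\<dots> = (\<Sum>U | vec.subspace U \<and> vec.dim U = s. ?g (points (perp std_dot UNIV U)))"
  proof (rule sum.reindex_bij_witness[of _ "perp std_dot UNIV" "perp std_dot UNIV"])
    fix X assume "X \<in> ?Y"
    then have X: "vec.subspace X" "vec.dim X = CARD('n) - s" by auto
    show pp: "perp std_dot UNIV (perp std_dot UNIV X) = X" by (rule perp_perp[OF X(1) subset_UNIV])
    show "perp std_dot UNIV X \<in> {U. vec.subspace U \<and> vec.dim U = s}"
      using subspace_perp[OF subset_UNIV] dim_perp[OF X(1) subset_UNIV] X(2) s by (simp add: vec_dim_card del: vec.dim_UNIV)
    show "?g (points (perp std_dot UNIV (perp std_dot UNIV X))) = ?g (points X)" unfolding pp ..
  next
    fix U :: "('a ^ 'n) set" assume "U \<in> {U. vec.subspace U \<and> vec.dim U = s}"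
    then have U: "vec.subspace U" "vec.dim U = s" by auto
    show "perp std_dot UNIV (perp std_dot UNIV U) = U" by (rule perp_perp[OF U(1) subset_UNIV])
    show "perp std_dot UNIV U \<in> ?Y"
      using subspace_perp[OF subset_UNIV] dim_perp[OF U(1) subset_UNIV] U(2) by (simp add: vec_dim_card del: vec.dim_UNIV)
  qed
  finally show ?thesis .
qed

section \<open>The q-matroids on subspaces and their weight contributions\<close>

text \<open>\<open>q_local\<close> is a \<open>SOME\<close>, so everything about it rests on a
  witness. The composite of the two perps maps the subspaces of \<open>U\<close> onto those above
  \<open>?Q U\<close>, preserving order, sums and intersections; the witness is
  \<open>\<rho>\<close> contracted by \<open>?Q U\<close>, transported along this map.\<close>

lemma q_local_spec:
  fixes \<rho> :: "('a::field ^ 'n) set \<Rightarrow> nat"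
  assumes M: "q_matroid UNIV \<rho>" and b: "vec.independent b" "vec.span b = U"
  shows "q_matroid U (q_local b \<rho> U) \<and> (\<forall>V. vec.subspace V \<and> V \<subseteq> U \<longrightarrow>
    q_nullity (q_dual (basis_dot b) U (q_local b \<rho> U)) V = q_nullity (q_dual std_dot UNIV \<rho>) V)"
proof -
  interpret L: inner_space "basis_dot b" U by (rule inner_space_basis_dot[OF b])
  interpret G: inner_space "std_dot :: 'a ^ 'n \<Rightarrow> _" UNIV by (rule inner_space_std_dot)
  let ?P = "perp (basis_dot b) U" and ?Q = "perp (std_dot :: 'a ^ 'n \<Rightarrow> _) UNIV"
  \<comment> \<open>The dual nullity on \<open>U\<close> is
    \<open>\<rho>U U - \<rho>U (?P V)\<close> and must equal
    \<open>\<rho> UNIV - \<rho> (?Q V)\<close>; with \<open>V = ?P W\<close> and the value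
    \<open>0\<close> at the zero space only this formula remains.\<close>
  define \<rho>U where "\<rho>U W = \<rho> (?Q (?P W)) - \<rho> (?Q U)" for W
  have sP: "vec.subspace (?P W)" if "W \<subseteq> U" for W by (rule L.subspace_perp[OF that])
  have sP0: "vec.subspace (?Q W)" for W using G.subspace_perp[of W] by simp
  have ge: "\<rho> (?Q U) \<le> \<rho> (?Q V)" if "V \<subseteq> U" for V
    by (rule q_matroidD(3)[OF M sP0 sP0 G.perp_antimono[OF that] subset_UNIV])
  have dimP0: "vec.dim (?Q W) + vec.dim W = CARD('n)" if "vec.subspace W" for W
    using G.dim_perp[OF that subset_UNIV] by (simp add: vec_dim_card del: vec.dim_UNIV)
  have qm: "q_matroid U \<rho>U"
    unfolding q_matroid_def subspace_sum_def[symmetric]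
  proof (intro conjI allI impI; (elim conjE)?)
    show "vec.subspace U" by (rule L.U)
  next
    fix X assume X: "vec.subspace X" "X \<subseteq> U"
    have "\<rho> (?Q (?P X)) + vec.dim (?Q U) \<le> \<rho> (?Q U) + vec.dim (?Q (?P X))"
      by (rule q_matroid_rank_growth[OF M sP0 sP0 subset_UNIV G.perp_antimono[OF L.perp_subset]])
    then show "\<rho>U X \<le> vec.dim X"
      using dimP0[OF L.U] dimP0[OF sP[OF X(2)]] L.dim_perp[OF X] unfolding \<rho>U_def by simp
  next
    fix X Y assume "vec.subspace X" "vec.subspace Y" "X \<subseteq> Y" "Y \<subseteq> U"
    then show "\<rho>U X \<le> \<rho>U Y"
      unfolding \<rho>U_def
      by (intro diff_le_mono q_matroidD(3)[OF M sP0 sP0 _ subset_UNIV] G.perp_antimono L.perp_antimono)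
  next
    fix X Y assume X: "vec.subspace X" "X \<subseteq> U" and Y: "vec.subspace Y" "Y \<subseteq> U"
    have s: "?Q (?P (subspace_sum X Y)) = subspace_sum (?Q (?P X)) (?Q (?P Y))"
      unfolding L.perp_subspace_sum[OF X Y] by (rule G.perp_Int[OF sP[OF X(2)] subset_UNIV sP[OF Y(2)] subset_UNIV])
    have i: "?Q (?P (X \<inter> Y)) = ?Q (?P X) \<inter> ?Q (?P Y)"
      unfolding L.perp_Int[OF X Y]
      by (rule G.perp_subspace_sum[OF sP[OF X(2)] subset_UNIV sP[OF Y(2)] subset_UNIV])
    have "\<rho> (?Q (?P (subspace_sum X Y))) + \<rho> (?Q (?P (X \<inter> Y))) \<le> \<rho> (?Q (?P X)) + \<rho> (?Q (?P Y))"
      unfolding s i by (rule q_matroidD(4)[OF M sP0 subset_UNIV sP0 subset_UNIV])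
    moreover have "\<rho> (?Q U) \<le> \<rho> (?Q (?P W))" for W by (rule ge[OF L.perp_subset])
    ultimately show "\<rho>U (subspace_sum X Y) + \<rho>U (X \<inter> Y) \<le> \<rho>U X + \<rho>U Y"
      unfolding \<rho>U_def by (smt (verit) add_diff_inverse_nat nat_add_left_cancel_le not_less add.commute add.left_commute diff_le_mono le_diff_conv)
  qed
  have "q_nullity (q_dual (basis_dot b) U \<rho>U) V = q_nullity (q_dual std_dot UNIV \<rho>) V"
    if V: "vec.subspace V" "V \<subseteq> U" for V
  proof -
    have 1: "\<rho>U (?P V) = \<rho> (?Q V) - \<rho> (?Q U)" by (simp add: \<rho>U_def L.perp_perp[OF V])
    have 2: "\<rho>U U = \<rho> UNIV - \<rho> (?Q U)" by (simp add: \<rho>U_def L.perp_U G.perp_0)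
    have 3: "\<rho> (?Q U) \<le> \<rho> UNIV" by (rule q_matroidD(3)[OF M sP0]) auto
    show ?thesis unfolding q_nullity_def q_dual_def 1 2 using ge[OF V(2)] 3 by simp
  qed
  then have "\<exists>\<rho>\<^sub>U. q_matroid U \<rho>\<^sub>U \<and> (\<forall>V. vec.subspace V \<and> V \<subseteq> U \<longrightarrow>
     q_nullity (q_dual (basis_dot b) U \<rho>\<^sub>U) V = q_nullity (q_dual std_dot UNIV \<rho>) V)"
    using qm by blast
  then show ?thesis unfolding q_local_def by (rule someI_ex)
qed

text \<open>The nullity condition at the perp of \<open>W\<close> inside \<open>U\<close> fixes the
  corank of \<open>W\<close>, which is all that the weight polynomial sees of
  \<open>q_local\<close>. The facts \<open>1\<close> to \<open>4\<close> exclude truncation on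
  either side.\<close>

lemma q_local_corank:
  fixes \<rho> :: "('a::field ^ 'n) set \<Rightarrow> nat"
  assumes M: "q_matroid UNIV \<rho>" and b: "vec.independent b" "vec.span b = U"
    and W: "vec.subspace W" "W \<subseteq> U"
  shows "q_local b \<rho> U U - q_local b \<rho> U W =
    \<rho> UNIV - \<rho> (perp std_dot UNIV (perp (basis_dot b) U W))"
proof -
  interpret L: inner_space "basis_dot b" U by (rule inner_space_basis_dot[OF b])
  interpret G: inner_space "std_dot :: 'a ^ 'n \<Rightarrow> _" UNIV by (rule inner_space_std_dot)
  let ?r = "q_local b \<rho> U" and ?V = "perp (basis_dot b) U W"
  let ?Q = "perp (std_dot :: 'a ^ 'n \<Rightarrow> _) UNIV"
  have V: "vec.subspace ?V" "?V \<subseteq> U" by (rule L.subspace_perp[OF W(2)]) (rule L.perp_subset)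
  have qm: "q_matroid U ?r" and "q_nullity (q_dual (basis_dot b) U ?r) ?V = q_nullity (q_dual std_dot UNIV \<rho>) ?V"
    using q_local_spec[OF M b] V by auto
  then have eq: "vec.dim ?V - (vec.dim ?V + ?r W - ?r U) = vec.dim ?V - (vec.dim ?V + \<rho> (?Q ?V) - \<rho> UNIV)"
    unfolding q_nullity_def q_dual_def by (simp add: L.perp_perp[OF W])
  have P0: "vec.subspace (?Q ?V)" by (rule G.subspace_perp[OF subset_UNIV])
  have "?r U + vec.dim W \<le> ?r W + vec.dim U" by (rule q_matroid_rank_growth[OF qm W(1) L.U subset_refl W(2)])
  then have 1: "?r U \<le> vec.dim ?V + ?r W" using L.dim_perp[OF W] by simp
  have "\<rho> UNIV + vec.dim (?Q ?V) \<le> \<rho> (?Q ?V) + CARD('n)"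
    using q_matroid_rank_growth[OF M P0 vec.subspace_UNIV] by (simp add: vec_dim_card del: vec.dim_UNIV)
  then have 2: "\<rho> UNIV \<le> vec.dim ?V + \<rho> (?Q ?V)" using G.dim_perp[OF V(1) subset_UNIV] by (simp add: vec_dim_card del: vec.dim_UNIV)
  have 3: "?r W \<le> ?r U" by (rule q_matroidD(3)[OF qm W(1) L.U W(2) subset_refl])
  have 4: "\<rho> (?Q ?V) \<le> \<rho> UNIV" by (rule q_matroidD(3)[OF M P0]) auto
  show ?thesis using eq 1 2 3 4 by simp
qed

text \<open>The contribution of \<open>U\<close> equals a term of the Moebius inverse on the whole
  space: extended to all subspaces of \<open>U\<close>, both sides sum below \<open>V\<close> to the
  indeterminate raised to the dual nullity of \<open>V\<close>. Thus the two dot products never have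
  to be compared directly.\<close>

lemma gen_weight_poly_eq:
  fixes \<rho> :: "('a::{field,finite} ^ 'n) set \<Rightarrow> nat"
  assumes M: "q_matroid UNIV \<rho>" and B: "basis_family B"
  shows "gen_weight_poly B \<rho> s = (\<Sum>U | vec.subspace U \<and> vec.dim U = s.
    span_superset_sum (\<lambda>Y. monom 1 1 ^ (\<rho> UNIV - \<rho> Y)) UNIV (points (perp std_dot UNIV U)))"
proof -
  interpret G: inner_space "std_dot :: 'a ^ 'n \<Rightarrow> _" UNIV by (rule inner_space_std_dot)
  let ?x = "monom 1 1 :: int poly"
  let ?Q = "perp (std_dot :: 'a ^ 'n \<Rightarrow> _) UNIV"
  let ?g = "\<lambda>Y. ?x ^ (\<rho> UNIV - \<rho> Y)"
  have "(-1) ^ ((CARD('a) ^ s - 1) div (CARD('a) - 1)) *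
      (\<Sum>\<gamma>\<in>Pow (points U). (-1) ^ card \<gamma> * monom 1 (nullity (mdual (Cl U (q_local (B U) \<rho> U))) \<gamma>)) =
      span_superset_sum ?g UNIV (points (?Q U))"
    if U: "vec.subspace U" "vec.dim U = s" for U
  proof -
    have b: "vec.independent (B U)" "vec.span (B U) = U" using B U(1) by (auto simp: basis_family_def)
    interpret L: inner_space "basis_dot (B U)" U by (rule inner_space_basis_dot[OF b])
    let ?P = "perp (basis_dot (B U)) U" and ?r = "q_local (B U) \<rho> U"
    let ?h = "\<lambda>Y. ?g (?Q (?P Y))"
    have qm: "q_matroid U ?r" using q_local_spec[OF M b] by simp
    have "card (points U) * (CARD('a) - 1) = CARD('a) ^ s - 1" using card_points[OF U(1)] U(2) by simp
    \<comment> \<open>The sign in the definition is the parity of the number of points of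
      \<open>U\<close>.\<close>
    then have cardP: "(CARD('a) ^ s - 1) div (CARD('a) - 1) = card (points U)"
      using card_field_ge_2[where ?'a = 'a] nonzero_mult_div_cancel_right[of "CARD('a) - 1" "card (points U)"]
      by simp
    have "(-1) ^ card (points U) *
      (\<Sum>\<gamma>\<in>Pow (points U). (-1) ^ card \<gamma> * monom 1 (nullity (mdual (Cl U ?r)) \<gamma>)) =
      (\<Sum>\<gamma>\<in>Pow (points U). (-1) ^ (card (points U) + card \<gamma>) * ?x ^ point_nullity U ?r \<gamma>)"
      unfolding sum_distrib_left
    proof (rule sum.cong[OF refl])
      fix \<gamma> assume "\<gamma> \<in> Pow (points U)"
      then have "nullity (mdual (Cl U ?r)) \<gamma> = point_nullity U ?r \<gamma>"
        using nullity_mdual_Cl[OF qm] by (simp add: point_nullity_def)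
      then show "(-1) ^ card (points U) * ((-1) ^ card \<gamma> * monom 1 (nullity (mdual (Cl U ?r)) \<gamma>)) =
        (-1) ^ (card (points U) + card \<gamma>) * ?x ^ point_nullity U ?r \<gamma>"
        by (simp add: power_add monom_power mult.assoc)
    qed
    also have "\<dots> = span_superset_sum (\<lambda>Y. ?x ^ (?r U - ?r Y)) U {}"
      using sum_Pow_span_superset_sum[OF qm, of "points U" ?x] by simp
    also have "\<dots> = span_superset_sum ?h U {}"
      unfolding span_superset_sum_def superset_sum_def
    proof (rule sum.cong[OF refl])
      fix \<tau> assume "\<tau> \<in> {\<tau>. {} \<subseteq> \<tau> \<and> \<tau> \<subseteq> points U}"
      then have "vec.span (\<Union>\<tau>) \<subseteq> U" using span_Union_subset[OF _ U(1)] by auto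
      then have "?r U - ?r (vec.span (\<Union>\<tau>)) = \<rho> UNIV - \<rho> (?Q (?P (vec.span (\<Union>\<tau>))))"
        by (intro q_local_corank[OF M b]) simp_all
      then show "(-1) ^ (card \<tau> + card {}) * ?x ^ (?r U - ?r (vec.span (\<Union>\<tau>))) =
        (-1) ^ (card \<tau> + card {}) * ?h (vec.span (\<Union>\<tau>))" by simp
    qed
    \<comment> \<open>The empty set is the point set of \<open>?P U = {0}\<close>, which puts the
      local sum into the form of the Moebius comparison.\<close>
    also have "\<dots> = span_superset_sum ?h U (points (?P U))"
      by (simp add: L.perp_U points_0)
    also have "\<dots> = span_superset_sum ?g UNIV (points (?Q U))"
    proof (rule subspace_moebius_unique[where U = U and V = U
          and a = "\<lambda>X. span_superset_sum ?h U (points (?P X))"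
          and b = "\<lambda>X. span_superset_sum ?g UNIV (points (?Q X))"])
      fix V assume V: "vec.subspace V" "V \<subseteq> U"
      have "(\<Sum>X | vec.subspace X \<and> X \<subseteq> V. span_superset_sum ?h U (points (?P X))) = ?h (?P V)"
        by (rule sum_span_superset_sum_perp[OF L.inner_space_axioms V])
      also have "\<dots> = ?g (?Q V)" by (simp add: L.perp_perp[OF V])
      also have "\<dots> = (\<Sum>X | vec.subspace X \<and> X \<subseteq> V. span_superset_sum ?g UNIV (points (?Q X)))"
        by (rule sum_span_superset_sum_perp[OF G.inner_space_axioms V(1) subset_UNIV, symmetric])
      finally show "(\<Sum>X | vec.subspace X \<and> X \<subseteq> V. span_superset_sum ?h U (points (?P X))) =
        (\<Sum>X | vec.subspace X \<and> X \<subseteq> V. span_superset_sum ?g UNIV (points (?Q X)))" .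
    qed (use U in auto)
    finally have eq: "(-1) ^ card (points U) *
      (\<Sum>\<gamma>\<in>Pow (points U). (-1) ^ card \<gamma> * monom 1 (nullity (mdual (Cl U ?r)) \<gamma>)) =
      span_superset_sum ?g UNIV (points (?Q U))" .
    show "(-1) ^ ((CARD('a) ^ s - 1) div (CARD('a) - 1)) *
      (\<Sum>\<gamma>\<in>Pow (points U). (-1) ^ card \<gamma> * monom 1 (nullity (mdual (Cl U ?r)) \<gamma>)) =
      span_superset_sum ?g UNIV (points (?Q U))"
      unfolding cardP by (rule eq)
  qed
  then show ?thesis
    unfolding gen_weight_poly_def sum_distrib_left[of _ _ "{U. vec.subspace U \<and> vec.dim U = s}"]
    by (intro sum.cong) auto
qed

section \<open>Rank-metric codes\<close>

lemma field_embedding_simps: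
  assumes "field_embedding \<iota>"
  shows "\<iota> 0 = 0" "\<iota> 1 = 1" "\<iota> (x + y) = \<iota> x + \<iota> y" "\<iota> (x * y) = \<iota> x * \<iota> y"
    "\<iota> (sum f S) = (\<Sum>i\<in>S. \<iota> (f i))"
proof -
  have "\<iota> (0 + 0) = \<iota> 0 + \<iota> 0" using assms unfolding field_embedding_def by blast
  then have "\<iota> 0 + 0 = \<iota> 0 + \<iota> 0" by (simp only: add_0_right)
  then show 0: "\<iota> 0 = 0" by (simp only: add_left_cancel)
  show "\<iota> 1 = 1" "\<iota> (x * y) = \<iota> x * \<iota> y" and a: "\<iota> (x + y) = \<iota> x + \<iota> y" for x y
    using assms unfolding field_embedding_def by auto
  show "\<iota> (sum f S) = (\<Sum>i\<in>S. \<iota> (f i))"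
    by (induction S rule: infinite_finite_induct) (auto simp: 0 a)
qed

lemma vector_space_ext_scale: "field_embedding \<iota> \<Longrightarrow> vector_space (ext_scale \<iota>)"
  by unfold_locales (auto simp: ext_scale_def field_embedding_simps algebra_simps)

lemma field_embedding_comp: "field_embedding \<iota> \<Longrightarrow> field_embedding \<kappa> \<Longrightarrow> field_embedding (\<kappa> \<circ> \<iota>)"
  by (simp add: field_embedding_def)

lemma ext_basis_exists:
  assumes "field_embedding \<kappa>"
  shows "\<exists>\<Theta>. ext_basis \<kappa> \<Theta>"
proof -
  interpret vector_space "ext_scale \<kappa>" by (rule vector_space_ext_scale[OF assms])
  obtain \<Theta> where "independent \<Theta>" "UNIV \<subseteq> span \<Theta>"
    by (rule basis_exists[of UNIV])
  then show ?thesis unfolding ext_basis_def by blast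
qed

lemma ext_basis_sum_eq_0:
  fixes \<kappa> :: "'a::field \<Rightarrow> 'b::{field,finite}"
  assumes "field_embedding \<kappa>" "ext_basis \<kappa> \<Theta>" "(\<Sum>\<theta>\<in>\<Theta>. \<kappa> (f \<theta>) * \<theta>) = 0" "\<theta> \<in> \<Theta>"
  shows "f \<theta> = 0"
proof -
  interpret vector_space "ext_scale \<kappa>" by (rule vector_space_ext_scale[OF assms(1)])
  show ?thesis
    by (rule independentD[of \<Theta> \<Theta>]) (use assms in \<open>auto simp: ext_basis_def ext_scale_def\<close>)
qed

lemma ext_basis_expansion:
  fixes \<kappa> :: "'a::field \<Rightarrow> 'b::{field,finite}"
  assumes "field_embedding \<kappa>" "ext_basis \<kappa> \<Theta>"
  shows "(\<Sum>\<theta>\<in>\<Theta>. \<kappa> (module.representation (ext_scale \<kappa>) \<Theta> x \<theta>) * \<theta>) = x"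
proof -
  interpret vector_space "ext_scale \<kappa>" by (rule vector_space_ext_scale[OF assms(1)])
  show ?thesis
    using sum_representation_eq[of \<Theta> x \<Theta>] assms(2) by (simp add: ext_basis_def ext_scale_def)
qed

section \<open>Rank supports as linear equations\<close>

definition ext_dot :: "('a::field \<Rightarrow> 'b::field) \<Rightarrow> 'a ^ 'n \<Rightarrow> 'b ^ 'n \<Rightarrow> 'b" where
  "ext_dot \<iota> y c = (\<Sum>j\<in>UNIV. \<iota> (y $ j) * c $ j)"

lemma ext_dot_add: "ext_dot \<iota> y (c + d) = ext_dot \<iota> y c + ext_dot \<iota> y d"
  by (simp add: ext_dot_def algebra_simps sum.distrib)

lemma ext_dot_scale: "ext_dot \<iota> y (a *s c) = a * ext_dot \<iota> y c"
  by (simp add: ext_dot_def sum_distrib_left ac_simps)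

lemma ext_dot_add_left: "field_embedding \<iota> \<Longrightarrow> ext_dot \<iota> (x + y) c = ext_dot \<iota> x c + ext_dot \<iota> y c"
  by (simp add: ext_dot_def field_embedding_simps algebra_simps sum.distrib)

lemma ext_dot_scale_left: "field_embedding \<iota> \<Longrightarrow> ext_dot \<iota> (a *s y) c = \<iota> a * ext_dot \<iota> y c"
  by (simp add: ext_dot_def field_embedding_simps sum_distrib_left ac_simps)

text \<open>Membership of the rows in \<open>V\<close> is tested against
  \<open>perp std_dot UNIV V\<close>; independence of \<open>\<B>\<close> packs the equations for
  all rows into a single one over the extension, in which the basis has disappeared.\<close>

lemma Rsupp_subset_iff:
  fixes \<iota> :: "'a::field \<Rightarrow> 'b::{field,finite}" and V :: "('a ^ 'n) set"
  assumes \<iota>: "field_embedding \<iota>" and \<B>: "ext_basis \<iota> \<B>" and V: "vec.subspace V"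
  shows "Rsupp \<iota> \<B> c \<subseteq> V \<longleftrightarrow> (\<forall>y\<in>perp std_dot UNIV V. ext_dot \<iota> y c = 0)"
proof -
  interpret G: inner_space "std_dot :: 'a ^ 'n \<Rightarrow> _" UNIV by (rule inner_space_std_dot)
  let ?rep = "module.representation (ext_scale \<iota>) \<B>"
  let ?row = "\<lambda>b. (\<chi> j. ?rep (c $ j) b) :: 'a ^ 'n"
  have dot: "ext_dot \<iota> y c = (\<Sum>b\<in>\<B>. \<iota> (std_dot y (?row b)) * b)" for y
  proof -
    have "ext_dot \<iota> y c = (\<Sum>j\<in>UNIV. \<Sum>b\<in>\<B>. \<iota> (y $ j) * (\<iota> (?rep (c $ j) b) * b))"
      unfolding ext_dot_def sum_distrib_left[symmetric] ext_basis_expansion[OF \<iota> \<B>] ..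
    also have "\<dots> = (\<Sum>b\<in>\<B>. \<Sum>j\<in>UNIV. \<iota> (y $ j) * (\<iota> (?rep (c $ j) b) * b))"
      by (rule sum.swap)
    finally show ?thesis
      by (simp add: std_dot_def field_embedding_simps[OF \<iota>] sum_distrib_right mult.assoc)
  qed
  have "Rsupp \<iota> \<B> c \<subseteq> V \<longleftrightarrow> (\<forall>b\<in>\<B>. ?row b \<in> V)"
  proof
    assume "Rsupp \<iota> \<B> c \<subseteq> V"
    then show "\<forall>b\<in>\<B>. ?row b \<in> V" unfolding Rsupp_def using vec.span_superset[of "?row ` \<B>"] by blast
  next
    assume "\<forall>b\<in>\<B>. ?row b \<in> V"
    then show "Rsupp \<iota> \<B> c \<subseteq> V" unfolding Rsupp_def by (intro vec.span_minimal[OF _ V]) auto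
  qed
  also have "\<dots> \<longleftrightarrow> (\<forall>b\<in>\<B>. ?row b \<in> perp std_dot UNIV (perp std_dot UNIV V))"
    by (simp add: G.perp_perp[OF V])
  also have "\<dots> \<longleftrightarrow> (\<forall>y\<in>perp std_dot UNIV V. \<forall>b\<in>\<B>. std_dot y (?row b) = 0)"
    by (auto simp: perp_def[of _ _ "perp std_dot UNIV V"])
  also have "\<dots> \<longleftrightarrow> (\<forall>y\<in>perp std_dot UNIV V. ext_dot \<iota> y c = 0)"
  proof (rule ball_cong[OF refl])
    fix y
    have "std_dot y (?row b) = 0" if "ext_dot \<iota> y c = 0" "b \<in> \<B>" for b
      by (rule ext_basis_sum_eq_0[OF \<iota> \<B> _ that(2), where f = "\<lambda>b. std_dot y (?row b)"])
        (use that(1) in \<open>simp only: dot\<close>)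
    then show "(\<forall>b\<in>\<B>. std_dot y (?row b) = 0) \<longleftrightarrow> ext_dot \<iota> y c = 0"
      unfolding dot by (auto simp: field_embedding_simps[OF \<iota>])
  qed
  finally show ?thesis .
qed

text \<open>For a subspace \<open>X\<close>, the subcode of words with rank support in the perp of
  \<open>X\<close>, written without a basis of the extension.\<close>

definition annihilated :: "('a::field \<Rightarrow> 'b::field) \<Rightarrow> ('b ^ 'n) set \<Rightarrow> ('a ^ 'n) set \<Rightarrow> ('b ^ 'n) set" where
  "annihilated \<iota> C X = {c \<in> C. \<forall>x\<in>X. ext_dot \<iota> x c = 0}"

lemma annihilated_insert:
  "annihilated \<iota> C (insert x X) = {c \<in> annihilated \<iota> C X. ext_dot \<iota> x c = 0}"
  by (auto simp: annihilated_def)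

lemma subspace_annihilated:
  assumes "vec.subspace C"
  shows "vec.subspace (annihilated \<iota> C X)"
  using assms unfolding vec.subspace_def annihilated_def
  by (auto simp: ext_dot_add ext_dot_scale) (simp add: ext_dot_def)

lemma annihilated_span:
  assumes "field_embedding \<iota>"
  shows "annihilated \<iota> C (vec.span X) = annihilated \<iota> C X"
proof
  show "annihilated \<iota> C (vec.span X) \<subseteq> annihilated \<iota> C X"
    using vec.span_superset[of X] by (auto simp: annihilated_def)
  have "ext_dot \<iota> y c = 0" if "\<And>x. x \<in> X \<Longrightarrow> ext_dot \<iota> x c = 0" "y \<in> vec.span X" for y c
    using that(2)
  proof (induction rule: vec.span_induct_alt)
    case base
    then show ?case by (simp add: ext_dot_def field_embedding_simps(1)[OF assms])
  next
    case (step a x y)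
    then show ?case
      using that(1) by (simp add: ext_dot_add_left[OF assms] ext_dot_scale_left[OF assms])
  qed
  then show "annihilated \<iota> C X \<subseteq> annihilated \<iota> C (vec.span X)"
    by (auto simp: annihilated_def)
qed

text \<open>Each basis vector of \<open>X\<close> imposes one equation over the extension; this
  bounds the rank of \<open>X\<close> by its dimension.\<close>

lemma dim_annihilated:
  fixes X :: "('a::field ^ 'n) set"
  assumes \<iota>: "field_embedding \<iota>" and C: "vec.subspace C" and X: "vec.subspace X"
  shows "vec.dim C \<le> vec.dim (annihilated \<iota> C X) + vec.dim X"
proof -
  obtain B where B: "B \<subseteq> X" "vec.independent B" "X \<subseteq> vec.span B" "card B = vec.dim X"
    by (rule vec.basis_exists)
  have "finite B" using B(2) vec.finiteI_independent by auto
  then have "vec.dim C \<le> vec.dim (annihilated \<iota> C B) + card B"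
  proof (induction B rule: finite_induct)
    case empty
    then show ?case by (simp add: annihilated_def)
  next
    case (insert x B)
    have "vec.dim (annihilated \<iota> C B) \<le> vec.dim {c \<in> annihilated \<iota> C B. ext_dot \<iota> x c = 0} + 1"
      by (rule dim_hyperplane(2)[OF subspace_annihilated[OF C]]) (simp_all add: ext_dot_add ext_dot_scale)
    then show ?case using insert by (simp add: annihilated_insert)
  qed
  moreover have "vec.span B = X" using B X by (metis subset_antisym vec.span_minimal)
  ultimately show ?thesis using annihilated_span[OF \<iota>, of C B] B(4) by simp
qed

lemma code_rank_eq:
  fixes \<iota> :: "'a::field \<Rightarrow> 'b::{field,finite}" and X :: "('a ^ 'n) set"
  assumes \<iota>: "field_embedding \<iota>" and \<B>: "ext_basis \<iota> \<B>" and X: "vec.subspace X"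
  shows "code_rank \<iota> \<B> C X = vec.dim C - vec.dim (annihilated \<iota> C X)"
proof -
  interpret G: inner_space "std_dot :: 'a ^ 'n \<Rightarrow> _" UNIV by (rule inner_space_std_dot)
  have "vec.subspace (perp std_dot UNIV X)" by (rule G.subspace_perp[OF subset_UNIV])
  then show ?thesis
    unfolding code_rank_def annihilated_def
    by (simp add: Rsupp_subset_iff[OF \<iota> \<B>] G.perp_perp[OF X])
qed

text \<open>Submodularity is the dimension formula for two subcodes: the words annihilated by the
  sum of \<open>X\<close> and \<open>Y\<close> form their intersection, and their sum lies in the
  words annihilated by \<open>X \<inter> Y\<close>.\<close>

lemma q_matroid_code_rank:
  fixes \<iota> :: "'a::field \<Rightarrow> 'b::{field,finite}" and C :: "('b ^ 'n) set"
  assumes \<iota>: "field_embedding \<iota>" and \<B>: "ext_basis \<iota> \<B>" and C: "vec.subspace C"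
  shows "q_matroid UNIV (code_rank \<iota> \<B> C)" and "code_rank \<iota> \<B> C UNIV = vec.dim C"
proof -
  note rank = code_rank_eq[OF \<iota> \<B>, where C = C]
  have le: "vec.dim (annihilated \<iota> C X) \<le> vec.dim C" for X :: "('a ^ 'n) set"
    by (rule vec.dim_subset) (auto simp: annihilated_def)
  show "q_matroid UNIV (code_rank \<iota> \<B> C)"
    unfolding q_matroid_def subspace_sum_def[symmetric]
  proof (intro conjI allI impI; (elim conjE)?)
    fix X :: "('a ^ 'n) set" assume X: "vec.subspace X"
    then show "code_rank \<iota> \<B> C X \<le> vec.dim X"
      using dim_annihilated[OF \<iota> C X] by (simp add: rank)
  next
    fix X Y :: "('a ^ 'n) set" assume XY: "vec.subspace X" "vec.subspace Y" "X \<subseteq> Y"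
    have "vec.dim (annihilated \<iota> C Y) \<le> vec.dim (annihilated \<iota> C X)"
      by (rule vec.dim_subset) (use XY(3) in \<open>auto simp: annihilated_def\<close>)
    then show "code_rank \<iota> \<B> C X \<le> code_rank \<iota> \<B> C Y" by (simp add: rank XY)
  next
    fix X Y :: "('a ^ 'n) set" assume X: "vec.subspace X" and Y: "vec.subspace Y"
    let ?A = "annihilated \<iota> C"
    have "subspace_sum X Y = vec.span (X \<union> Y)"
      unfolding span_Un_eq_subspace_sum using X Y by (simp add: span_subspace_eq)
    then have s: "?A (subspace_sum X Y) = ?A X \<inter> ?A Y"
      using annihilated_span[OF \<iota>, of C "X \<union> Y"] by (auto simp: annihilated_def)
    have "subspace_sum (?A X) (?A Y) \<subseteq> ?A (X \<inter> Y)"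
      by (rule subspace_sum_least[OF _ _ subspace_annihilated[OF C]]) (auto simp: annihilated_def)
    then have "vec.dim (subspace_sum (?A X) (?A Y)) \<le> vec.dim (?A (X \<inter> Y))" by (rule vec.dim_subset)
    moreover have "vec.dim (subspace_sum (?A X) (?A Y)) + vec.dim (?A X \<inter> ?A Y) = vec.dim (?A X) + vec.dim (?A Y)"
      unfolding subspace_sum_def by (rule vec.dim_sums_Int[OF subspace_annihilated[OF C] subspace_annihilated[OF C]])
    ultimately show "code_rank \<iota> \<B> C (subspace_sum X Y) + code_rank \<iota> \<B> C (X \<inter> Y) \<le>
      code_rank \<iota> \<B> C X + code_rank \<iota> \<B> C Y"
      using le[of X] le[of Y] le[of "X \<inter> Y"] le[of "subspace_sum X Y"]
      by (simp add: rank X Y subspace_subspace_sum vec.subspace_inter s)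
  qed simp
  \<comment> \<open>Pairing with unit vectors reads off the coordinates, so only the zero word is
    annihilated by the whole space.\<close>
  have "c = 0" if "c \<in> annihilated \<iota> C UNIV" for c
  proof -
    have "c $ i = 0" for i
    proof -
      have "ext_dot \<iota> (axis i 1) c = (\<Sum>j\<in>UNIV. if j = i then c $ j else 0)"
        unfolding ext_dot_def by (intro sum.cong) (auto simp: axis_def field_embedding_simps[OF \<iota>])
      then show ?thesis using that by (simp add: annihilated_def)
    qed
    then show ?thesis by (simp add: vec_eq_iff)
  qed
  then have "annihilated \<iota> C UNIV \<subseteq> {0}" by auto
  then have 0: "vec.dim (annihilated \<iota> C UNIV) = 0" by (simp add: vec.dim_eq_0)
  show "code_rank \<iota> \<B> C UNIV = vec.dim C"
    unfolding rank[OF vec.subspace_UNIV] 0 by (rule diff_zero)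
qed

text \<open>With \<open>D\<close> a code and \<open>\<Theta>\<close> a basis of the extension, this identifies \<open>\<Theta> \<rightarrow> D\<close> with the extended code.\<close>

definition ext_combine :: "('b::field \<Rightarrow> 'c::field) \<Rightarrow> 'c set \<Rightarrow> ('c \<Rightarrow> 'b ^ 'n) \<Rightarrow> 'c ^ 'n" where
  "ext_combine \<kappa> \<Theta> u = (\<chi> j. \<Sum>\<theta>\<in>\<Theta>. \<kappa> (u \<theta> $ j) * \<theta>)"

lemma inj_on_ext_combine:
  fixes \<kappa> :: "'b::field \<Rightarrow> 'c::{field,finite}"
  assumes \<kappa>: "field_embedding \<kappa>" and \<Theta>: "ext_basis \<kappa> \<Theta>"
  shows "inj_on (ext_combine \<kappa> \<Theta>) (PiE \<Theta> (\<lambda>_. D))"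
proof (rule inj_onI)
  fix u v assume u: "u \<in> PiE \<Theta> (\<lambda>_. D)" and v: "v \<in> PiE \<Theta> (\<lambda>_. D)"
    and eq: "ext_combine \<kappa> \<Theta> u = ext_combine \<kappa> \<Theta> v"
  have "u \<theta> = v \<theta>" if "\<theta> \<in> \<Theta>" for \<theta>
  proof -
    have "u \<theta> $ j - v \<theta> $ j = 0" for j
    proof (rule ext_basis_sum_eq_0[OF \<kappa> \<Theta> _ that, where f = "\<lambda>\<theta>. u \<theta> $ j - v \<theta> $ j"])
      have d: "\<kappa> (a - b) = \<kappa> a - \<kappa> b" for a b
        using field_embedding_simps(3)[OF \<kappa>, of "a - b" b] by (simp add: eq_diff_eq)
      have "(\<Sum>\<theta>\<in>\<Theta>. \<kappa> (u \<theta> $ j) * \<theta>) = (\<Sum>\<theta>\<in>\<Theta>. \<kappa> (v \<theta> $ j) * \<theta>)"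
        using eq by (simp add: ext_combine_def vec_eq_iff)
      then show "(\<Sum>\<theta>\<in>\<Theta>. \<kappa> (u \<theta> $ j - v \<theta> $ j) * \<theta>) = 0"
        by (simp add: d left_diff_distrib sum_subtractf)
    qed
    then show ?thesis by (simp add: vec_eq_iff)
  qed
  then show "u = v" using u v by (intro PiE_ext[of u \<Theta> "\<lambda>_. D" v]) auto
qed

lemma ext_combine_image:
  fixes \<kappa> :: "'b::field \<Rightarrow> 'c::{field,finite}" and D :: "('b ^ 'n) set"
  assumes \<kappa>: "field_embedding \<kappa>" and \<Theta>: "ext_basis \<kappa> \<Theta>" and D: "vec.subspace D"
  shows "ext_combine \<kappa> \<Theta> ` PiE \<Theta> (\<lambda>_. D) = extend_code \<kappa> D"
proof
  let ?k = "\<lambda>c :: 'b ^ 'n. (\<chi> j. \<kappa> (c $ j)) :: 'c ^ 'n"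
  note emb = field_embedding_simps[OF \<kappa>]
  show "ext_combine \<kappa> \<Theta> ` PiE \<Theta> (\<lambda>_. D) \<subseteq> extend_code \<kappa> D"
  proof (rule image_subsetI)
    fix u assume u: "u \<in> PiE \<Theta> (\<lambda>_. D)"
    have "ext_combine \<kappa> \<Theta> u = (\<Sum>\<theta>\<in>\<Theta>. \<theta> *s ?k (u \<theta>))"
      by (simp add: ext_combine_def vec_eq_iff mult.commute)
    also have "\<dots> \<in> extend_code \<kappa> D"
      unfolding extend_code_def
      by (intro vec.span_sum vec.span_scale vec.span_base imageI) (use u in auto)
    finally show "ext_combine \<kappa> \<Theta> u \<in> extend_code \<kappa> D" .
  qed
  let ?rep = "module.representation (ext_scale \<kappa>) \<Theta>"
  let ?I = "ext_combine \<kappa> \<Theta> ` PiE \<Theta> (\<lambda>_. D)"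
  have I: "ext_combine \<kappa> \<Theta> u \<in> ?I" if "\<And>\<theta>. u \<theta> \<in> D" for u
  proof (rule image_eqI)
    show "ext_combine \<kappa> \<Theta> u = ext_combine \<kappa> \<Theta> (restrict u \<Theta>)" by (simp add: ext_combine_def)
  qed (use that in auto)
  have ID: "\<exists>u. (\<forall>\<theta>. u \<theta> \<in> D) \<and> z = ext_combine \<kappa> \<Theta> u" if z: "z \<in> ?I" for z
  proof -
    obtain u where u: "u \<in> PiE \<Theta> (\<lambda>_. D)" "z = ext_combine \<kappa> \<Theta> u" using z by blast
    have "z = ext_combine \<kappa> \<Theta> (\<lambda>\<theta>. if \<theta> \<in> \<Theta> then u \<theta> else 0)"
      unfolding u(2) by (simp add: ext_combine_def)
    then show ?thesis using u(1) vec.subspace_0[OF D] by (intro exI[of _ "\<lambda>\<theta>. if \<theta> \<in> \<Theta> then u \<theta> else 0"]) auto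
  qed
  show "extend_code \<kappa> D \<subseteq> ?I"
    unfolding extend_code_def
  proof (rule vec.span_minimal)
    show "?k ` D \<subseteq> ?I"
    proof (rule image_subsetI)
      fix c assume c: "c \<in> D"
      \<comment> \<open>An embedded codeword gets its coordinates by expanding \<open>1\<close> in
        the basis \<open>\<Theta>\<close>.\<close>
      have "(\<Sum>\<theta>\<in>\<Theta>. \<kappa> (?rep 1 \<theta> * a) * \<theta>) = \<kappa> a" for a
      proof -
        have "(\<Sum>\<theta>\<in>\<Theta>. \<kappa> (?rep 1 \<theta> * a) * \<theta>) = \<kappa> a * (\<Sum>\<theta>\<in>\<Theta>. \<kappa> (?rep 1 \<theta>) * \<theta>)"
          by (simp add: emb sum_distrib_left ac_simps)
        then show ?thesis by (simp add: ext_basis_expansion[OF \<kappa> \<Theta>])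
      qed
      then have "?k c = ext_combine \<kappa> \<Theta> (\<lambda>\<theta>. ?rep 1 \<theta> *s c)"
        by (simp add: ext_combine_def vec_eq_iff)
      then show "?k c \<in> ?I" using I[of "\<lambda>\<theta>. ?rep 1 \<theta> *s c"] vec.subspace_scale[OF D c] by simp
    qed
    show "vec.subspace ?I"
      unfolding vec.subspace_def
    proof (intro conjI ballI allI)
      have "ext_combine \<kappa> \<Theta> (\<lambda>_. 0) \<in> ?I" by (rule I) (rule vec.subspace_0[OF D])
      moreover have "ext_combine \<kappa> \<Theta> (\<lambda>_. 0 :: 'b ^ 'n) = 0" by (simp add: ext_combine_def vec_eq_iff emb(1))
      ultimately show "0 \<in> ?I" by simp
    next
      fix y z assume "y \<in> ?I" "z \<in> ?I"
      then obtain u v where uv: "\<And>\<theta>. u \<theta> \<in> D" "\<And>\<theta>. v \<theta> \<in> D"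
        "y = ext_combine \<kappa> \<Theta> u" "z = ext_combine \<kappa> \<Theta> v" using ID by metis
      have "y + z = ext_combine \<kappa> \<Theta> (\<lambda>\<theta>. u \<theta> + v \<theta>)"
        unfolding uv(3,4) by (simp add: ext_combine_def vec_eq_iff emb(3) distrib_right sum.distrib)
      then show "y + z \<in> ?I" using I[of "\<lambda>\<theta>. u \<theta> + v \<theta>"] vec.subspace_add[OF D uv(1,2)] by simp
    next
      fix a y assume "y \<in> ?I"
      then obtain u where u: "\<And>\<theta>. u \<theta> \<in> D" "y = ext_combine \<kappa> \<Theta> u" using ID by metis
      \<comment> \<open>Multiplication by \<open>a\<close> mixes the coordinates over
        \<open>\<Theta>\<close>; the new ones come from expanding each product
        \<open>a * \<theta>\<close>, with coefficients in \<open>'b\<close>, so they stay in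
        \<open>D\<close>.\<close>
      let ?v = "\<lambda>\<theta>'. \<Sum>\<theta>\<in>\<Theta>. ?rep (a * \<theta>) \<theta>' *s u \<theta>"
      have "(a *s y) $ j = ext_combine \<kappa> \<Theta> ?v $ j" for j
      proof -
        have "(a *s y) $ j = (\<Sum>\<theta>\<in>\<Theta>. \<kappa> (u \<theta> $ j) * (a * \<theta>))"
          unfolding u(2) by (simp add: ext_combine_def sum_distrib_left ac_simps)
        also have "\<dots> = (\<Sum>\<theta>\<in>\<Theta>. \<Sum>\<theta>'\<in>\<Theta>. \<kappa> (u \<theta> $ j) * (\<kappa> (?rep (a * \<theta>) \<theta>') * \<theta>'))"
          by (simp add: ext_basis_expansion[OF \<kappa> \<Theta>] flip: sum_distrib_left)
        also have "\<dots> = (\<Sum>\<theta>'\<in>\<Theta>. \<Sum>\<theta>\<in>\<Theta>. \<kappa> (u \<theta> $ j) * (\<kappa> (?rep (a * \<theta>) \<theta>') * \<theta>'))"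
          by (rule sum.swap)
        also have "\<dots> = ext_combine \<kappa> \<Theta> ?v $ j"
          by (simp add: ext_combine_def emb sum_distrib_right sum_distrib_left ac_simps)
        finally show ?thesis .
      qed
      then have "a *s y = ext_combine \<kappa> \<Theta> ?v" by (simp add: vec_eq_iff)
      moreover have "?v \<theta>' \<in> D" for \<theta>'
        by (intro vec.subspace_sum[OF D] vec.subspace_scale[OF D] u(1))
      ultimately show "a *s y \<in> ?I" using I[of ?v] by simp
    qed
  qed
qed

lemma ext_dot_ext_combine:
  assumes \<kappa>: "field_embedding \<kappa>"
  shows "ext_dot (\<kappa> \<circ> \<iota>) y (ext_combine \<kappa> \<Theta> u) = (\<Sum>\<theta>\<in>\<Theta>. \<kappa> (ext_dot \<iota> y (u \<theta>)) * \<theta>)"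
proof -
  have "ext_dot (\<kappa> \<circ> \<iota>) y (ext_combine \<kappa> \<Theta> u) = (\<Sum>j\<in>UNIV. \<Sum>\<theta>\<in>\<Theta>. \<kappa> (\<iota> (y $ j)) * (\<kappa> (u \<theta> $ j) * \<theta>))"
    by (simp add: ext_dot_def ext_combine_def sum_distrib_left)
  also have "\<dots> = (\<Sum>\<theta>\<in>\<Theta>. \<Sum>j\<in>UNIV. \<kappa> (\<iota> (y $ j)) * (\<kappa> (u \<theta> $ j) * \<theta>))"
    by (rule sum.swap)
  finally show ?thesis
    by (simp add: ext_dot_def field_embedding_simps[OF \<kappa>] sum_distrib_right mult.assoc)
qed

text \<open>The equations have coefficients in the smallest field, so they hold for an extended word
  exactly when they hold for each of its coordinates over \<open>\<Theta>\<close>: the subcode of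
  the extension is the extension of the subcode.\<close>

lemma card_annihilated_extend_code:
  fixes \<kappa> :: "'b::{field,finite} \<Rightarrow> 'c::{field,finite}" and \<iota> :: "'a::field \<Rightarrow> 'b"
  assumes \<kappa>: "field_embedding \<kappa>" and C: "vec.subspace C"
  shows "card (annihilated (\<kappa> \<circ> \<iota>) (extend_code \<kappa> C) X) = CARD('c) ^ vec.dim (annihilated \<iota> C X)"
proof -
  obtain \<Theta> where \<Theta>: "ext_basis \<kappa> \<Theta>" using ext_basis_exists[OF \<kappa>] by blast
  let ?K = "annihilated \<iota> C X"
  have "annihilated (\<kappa> \<circ> \<iota>) (extend_code \<kappa> C) X = ext_combine \<kappa> \<Theta> ` PiE \<Theta> (\<lambda>_. ?K)"
  proof (intro equalityI subsetI)
    fix z assume z: "z \<in> annihilated (\<kappa> \<circ> \<iota>) (extend_code \<kappa> C) X"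
    then have "z \<in> ext_combine \<kappa> \<Theta> ` PiE \<Theta> (\<lambda>_. C)"
      unfolding ext_combine_image[OF \<kappa> \<Theta> C] by (simp add: annihilated_def)
    then obtain u where u: "u \<in> PiE \<Theta> (\<lambda>_. C)" "z = ext_combine \<kappa> \<Theta> u" by blast
    have "ext_dot \<iota> x (u \<theta>) = 0" if "x \<in> X" "\<theta> \<in> \<Theta>" for x \<theta>
    proof (rule ext_basis_sum_eq_0[OF \<kappa> \<Theta> _ that(2), where f = "\<lambda>\<theta>. ext_dot \<iota> x (u \<theta>)"])
      show "(\<Sum>\<theta>\<in>\<Theta>. \<kappa> (ext_dot \<iota> x (u \<theta>)) * \<theta>) = 0"
        using z that(1) unfolding ext_dot_ext_combine[OF \<kappa>, symmetric] u(2) by (simp add: annihilated_def)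
    qed
    then have "u \<in> PiE \<Theta> (\<lambda>_. ?K)" using u(1) by (auto simp: annihilated_def PiE_iff)
    then show "z \<in> ext_combine \<kappa> \<Theta> ` PiE \<Theta> (\<lambda>_. ?K)" using u(2) by blast
  next
    fix z assume "z \<in> ext_combine \<kappa> \<Theta> ` PiE \<Theta> (\<lambda>_. ?K)"
    then obtain u where u: "u \<in> PiE \<Theta> (\<lambda>_. ?K)" "z = ext_combine \<kappa> \<Theta> u" by blast
    have "u \<in> PiE \<Theta> (\<lambda>_. C)" using u(1) by (auto simp: annihilated_def PiE_iff)
    then have "z \<in> extend_code \<kappa> C" unfolding ext_combine_image[OF \<kappa> \<Theta> C, symmetric] u(2) by blast
    moreover have "ext_dot (\<kappa> \<circ> \<iota>) x z = 0" if "x \<in> X" for x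
      unfolding u(2) ext_dot_ext_combine[OF \<kappa>]
      by (rule sum.neutral) (use u(1) that in \<open>auto simp: annihilated_def PiE_iff field_embedding_simps(1)[OF \<kappa>]\<close>)
    ultimately show "z \<in> annihilated (\<kappa> \<circ> \<iota>) (extend_code \<kappa> C) X" by (simp add: annihilated_def)
  qed
  then have "card (annihilated (\<kappa> \<circ> \<iota>) (extend_code \<kappa> C) X) = card ?K ^ card \<Theta>"
    by (simp add: card_image[OF inj_on_ext_combine[OF \<kappa> \<Theta>]] card_PiE)
  also have "\<dots> = (CARD('b) ^ card \<Theta>) ^ vec.dim ?K"
    by (simp add: card_subspace[OF subspace_annihilated[OF C]] mult.commute flip: power_mult)
  \<comment> \<open>Coordinates over \<open>\<Theta>\<close> identify \<open>'c\<close> with the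
    functions from \<open>\<Theta>\<close> to \<open>'b\<close>.\<close>
  also have "CARD('b) ^ card \<Theta> = CARD('c)"
  proof -
    let ?f = "\<lambda>u. \<Sum>\<theta>\<in>\<Theta>. \<kappa> (u \<theta>) * \<theta>"
    have d: "\<kappa> (a - b) = \<kappa> a - \<kappa> b" for a b
      using field_embedding_simps(3)[OF \<kappa>, of "a - b" b] by (simp add: eq_diff_eq)
    have inj: "inj_on ?f (PiE \<Theta> (\<lambda>_. UNIV))"
    proof (rule inj_onI)
      fix u v assume u: "u \<in> PiE \<Theta> (\<lambda>_. UNIV)" and v: "v \<in> PiE \<Theta> (\<lambda>_. UNIV)" and eq: "?f u = ?f v"
      have "u \<theta> - v \<theta> = 0" if "\<theta> \<in> \<Theta>" for \<theta>
        by (rule ext_basis_sum_eq_0[OF \<kappa> \<Theta> _ that, where f = "\<lambda>\<theta>. u \<theta> - v \<theta>"])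
          (use eq in \<open>simp add: d left_diff_distrib sum_subtractf\<close>)
      then show "u = v" using u v by (intro PiE_ext[of u \<Theta> "\<lambda>_. UNIV" v]) auto
    qed
    have "?f ` PiE \<Theta> (\<lambda>_. UNIV) = UNIV"
    proof (intro equalityI subsetI UNIV_I)
      fix x :: 'c
      let ?u = "restrict (module.representation (ext_scale \<kappa>) \<Theta> x) \<Theta>"
      show "x \<in> ?f ` PiE \<Theta> (\<lambda>_. UNIV)"
      proof (rule image_eqI[where f = ?f and x = ?u])
        show "x = ?f ?u" using ext_basis_expansion[OF \<kappa> \<Theta>, of x] by simp
      qed simp
    qed
    then have "card (PiE \<Theta> (\<lambda>_. UNIV :: 'b set)) = CARD('c)" using card_image[OF inj] by simp
    then show ?thesis by (simp add: card_PiE)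
  qed
  finally show ?thesis .
qed

text \<open>Words with support inside \<open>V\<close> form a subcode and are easy to count. Words
  with support exactly \<open>U\<close> are the Moebius inverse of that count, which
  \<open>subspace_moebius_unique\<close> identifies with the one arising from the matroid.\<close>

lemma rank_weight_count_eq:
  fixes \<iota> :: "'a::{field,finite} \<Rightarrow> 'b::{field,finite}" and \<kappa> :: "'b \<Rightarrow> 'c::{field,finite}"
    and C :: "('b ^ 'n) set"
  assumes \<iota>: "field_embedding \<iota>" and \<kappa>: "field_embedding \<kappa>"
    and \<B>: "ext_basis \<iota> \<B>" and \<B>': "ext_basis (\<kappa> \<circ> \<iota>) \<B>'" and C: "vec.subspace C"
  shows "int (rank_weight_count (\<kappa> \<circ> \<iota>) \<B>' (extend_code \<kappa> C) s) =
    (\<Sum>U | vec.subspace U \<and> vec.dim U = s. span_superset_sum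
      (\<lambda>Y. int CARD('c) ^ (vec.dim C - code_rank \<iota> \<B> C Y)) UNIV (points (perp std_dot UNIV U)))"
proof -
  interpret G: inner_space "std_dot :: 'a ^ 'n \<Rightarrow> _" UNIV by (rule inner_space_std_dot)
  let ?P = "perp (std_dot :: 'a ^ 'n \<Rightarrow> _) UNIV"
  let ?S = "\<lambda>c. Rsupp (\<kappa> \<circ> \<iota>) \<B>' c :: ('a ^ 'n) set"
  let ?C = "extend_code \<kappa> C"
  let ?h = "\<lambda>Y. int CARD('c) ^ (vec.dim C - code_rank \<iota> \<B> C Y)"
  have \<kappa>\<iota>: "field_embedding (\<kappa> \<circ> \<iota>)" by (rule field_embedding_comp[OF \<iota> \<kappa>])
  have S: "vec.subspace (?S c)" for c by (simp add: Rsupp_def)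
  have fibre: "int (card {c \<in> ?C. ?S c = U}) = span_superset_sum ?h UNIV (points (?P U))"
    if "vec.subspace U" for U
  proof (rule subspace_moebius_unique[where U = UNIV and V = U
        and a = "\<lambda>U. int (card {c \<in> ?C. ?S c = U})"
        and b = "\<lambda>U. span_superset_sum ?h UNIV (points (?P U))"])
    fix V :: "('a ^ 'n) set" assume V: "vec.subspace V"
    have PV: "vec.subspace (?P V)" by (rule G.subspace_perp[OF subset_UNIV])
    have "card (\<Union>X\<in>{X. vec.subspace X \<and> X \<subseteq> V}. {c \<in> ?C. ?S c = X}) =
      (\<Sum>X | vec.subspace X \<and> X \<subseteq> V. card {c \<in> ?C. ?S c = X})"
      by (rule card_UN_disjoint) auto
    moreover have "(\<Union>X\<in>{X. vec.subspace X \<and> X \<subseteq> V}. {c \<in> ?C. ?S c = X}) = {c \<in> ?C. ?S c \<subseteq> V}"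
      using S by auto
    ultimately have "(\<Sum>X | vec.subspace X \<and> X \<subseteq> V. int (card {c \<in> ?C. ?S c = X})) = int (card {c \<in> ?C. ?S c \<subseteq> V})"
      by simp
    also have "{c \<in> ?C. ?S c \<subseteq> V} = annihilated (\<kappa> \<circ> \<iota>) ?C (?P V)"
      by (simp add: annihilated_def Rsupp_subset_iff[OF \<kappa>\<iota> \<B>' V])
    also have "int (card \<dots>) = int CARD('c) ^ vec.dim (annihilated \<iota> C (?P V))"
      by (simp add: card_annihilated_extend_code[OF \<kappa> C])
    also have "vec.dim (annihilated \<iota> C (?P V)) = vec.dim C - code_rank \<iota> \<B> C (?P V)"
      using vec.dim_subset[of "annihilated \<iota> C (?P V)" C]
      by (simp add: code_rank_eq[OF \<iota> \<B> PV] annihilated_def)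
    also have "?h (?P V) = (\<Sum>X | vec.subspace X \<and> X \<subseteq> V. span_superset_sum ?h UNIV (points (?P X)))"
      by (rule sum_span_superset_sum_perp[OF G.inner_space_axioms V subset_UNIV, symmetric])
    finally show "(\<Sum>X | vec.subspace X \<and> X \<subseteq> V. int (card {c \<in> ?C. ?S c = X})) =
      (\<Sum>X | vec.subspace X \<and> X \<subseteq> V. span_superset_sum ?h UNIV (points (?P X)))" .
  qed (use that in auto)
  have "card (\<Union>U\<in>{U. vec.subspace U \<and> vec.dim U = s}. {c \<in> ?C. ?S c = U}) =
    (\<Sum>U | vec.subspace U \<and> vec.dim U = s. card {c \<in> ?C. ?S c = U})"
    by (rule card_UN_disjoint) auto
  moreover have "(\<Union>U\<in>{U. vec.subspace U \<and> vec.dim U = s}. {c \<in> ?C. ?S c = U}) = {c \<in> ?C. vec.dim (?S c) = s}"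
    using S by auto
  ultimately have "int (rank_weight_count (\<kappa> \<circ> \<iota>) \<B>' ?C s) =
    (\<Sum>U | vec.subspace U \<and> vec.dim U = s. int (card {c \<in> ?C. ?S c = U}))"
    by (simp add: rank_weight_count_def)
  also have "\<dots> = (\<Sum>U | vec.subspace U \<and> vec.dim U = s. span_superset_sum ?h UNIV (points (?P U)))"
    by (rule sum.cong) (auto simp: fibre)
  finally show ?thesis .
qed

theorem theorem5p12:
  fixes \<rho> :: "('a::{field,finite} ^ 'n) set \<Rightarrow> nat"
    and B :: "('a ^ 'n) set \<Rightarrow> ('a ^ 'n) set"
    and \<iota> :: "'a \<Rightarrow> 'b::{field,finite}"
    and \<kappa> :: "'b \<Rightarrow> 'c::{field,finite}"
    and \<B> :: "'b set" and \<B>' :: "'c set"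
    and C :: "('b ^ 'n) set"
    and k q n m r s :: nat
  assumes "q = CARD('a)" and "n = CARD('n)" and "s \<le> n"
  shows
    "(q_matroid UNIV \<rho> \<and> k = \<rho> UNIV \<and> basis_family B \<longrightarrow>
       (let N = mdual (Cl UNIV \<rho>) in
        gen_weight_poly B \<rho> s =
          (\<Sum>l=0..k. \<Sum>i=0..k. monom ((-1) ^ i *
             (elongation_betti TYPE('k::field) (int l) N i (q_bracket q n s) -
              elongation_betti TYPE('k) (int l - 1) N i (q_bracket q n s))) l))) \<and>
     (m \<ge> 1 \<and> r \<ge> 1 \<and> CARD('b) = q ^ m \<and> CARD('c) = q ^ (m * r) \<and>
      field_embedding \<iota> \<and> field_embedding \<kappa> \<and>
      ext_basis \<iota> \<B> \<and> ext_basis (\<kappa> \<circ> \<iota>) \<B>' \<and>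
      vec.subspace C \<and> vec.dim C = k \<longrightarrow>
       (let N = mdual (Cl UNIV (code_rank \<iota> \<B> C)) in
        int (rank_weight_count (\<kappa> \<circ> \<iota>) \<B>' (extend_code \<kappa> C) s) =
          (\<Sum>l=0..k. \<Sum>i=0..k. (-1) ^ i *
             (elongation_betti TYPE('k) (int l) N i (q_bracket q n s) -
              elongation_betti TYPE('k) (int l - 1) N i (q_bracket q n s)) *
             int (q ^ (m * r)) ^ l)))"
proof (intro conjI impI; elim conjE)
  assume M: "q_matroid UNIV \<rho>" and k: "k = \<rho> UNIV" and B: "basis_family B"
  let ?N = "mdual (Cl UNIV \<rho>)" and ?j = "q_bracket q n s"
  let ?e = "\<lambda>l i. (-1) ^ i * (elongation_betti TYPE('k) (int l) ?N i ?j -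
    elongation_betti TYPE('k) (int l - 1) ?N i ?j)"
  \<comment> \<open>\<open>monom 1 1\<close> is the indeterminate; this puts the polynomial into the
    form of \<open>sum_elongation_betti_power\<close>.\<close>
  have mono: "monom c l = of_int c * monom 1 1 ^ l" for c :: int and l
    by (simp add: monom_power of_int_poly smult_monom)
  have "(\<Sum>l=0..k. \<Sum>i=0..k. monom (?e l i) l) = (\<Sum>l=0..k. \<Sum>i=0..k. of_int (?e l i) * monom 1 1 ^ l)"
    by (intro sum.cong refl mono)
  also have "\<dots> = (\<Sum>l=0..k. of_int (\<Sum>i=0..k. ?e l i) * monom 1 1 ^ l)"
    by (simp only: sum_distrib_right of_int_sum)
  also have "\<dots> = gen_weight_poly B \<rho> s"
    unfolding k sum_elongation_betti_power[OF M] assms(1,2) gen_weight_poly_eq[OF M B]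
    by (rule sum_span_superset_sum_card) (use assms in simp)
  finally show "let N = ?N in gen_weight_poly B \<rho> s =
    (\<Sum>l=0..k. \<Sum>i=0..k. monom ((-1) ^ i * (elongation_betti TYPE('k) (int l) N i ?j -
      elongation_betti TYPE('k) (int l - 1) N i ?j)) l)" by (simp only: Let_def)
next
  assume card_c: "CARD('c) = q ^ (m * r)"
    and emb: "field_embedding \<iota>" "field_embedding \<kappa>" "ext_basis \<iota> \<B>" "ext_basis (\<kappa> \<circ> \<iota>) \<B>'"
    and C: "vec.subspace C" "vec.dim C = k"
  let ?\<rho> = "code_rank \<iota> \<B> C"
  let ?N = "mdual (Cl UNIV ?\<rho>)" and ?j = "q_bracket q n s"
  let ?e = "\<lambda>l i. (-1) ^ i * (elongation_betti TYPE('k) (int l) ?N i ?j -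
    elongation_betti TYPE('k) (int l - 1) ?N i ?j)"
  have M: "q_matroid UNIV ?\<rho>" and k: "k = ?\<rho> UNIV"
    using q_matroid_code_rank[OF emb(1,3) C(1)] C(2) by simp_all
  have "(\<Sum>l=0..k. \<Sum>i=0..k. ?e l i * int (q ^ (m * r)) ^ l) =
    (\<Sum>l=0..k. of_int (\<Sum>i=0..k. ?e l i) * int CARD('c) ^ l)"
    by (simp add: sum_distrib_right card_c)
  also have "\<dots> = (\<Sum>\<sigma> | \<sigma> \<subseteq> points UNIV \<and> card \<sigma> = ?j.
    span_superset_sum (\<lambda>Y. int CARD('c) ^ (?\<rho> UNIV - ?\<rho> Y)) UNIV (points UNIV - \<sigma>))"
    unfolding k by (rule sum_elongation_betti_power[OF M])
  also have "\<dots> = (\<Sum>U | vec.subspace U \<and> vec.dim U = s.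
    span_superset_sum (\<lambda>Y. int CARD('c) ^ (?\<rho> UNIV - ?\<rho> Y)) UNIV (points (perp std_dot UNIV U)))"
    unfolding assms(1,2) by (rule sum_span_superset_sum_card) (use assms in simp)
  also have "\<dots> = int (rank_weight_count (\<kappa> \<circ> \<iota>) \<B>' (extend_code \<kappa> C) s)"
    unfolding rank_weight_count_eq[OF emb C(1)] C(2) k ..
  finally show "let N = ?N in int (rank_weight_count (\<kappa> \<circ> \<iota>) \<B>' (extend_code \<kappa> C) s) =
    (\<Sum>l=0..k. \<Sum>i=0..k. (-1) ^ i * (elongation_betti TYPE('k) (int l) N i ?j -
      elongation_betti TYPE('k) (int l - 1) N i ?j) * int (q ^ (m * r)) ^ l)" by (simp only: Let_def)
qed

end
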